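(* For every $\beta\ge 1$ there exist a real sequence $(\varepsilon_N)$ with $\varepsilon_N\to 0$ as $N\to\infty$ and a constant $C>0$ such that the following holds for every integer $N\ge 512$ and all parameters $p_T,p_\Omega\in[0,1]$ with $\min(\mathbf{E}|T|,\mathbf{E}|\Omega|)\ge 4(\beta+1)\log N$ and $$\mathbf{E}|T|+\mathbf{E}|\Omega|\;\le\;\frac{N}{(\beta+1)\log N}\cdot\bigl(1/8+\varepsilon_N\bigr).$$ Let $f=\Phi\alpha$ be a random signal, where the random support $\Gamma=T\cup\Omega$ and the random coefficient vector $\alpha$ supported on $\Gamma$ are sampled according to the probability model. Then with probability at least $1-C(\log N)\cdot N^{-\beta}$, the solutions of $$(P_1)\quad \min_{\alpha'\in\mathbb{C}^{2N}}\|\alpha'\|_{\ell_1}\ \text{ subject to }\ \Phi\alpha'=f\qquad\text{and}\qquad (P_0)\quad \min_{\alpha'\in\mathbb{C}^{2N}}\|\alpha'\|_{\ell_0}\ \text{ subject to }\ \Phi\alpha'=f$$ are identical and equal to $\alpha$ (i.e. $\alpha$ is the unique minimizer of each program).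
   Context: The time-frequency dictionary is the $N\times 2N$ matrix $\Phi=(I\;\;F^* )$, where $I$ is the identity (spike basis) and $F$ is the unitary discrete Fourier matrix, $(Ff)(\omega)=\hat f(\omega)=\frac1{\sqrt N}\sum_{t=0}^{N-1}f(t)e^{-i2\pi\omega t/N}$. So for $\alpha=(\alpha_1,\alpha_2)\in\mathbb{C}^{2N}$, $(\Phi\alpha)(s)=\alpha_1(s)+\frac1{\sqrt N}\sum_{\omega}\alpha_2(\omega)e^{i2\pi\omega s/N}$. Also $\|\alpha\|_{\ell_0}$ is the number of nonzero entries of $\alpha$ and $\|\alpha\|_{\ell_1}=\sum_\gamma|\alpha(\gamma)|$. Probability model: let $I_1(t)$, $t=0,\dots,N-1$, and $I_2(\omega)$, $\omega=0,\dots,N-1$, be two independent sequences of i.i.d. Bernoulli random variables with parameters $p_T$ and $p_\Omega$ respectively; $T=\{t:I_1(t)=1\}$, $\Omega=\{\omega:I_2(\omega)=1\}$, so $\mathbf{E}|T|=p_TN$, $\mathbf{E}|\Omega|=p_\Omega N$. The set $\Gamma=T\cup\Omega$ is viewed as a subset of the $2N$ column indices of $\Phi$ (a disjoint union: $T$ among the first $N$ indices, $\Omega$ among the last $N$), so $|\Gamma|=|T|+|\Omega|$. Given $(T,\Omega)$, the coefficients $\{\alpha(\gamma),\gamma\in\Gamma\}$ are i.i.d. draws from a continuous probability distribution on $\mathbb{C}$ (one having a density) that is circularly symmetric (the phase of $\alpha(\gamma)$ is uniform on $[0,2\pi)$), and $\alpha(\gamma)=0$ for $\gamma\notin\Gamma$.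 $\log$ is the natural logarithm. *)

theory Defs
  imports "HOL-Probability.Probability"
begin

text \<open>
  The \<open>2 N\<close> column indices of the dictionary: \<open>Inl t\<close> is the spike at time \<open>t\<close>, \<open>Inr \<omega>\<close> the
  sinusoid of frequency \<open>\<omega>\<close>.  Vectors over a finite index set \<open>J\<close> are the extensional functions
  \<open>J \<rightarrow>\<^sub>E UNIV\<close>, so that equality of vectors is equality of functions.
\<close>

definition indices :: "nat \<Rightarrow> (nat + nat) set" where
  "indices N = {..<N} <+> {..<N}"

definition coeff_space :: "nat \<Rightarrow> (nat + nat \<Rightarrow> complex) set" where
  "coeff_space N = indices N \<rightarrow>\<^sub>E UNIV"

definition dft :: "nat \<Rightarrow> nat \<Rightarrow> nat \<Rightarrow> complex" where
  "dft N \<omega> t = exp (- (\<i> * complex_of_real (2 * pi * real \<omega> * real t / real N))) / complex_of_real (sqrt (real N))"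

text \<open>The entries of \<open>\<Phi> = (I F\<^sup>*)\<close>, where \<open>F\<^sup>*\<close> is the conjugate transpose of \<open>F\<close>.\<close>

definition dictionary :: "nat \<Rightarrow> nat \<Rightarrow> nat + nat \<Rightarrow> complex" where
  "dictionary N s \<gamma> = (case \<gamma> of Inl t \<Rightarrow> (if s = t then 1 else 0) | Inr \<omega> \<Rightarrow> cnj (dft N \<omega> s))"

definition synthesis :: "nat \<Rightarrow> (nat + nat \<Rightarrow> complex) \<Rightarrow> nat \<Rightarrow> complex" where
  "synthesis N \<alpha> = (\<lambda>s\<in>{..<N}. \<Sum>\<gamma>\<in>indices N. dictionary N s \<gamma> * \<alpha> \<gamma>)"

definition l0_norm :: "nat \<Rightarrow> (nat + nat \<Rightarrow> complex) \<Rightarrow> nat" where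
  "l0_norm N \<alpha> = card {\<gamma>\<in>indices N. \<alpha> \<gamma> \<noteq> 0}"

definition l1_norm :: "nat \<Rightarrow> (nat + nat \<Rightarrow> complex) \<Rightarrow> real" where
  "l1_norm N \<alpha> = (\<Sum>\<gamma>\<in>indices N. cmod (\<alpha> \<gamma>))"

definition P1_solutions :: "nat \<Rightarrow> (nat \<Rightarrow> complex) \<Rightarrow> (nat + nat \<Rightarrow> complex) set" where
  "P1_solutions N f =
    {\<alpha>. is_arg_min (l1_norm N) (\<lambda>\<alpha>'. \<alpha>' \<in> coeff_space N \<and> synthesis N \<alpha>' = f) \<alpha>}"

definition P0_solutions :: "nat \<Rightarrow> (nat \<Rightarrow> complex) \<Rightarrow> (nat + nat \<Rightarrow> complex) set" where
  "P0_solutions N f =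
    {\<alpha>. is_arg_min (l0_norm N) (\<lambda>\<alpha>'. \<alpha>' \<in> coeff_space N \<and> synthesis N \<alpha>' = f) \<alpha>}"

definition random_set :: "nat \<Rightarrow> real \<Rightarrow> nat set pmf" where
  "random_set N p = map_pmf (\<lambda>I. {t. I t}) (Pi_pmf {..<N} False (\<lambda>_. bernoulli_pmf p))"

definition expected_card :: "nat \<Rightarrow> real \<Rightarrow> real" where
  "expected_card N p = measure_pmf.expectation (random_set N p) (\<lambda>T. real (card T))"

text \<open>
  A distribution on the complex plane with a density and uniform phase.  No independence of phase
  and modulus is required, so every rotation invariant distribution with a density is covered.
  The value \<open>Arg2pi 0 = 0\<close> is irrelevant because the origin is a null set.
\<close>

definition continuous_circular :: "complex measure \<Rightarrow> bool" where
  "continuous_circular \<nu> \<longleftrightarrow>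
    prob_space \<nu> \<and>
    (\<exists>g\<in>borel_measurable lborel. \<nu> = density lborel g) \<and>
    distr \<nu> borel Arg2pi = uniform_measure lborel {0..<2 * pi}"

text \<open>
  The law of the coefficient vector: draw independent supports \<open>T\<close> and \<open>\<Omega>\<close>; given these, the entries
  on \<open>\<Gamma> = T <+> \<Omega>\<close> are independent with law \<open>\<nu>\<close>, and the remaining entries are \<open>0\<close> (point masses).
\<close>

definition coeff_given_support ::
    "nat \<Rightarrow> complex measure \<Rightarrow> nat set \<times> nat set \<Rightarrow> (nat + nat \<Rightarrow> complex) measure" where
  "coeff_given_support N \<nu> =
    (\<lambda>(T, \<Omega>). \<Pi>\<^sub>M \<gamma>\<in>indices N. if \<gamma> \<in> T <+> \<Omega> then \<nu> else return borel 0)"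

definition coeff_law ::
    "nat \<Rightarrow> real \<Rightarrow> real \<Rightarrow> complex measure \<Rightarrow> (nat + nat \<Rightarrow> complex) measure" where
  "coeff_law N p\<^sub>T p\<^sub>\<Omega> \<nu> =
    measure_pmf (pair_pmf (random_set N p\<^sub>T) (random_set N p\<^sub>\<Omega>)) \<bind> coeff_given_support N \<nu>"

end

theory Submission
  imports Defs "HOL-Library.Function_Algebras" "HOL-Real_Asymp.Real_Asymp"
begin

text \<open>
  Fix the support \<open>\<Gamma> = T <+> \<Omega>\<close> and let \<open>\<Phi>\<^sub>\<Gamma>\<close> be the matrix of the atoms in \<open>\<Gamma>\<close>.  For an atom
  \<open>\<phi>\<^sub>\<gamma>\<close> outside the support let \<open>a\<^sub>\<gamma>\<close> be the coefficients of its orthogonal projection onto the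
  range of \<open>\<Phi>\<^sub>\<Gamma>\<close>.  If \<open>\<Phi> h = 0\<close>, then on \<open>\<Gamma>\<close> the vector \<open>h\<close> equals \<open>- \<Sum> h \<gamma> * a\<^sub>\<gamma>\<close>, the sum over the
  outer \<open>\<gamma>\<close>, so passing from \<open>\<alpha>\<close> to \<open>\<alpha> + h\<close> raises the \<open>\<ell>\<^sub>1\<close> norm by at least
  \<open>\<Sum> |h \<gamma>| * (1 - |\<langle>sgn \<alpha>, a\<^sub>\<gamma>\<rangle>|)\<close>.  Thus \<open>\<alpha>\<close> is the only minimizer of \<open>(P\<^sub>1)\<close> once
  \<open>|\<langle>sgn \<alpha>, a\<^sub>\<gamma>\<rangle>| < 1\<close> for all outer \<open>\<gamma>\<close> (\<open>l1_unique\<close>).  The signs are independent with mean zero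
  and modulus one, so by Hoeffding's inequality this fails for a given \<open>\<gamma>\<close> with probability at
  most \<open>4 * exp (- 1 / (4 * \<parallel>a\<^sub>\<gamma>\<parallel>\<^sup>2))\<close> (\<open>prob_phase_sum_norm_ge\<close>).

  The vector \<open>a\<^sub>\<gamma>\<close> is the Gram matrix inverted on the correlations of \<open>\<phi>\<^sub>\<gamma>\<close> with the atoms of \<open>\<Gamma>\<close>.
  These have square sum \<open>|T| / N\<close> or \<open>|\<Omega>| / N\<close>, and the Gram matrix is the identity plus the
  partial Fourier matrix between \<open>T\<close> and \<open>\<Omega>\<close> in the off-diagonal blocks.  If that matrix has norm
  at most \<open>1 / 8\<close> and both sets have at most \<open>R * N\<close> elements with
  \<open>R = 3 / (16 * (\<beta> + 1) * ln N)\<close>, then \<open>\<parallel>a\<^sub>\<gamma>\<parallel>\<^sup>2 \<le> 64 / 49 * R\<close>, and the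
  \<open>2 * N\<close> exceptional events together have probability at most \<open>8 * N powr - \<beta>\<close>.  The value of \<open>R\<close>
  exceeds the largest admissible value of \<open>p\<^sub>T\<close> and \<open>p\<^sub>\<Omega>\<close> by the factor \<open>3 / 2\<close>, so the sizes are
  controlled by Hoeffding's inequality for binomial variables.

  The norm of the partial Fourier matrix is bounded by the moment method.  Let \<open>v\<^sub>\<omega>\<close> be the row of
  frequency \<open>\<omega>\<close> restricted to \<open>T\<close>, and \<open>A = \<Sum>\<omega>\<in>\<Omega>. v\<^sub>\<omega> v\<^sub>\<omega>\<^sup>*\<close>.  Singling out one factor in the
  expected trace of \<open>A ^ (m + 1)\<close> gives \<open>p * \<Sum>\<omega>. E \<langle>v\<^sub>\<omega>, (A + v\<^sub>\<omega> v\<^sub>\<omega>\<^sup>*) ^ m v\<^sub>\<omega>\<rangle>\<close>, where \<open>\<omega>\<close> does not occur in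
  \<open>A\<close>.  The numbers \<open>\<langle>v, A ^ j v\<rangle>\<close> form a log-convex sequence, and this makes it legitimate to replace
  the rank one term by the scalar \<open>\<parallel>v\<^sub>\<omega>\<parallel>\<^sup>2 \<le> R\<close> (\<open>renewal_bound\<close>).  Since the \<open>v\<^sub>\<omega>\<close> over all \<open>\<omega>\<close>
  form a Parseval frame, the recursion closes: with \<open>M m\<close> the expected trace,
  \<open>M (m + 1) \<le> p * (\<Sum>i\<le>m. (m choose i) * R ^ i * M (m - i))\<close> (\<open>expected_walk_trace_Suc_le\<close>), which
  is the recursion for the moments of \<open>R\<close> times a Poisson variable of mean \<open>p / R\<close>.  At order
  \<open>k \<approx> (\<beta> + 1) * ln N\<close> the product \<open>k * R\<close> is bounded while \<open>p\<close> tends to zero, hence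
  \<open>M k \<le> N * q ^ k\<close> for the fixed number \<open>q = 1 / (64 * e)\<close> and large \<open>N\<close>, and Markov's inequality
  concludes.

  For \<open>(P\<^sub>0)\<close>, a competing set \<open>\<Gamma>'\<close> of at most \<open>|\<Gamma>|\<close> atoms that is not contained in \<open>\<Gamma>\<close> cannot span
  all atoms of \<open>\<Gamma>\<close>, so some linear functional vanishes on the range of \<open>\<Phi>\<^sub>\<Gamma>\<^sub>'\<close> but not identically on
  the range of \<open>\<Phi>\<^sub>\<Gamma>\<close> (\<open>separating_functional\<close>).  As the coefficients have a density, it is nonzero
  at \<open>\<Phi> \<alpha>\<close> almost surely.

  The sequence \<open>\<epsilon> = 0\<close> serves, and a large \<open>C\<close> makes the claim trivial for small \<open>N\<close>.
\<close>

section \<open>Log-convex sequences and renewal inequalities\<close>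

text \<open>
  Log-convexity says that the ratios \<open>b (Suc j) / b j\<close> increase, so mass may be moved from the
  smaller index to the larger one.  The form \<open>b (Suc i) * b j \<le> b i * b (Suc j)\<close> of this fact also
  covers vanishing terms.
\<close>

lemma log_convex_mult_le:
  fixes b :: "nat \<Rightarrow> real"
  assumes nonneg: "\<And>j. b j \<ge> 0" and log_convex: "\<And>j. (b (Suc j))\<^sup>2 \<le> b j * b (Suc (Suc j))"
  shows "b i * b j \<le> b 0 * b (i + j)"
proof -
  have ratio: "b (Suc i) * b j \<le> b i * b (Suc j)" if "i \<le> j" for i j
    using that
  proof (induction j rule: dec_induct)
    case base
    then show ?case by simp
  next
    case (step j)
    show ?case
    proof (cases "b (Suc j) = 0")
      case True
      then show ?thesis using nonneg by simp
    next
      case False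
      then have pos: "b (Suc j) > 0" using nonneg[of "Suc j"] by simp
      have "b j \<noteq> 0"
      proof
        assume "b j = 0"
        with log_convex[of j] have "(b (Suc j))\<^sup>2 \<le> 0" by simp
        with False show False by simp
      qed
      then have bj: "b j > 0" using nonneg[of j] by simp
      have "b j * (b (Suc i) * b (Suc j)) = b (Suc j) * (b (Suc i) * b j)" by simp
      also have "\<dots> \<le> b (Suc j) * (b i * b (Suc j))"
        using step.IH pos by (intro mult_left_mono) auto
      also have "\<dots> = b i * (b (Suc j))\<^sup>2" by (simp add: power2_eq_square)
      also have "\<dots> \<le> b i * (b j * b (Suc (Suc j)))"
        by (intro mult_left_mono log_convex nonneg)
      finally have "b j * (b (Suc i) * b (Suc j)) \<le> b j * (b i * b (Suc (Suc j)))" by (simp add: mult_ac)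
      with bj show ?thesis by simp
    qed
  qed
  have ordered: "b i * b j \<le> b 0 * b (i + j)" if "i \<le> j" for i j
    using that
  proof (induction i arbitrary: j)
    case 0
    then show ?case by simp
  next
    case (Suc i)
    have "b (Suc i) * b j \<le> b i * b (Suc j)" using Suc.prems by (intro ratio) simp
    also have "\<dots> \<le> b 0 * b (i + Suc j)" using Suc.prems by (intro Suc.IH) simp
    finally show ?case by simp
  qed
  show ?thesis
    using ordered[of i j] ordered[of j i] by (cases "i \<le> j") (auto simp: mult_ac add_ac)
qed

lemma log_convex_power_le:
  fixes b :: "nat \<Rightarrow> real"
  assumes nonneg: "\<And>j. b j \<ge> 0" and log_convex: "\<And>j. (b (Suc j))\<^sup>2 \<le> b j * b (Suc (Suc j))"
  shows "b 1 ^ Suc k \<le> b 0 ^ k * b (Suc k)"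
proof (induction k)
  case (Suc k)
  have "b 1 ^ Suc (Suc k) = b 1 * b 1 ^ Suc k" by simp
  also have "\<dots> \<le> b 1 * (b 0 ^ k * b (Suc k))"
    by (intro mult_left_mono Suc.IH nonneg)
  also have "\<dots> = b 0 ^ k * (b 1 * b (Suc k))" by simp
  also have "\<dots> \<le> b 0 ^ k * (b 0 * b (1 + Suc k))"
    by (intro mult_left_mono log_convex_mult_le assms zero_le_power)
  finally show ?case by (simp add: mult_ac)
qed simp

text \<open>
  The equation is that of \<open>\<beta> m = \<langle>v, (A + v v\<^sup>*) ^ m v\<rangle>\<close> and \<open>b m = \<langle>v, A ^ m v\<rangle>\<close>, obtained by
  splitting at the first rank one factor.  The upper bound is \<open>\<langle>v, (A + R) ^ m v\<rangle>\<close>: the rank one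
  term acts no worse than the scalar \<open>R\<close>.
\<close>

lemma renewal_bound:
  fixes b \<beta> :: "nat \<Rightarrow> real"
  assumes renewal: "\<And>m. \<beta> m = b m + (\<Sum>i<m. b i * \<beta> (m - 1 - i))"
    and nonneg: "\<And>j. b j \<ge> 0" and "R \<ge> 0"
    and mult_le: "\<And>i j. b i * b j \<le> R * b (i + j)"
  shows "b m \<le> \<beta> m" and "\<beta> m \<le> (\<Sum>i\<le>m. real (m choose i) * R ^ i * b (m - i))"
proof -
  have pos: "\<beta> m \<ge> 0" for m
  proof (induction m rule: less_induct)
    case (less m)
    then show ?case by (subst renewal) (intro add_nonneg_nonneg sum_nonneg mult_nonneg_nonneg nonneg, auto)
  qed
  show "b m \<le> \<beta> m"
    by (subst renewal) (simp add: sum_nonneg nonneg pos)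
  show "\<beta> m \<le> (\<Sum>i\<le>m. real (m choose i) * R ^ i * b (m - i))"
  proof (induction m rule: less_induct)
    case (less m)
    have "(\<Sum>i<m. b i * \<beta> (m - 1 - i)) = (\<Sum>j<m. b (m - 1 - j) * \<beta> j)"
      by (subst sum.nat_diff_reindex[symmetric], rule sum.cong) auto
    also have "\<dots> \<le> (\<Sum>j<m. b (m - 1 - j) * (\<Sum>l\<le>j. real (j choose l) * R ^ l * b (j - l)))"
      by (intro sum_mono mult_left_mono less.IH nonneg) auto
    also have "\<dots> = (\<Sum>j<m. \<Sum>l\<le>j. real (j choose l) * R ^ l * (b (m - 1 - j) * b (j - l)))"
      by (simp add: sum_distrib_left mult_ac)
    also have "\<dots> \<le> (\<Sum>j<m. \<Sum>l\<le>j. real (j choose l) * R ^ l * (R * b ((m - 1 - j) + (j - l))))"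
      using \<open>R \<ge> 0\<close> by (intro sum_mono mult_left_mono mult_le) auto
    also have "\<dots> = (\<Sum>j<m. \<Sum>l\<le>j. real (j choose l) * (R ^ Suc l * b (m - Suc l)))"
      by (intro sum.cong) (auto simp: mult_ac)
    also have "\<dots> = (\<Sum>j<m. \<Sum>l<m. real (j choose l) * (R ^ Suc l * b (m - Suc l)))"
    proof (rule sum.cong)
      fix j assume "j \<in> {..<m}"
      then have "(\<Sum>l\<in>{..<m}. real (j choose l) * (R ^ Suc l * b (m - Suc l)))
          = (\<Sum>l\<in>{..j}. real (j choose l) * (R ^ Suc l * b (m - Suc l)))"
        by (intro sum.mono_neutral_right) auto
      then show "(\<Sum>l\<le>j. real (j choose l) * (R ^ Suc l * b (m - Suc l)))
          = (\<Sum>l<m. real (j choose l) * (R ^ Suc l * b (m - Suc l)))" by simp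
    qed simp
    also have "\<dots> = (\<Sum>l<m. (\<Sum>j<m. real (j choose l)) * (R ^ Suc l * b (m - Suc l)))"
      by (subst sum.swap) (simp add: sum_distrib_right)
    also have "\<dots> = (\<Sum>l<m. real (m choose Suc l) * (R ^ Suc l * b (m - Suc l)))"
    proof (rule sum.cong)
      fix l assume "l \<in> {..<m}"
      \<comment> \<open>The hockey-stick identity turns the nested sums into binomial coefficients of order \<open>m\<close>.\<close>
      have "(\<Sum>j<m. j choose l) = m choose Suc l"
        by (induction m) (simp_all add: add.commute)
      then show "(\<Sum>j<m. real (j choose l)) * (R ^ Suc l * b (m - Suc l))
          = real (m choose Suc l) * (R ^ Suc l * b (m - Suc l))"
        by (metis of_nat_sum)
    qed simp
    finally have "\<beta> m \<le> b m + (\<Sum>l<m. real (m choose Suc l) * (R ^ Suc l * b (m - Suc l)))"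
      by (subst renewal) simp
    also have "\<dots> = (\<Sum>i<Suc m. real (m choose i) * R ^ i * b (m - i))"
      by (subst sum.lessThan_Suc_shift) (simp add: mult_ac)
    finally show ?case by (simp add: lessThan_Suc_atMost)
  qed
qed

lemma Cauchy_Schwarz_complex_sum:
  fixes f g :: "'a \<Rightarrow> complex"
  shows "(cmod (\<Sum>c\<in>A. cnj (f c) * g c))\<^sup>2 \<le> (\<Sum>c\<in>A. (cmod (f c))\<^sup>2) * (\<Sum>c\<in>A. (cmod (g c))\<^sup>2)"
proof -
  have "cmod (\<Sum>c\<in>A. cnj (f c) * g c) \<le> (\<Sum>c\<in>A. cmod (f c) * cmod (g c))"
    by (rule order_trans[OF norm_sum]) (simp add: norm_mult)
  then have "(cmod (\<Sum>c\<in>A. cnj (f c) * g c))\<^sup>2 \<le> (\<Sum>c\<in>A. cmod (f c) * cmod (g c))\<^sup>2"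
    by (intro power_mono) auto
  also have "\<dots> \<le> (\<Sum>c\<in>A. (cmod (f c))\<^sup>2) * (\<Sum>c\<in>A. (cmod (g c))\<^sup>2)"
    by (rule Cauchy_Schwarz_ineq_sum)
  finally show ?thesis .
qed

section \<open>Alternating projections and walk sums\<close>

text \<open>
  The entry of \<open>K (D K) ^ m\<close> at \<open>(a, b)\<close>, where \<open>D\<close> is the diagonal projection onto \<open>S\<close>: the
  \<open>K\<close>-weighted sum over walks from \<open>a\<close> to \<open>b\<close> with \<open>m\<close> intermediate stops in \<open>S\<close>.
\<close>

fun walk :: "('a \<Rightarrow> 'a \<Rightarrow> complex) \<Rightarrow> 'a set \<Rightarrow> nat \<Rightarrow> 'a \<Rightarrow> 'a \<Rightarrow> complex" where
  "walk K S 0 a b = K a b"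
| "walk K S (Suc m) a b = (\<Sum>c\<in>S. K a c * walk K S m c b)"

text \<open>
  Splitting a walk at its first visit to the new point; this is the resolvent identity.
\<close>

lemma walk_insert:
  assumes "finite S" "w \<notin> S"
  shows "walk K (insert w S) m a b
    = walk K S m a b + (\<Sum>i<m. walk K S i a w * walk K (insert w S) (m - 1 - i) w b)"
proof (induction m arbitrary: a)
  case (Suc m)
  let ?W = "walk K (insert w S)"
  have "?W (Suc m) a b = K a w * ?W m w b + (\<Sum>c\<in>S. K a c * ?W m c b)"
    using assms by simp
  also have "(\<Sum>c\<in>S. K a c * ?W m c b)
      = (\<Sum>c\<in>S. K a c * walk K S m c b)
        + (\<Sum>c\<in>S. \<Sum>i<m. K a c * walk K S i c w * ?W (m - 1 - i) w b)"
    by (subst sum.distrib[symmetric], intro sum.cong refl, subst Suc.IH)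
       (simp add: algebra_simps sum_distrib_left)
  also have "(\<Sum>c\<in>S. \<Sum>i<m. K a c * walk K S i c w * ?W (m - 1 - i) w b)
      = (\<Sum>i<m. walk K S (Suc i) a w * ?W (m - 1 - i) w b)"
    by (subst sum.swap) (simp add: sum_distrib_right)
  finally show ?case
    by (subst sum.lessThan_Suc_shift) (simp add: add_ac)
qed simp

lemma walk_append: "(\<Sum>c\<in>S. walk K S i a c * walk K S j c b) = walk K S (Suc (i + j)) a b"
proof (induction i arbitrary: a)
  case (Suc i)
  have "(\<Sum>c\<in>S. walk K S (Suc i) a c * walk K S j c b)
      = (\<Sum>c\<in>S. \<Sum>d\<in>S. K a d * (walk K S i d c * walk K S j c b))"
    by (simp add: sum_distrib_right mult.assoc)
  also have "\<dots> = (\<Sum>d\<in>S. K a d * (\<Sum>c\<in>S. walk K S i d c * walk K S j c b))"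
    by (subst sum.swap) (simp add: sum_distrib_left)
  finally show ?case by (simp only: Suc.IH add_Suc walk.simps)
qed simp

text \<open>
  Alternating the orthogonal projection \<open>K\<close> with the diagonal projection onto \<open>S\<close> gives vectors
  whose inner products depend only on the total number of projections applied.  All
  positivity and log-convexity statements below come from this.
\<close>

locale projection_kernel =
  fixes J :: "'a set" and K :: "'a \<Rightarrow> 'a \<Rightarrow> complex"
  assumes finite_J: "finite J"
    and hermitian: "\<And>a b. K a b = cnj (K b a)"
    and idempotent: "\<And>a b. a \<in> J \<Longrightarrow> b \<in> J \<Longrightarrow> (\<Sum>c\<in>J. K a c * K c b) = K a b"
begin

lemma walk_hermitian: "walk K S m a b = cnj (walk K S m b a)"
proof (induction m arbitrary: a b)
  case 0
  then show ?case by (simp add: hermitian[of a b])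
next
  case (Suc m)
  have "walk K S (Suc m) a b = (\<Sum>c\<in>S. walk K S m a c * K c b)"
    using walk_append[where i = m and j = 0 and K = K and S = S] by simp
  also have "\<dots> = (\<Sum>c\<in>S. cnj (K b c) * cnj (walk K S m c a))"
    by (intro sum.cong refl) (metis Suc.IH hermitian mult.commute)
  finally show ?case by simp
qed

lemma walk_append_full:
  assumes "S \<subseteq> J" "a \<in> J" "b \<in> J"
  shows "(\<Sum>c\<in>J. walk K S i a c * walk K S j c b) = walk K S (i + j) a b"
  using \<open>a \<in> J\<close>
proof (induction i arbitrary: a)
  case 0
  show ?case
  proof (cases j)
    case 0
    then show ?thesis using idempotent assms(3) \<open>a \<in> J\<close> by simp
  next
    case (Suc j')
    have "(\<Sum>c\<in>J. K a c * (\<Sum>d\<in>S. K c d * walk K S j' d b))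
        = (\<Sum>d\<in>S. (\<Sum>c\<in>J. K a c * K c d) * walk K S j' d b)"
      by (simp add: sum_distrib_left sum_distrib_right mult_ac) (rule sum.swap)
    also have "\<dots> = (\<Sum>d\<in>S. K a d * walk K S j' d b)"
      using assms(1) \<open>a \<in> J\<close> by (intro sum.cong refl) (auto simp: idempotent)
    finally show ?thesis using Suc by simp
  qed
next
  case (Suc i)
  have "(\<Sum>c\<in>J. walk K S (Suc i) a c * walk K S j c b)
      = (\<Sum>c\<in>J. \<Sum>d\<in>S. K a d * (walk K S i d c * walk K S j c b))"
    by (simp add: sum_distrib_right mult.assoc)
  also have "\<dots> = (\<Sum>d\<in>S. K a d * (\<Sum>c\<in>J. walk K S i d c * walk K S j c b))"
    by (subst sum.swap) (simp add: sum_distrib_left)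
  also have "\<dots> = (\<Sum>d\<in>S. K a d * walk K S (i + j) d b)"
    using assms(1) by (intro sum.cong refl) (auto simp: Suc.IH)
  finally show ?case by simp
qed

text \<open>
  This is \<open>\<langle>x, K (D K) ^ m x\<rangle>\<close>, with \<open>D\<close> the projection onto \<open>S\<close>.
\<close>

definition walk_form :: "'a set \<Rightarrow> nat \<Rightarrow> ('a \<Rightarrow> complex) \<Rightarrow> complex" where
  "walk_form S m x = (\<Sum>a\<in>J. \<Sum>b\<in>J. cnj (x a) * walk K S m a b * x b)"

definition walk_apply :: "'a set \<Rightarrow> nat \<Rightarrow> ('a \<Rightarrow> complex) \<Rightarrow> 'a \<Rightarrow> complex" where
  "walk_apply S m x c = (\<Sum>b\<in>J. walk K S m c b * x b)"

text \<open>
  The kernel is Hermitian, so a walk may be cut at a stop in \<open>L\<close> and its halves distributed over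
  the two sides of the inner product.
\<close>

lemma walk_form_split:
  assumes "\<And>a b. a \<in> J \<Longrightarrow> b \<in> J \<Longrightarrow> (\<Sum>c\<in>L. walk K S i a c * walk K S j c b) = walk K S m a b"
  shows "(\<Sum>c\<in>L. cnj (walk_apply S i x c) * walk_apply S j x c) = walk_form S m x"
proof -
  have "(\<Sum>c\<in>L. cnj (walk_apply S i x c) * walk_apply S j x c)
      = (\<Sum>c\<in>L. \<Sum>a\<in>J. \<Sum>b\<in>J. cnj (x a) * (walk K S i a c * walk K S j c b) * x b)"
    unfolding walk_apply_def cnj_sum sum_product
    by (intro sum.cong refl) (simp add: walk_hermitian[symmetric] mult_ac)
  also have "\<dots> = (\<Sum>a\<in>J. \<Sum>c\<in>L. \<Sum>b\<in>J. cnj (x a) * (walk K S i a c * walk K S j c b) * x b)"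
    by (rule sum.swap)
  also have "\<dots> = (\<Sum>a\<in>J. \<Sum>b\<in>J. \<Sum>c\<in>L. cnj (x a) * (walk K S i a c * walk K S j c b) * x b)"
    by (intro sum.cong refl sum.swap)
  also have "\<dots> = (\<Sum>a\<in>J. \<Sum>b\<in>J. cnj (x a) * (\<Sum>c\<in>L. walk K S i a c * walk K S j c b) * x b)"
    by (simp add: sum_distrib_left sum_distrib_right)
  also have "\<dots> = walk_form S m x"
    unfolding walk_form_def by (intro sum.cong refl) (simp add: assms)
  finally show ?thesis .
qed

lemma
  assumes "S \<subseteq> J"
  shows walk_form_even: "(\<Sum>c\<in>J. cnj (walk_apply S i x c) * walk_apply S j x c) = walk_form S (i + j) x"
    and walk_form_odd: "(\<Sum>c\<in>S. cnj (walk_apply S i x c) * walk_apply S j x c) = walk_form S (Suc (i + j)) x"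
  using assms by (auto intro!: walk_form_split walk_append_full simp del: walk.simps simp: walk_append)

lemma walk_form_norm:
  assumes "S \<subseteq> J"
  shows "walk_form S (2 * j) x = of_real (\<Sum>c\<in>J. (cmod (walk_apply S j x c))\<^sup>2)"
    and "walk_form S (Suc (2 * j)) x = of_real (\<Sum>c\<in>S. (cmod (walk_apply S j x c))\<^sup>2)"
  using walk_form_even[OF assms, of j x j] walk_form_odd[OF assms, of j x j]
  by (simp_all only: mult_2 of_real_sum complex_norm_square mult.commute[of _ "cnj _"])

lemma walk_form_nonneg:
  assumes "S \<subseteq> J"
  shows "walk_form S m x = of_real (Re (walk_form S m x))" and "Re (walk_form S m x) \<ge> 0"
proof -
  obtain j where "m = 2 * j \<or> m = Suc (2 * j)" by (metis evenE oddE Suc_eq_plus1)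
  then have "\<exists>L. walk_form S m x = of_real (\<Sum>c\<in>L. (cmod (walk_apply S j x c))\<^sup>2)"
    using walk_form_norm[OF assms, of j x] by metis
  then show "walk_form S m x = of_real (Re (walk_form S m x))" and "Re (walk_form S m x) \<ge> 0"
    by (auto simp: sum_nonneg)
qed

text \<open>
  Cauchy-Schwarz for the two vectors that arise after \<open>j\<close> and \<open>j + 1\<close> rounds.  The parity of \<open>m\<close>
  decides whether the last projection applied is \<open>K\<close>, giving an inner product over \<open>J\<close>, or the
  one onto \<open>S\<close>.
\<close>

lemma walk_form_log_convex:
  assumes "S \<subseteq> J"
  shows "(Re (walk_form S (Suc m) x))\<^sup>2 \<le> Re (walk_form S m x) * Re (walk_form S (Suc (Suc m)) x)"
proof (cases "even m")
  case True
  then obtain j where m: "m = 2 * j" by (elim evenE)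
  have "walk_form S (Suc m) x = (\<Sum>c\<in>J. cnj (walk_apply S j x c) * walk_apply S (Suc j) x c)"
    using walk_form_even[OF assms, of j x "Suc j"] by (simp add: m mult_2)
  then have "(cmod (walk_form S (Suc m) x))\<^sup>2
      \<le> (\<Sum>c\<in>J. (cmod (walk_apply S j x c))\<^sup>2) * (\<Sum>c\<in>J. (cmod (walk_apply S (Suc j) x c))\<^sup>2)"
    by (simp only: Cauchy_Schwarz_complex_sum)
  also have "\<dots> = Re (walk_form S m x) * Re (walk_form S (Suc (Suc m)) x)"
    using walk_form_norm(1)[OF assms, of j x] walk_form_norm(1)[OF assms, of "Suc j" x] by (simp add: m)
  finally show ?thesis
    by (subst (asm) walk_form_nonneg(1)[OF assms]) (simp add: norm_of_real)
next
  case False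
  then obtain j where m: "m = Suc (2 * j)" by (auto elim!: oddE)
  have "walk_form S (Suc m) x = (\<Sum>c\<in>S. cnj (walk_apply S j x c) * walk_apply S (Suc j) x c)"
    using walk_form_odd[OF assms, of j x "Suc j"] by (simp add: m mult_2)
  then have "(cmod (walk_form S (Suc m) x))\<^sup>2
      \<le> (\<Sum>c\<in>S. (cmod (walk_apply S j x c))\<^sup>2) * (\<Sum>c\<in>S. (cmod (walk_apply S (Suc j) x c))\<^sup>2)"
    by (simp only: Cauchy_Schwarz_complex_sum)
  also have "\<dots> = Re (walk_form S m x) * Re (walk_form S (Suc (Suc m)) x)"
    using walk_form_norm(2)[OF assms, of j x] walk_form_norm(2)[OF assms, of "Suc j" x] by (simp add: m)
  finally show ?thesis
    by (subst (asm) walk_form_nonneg(1)[OF assms]) (simp add: norm_of_real)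
qed

text \<open>
  The diagonal entries are real, see \<open>walk_eq_closed_walk\<close> below.
\<close>

definition closed_walk :: "'a set \<Rightarrow> nat \<Rightarrow> 'a \<Rightarrow> real" where
  "closed_walk S m w = Re (walk K S m w w)"

lemma walk_form_unit:
  assumes "w \<in> J"
  shows "walk_form S m (\<lambda>a. if a = w then 1 else 0) = walk K S m w w"
proof -
  have "walk_form S m (\<lambda>a. if a = w then 1 else 0)
      = (\<Sum>a\<in>J. if a = w then walk K S m a w else 0)"
    unfolding walk_form_def using assms finite_J
    by (intro sum.cong refl) (auto simp: if_distrib[of cnj] if_distribR if_distrib[of "\<lambda>z. _ * z"] sum.delta cong: if_cong)
  then show ?thesis using assms finite_J by (simp add: sum.delta)
qed

lemma
  assumes "S \<subseteq> J" "w \<in> J"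
  shows closed_walk_nonneg: "closed_walk S m w \<ge> 0"
    and walk_eq_closed_walk: "walk K S m w w = of_real (closed_walk S m w)"
    and closed_walk_log_convex: "(closed_walk S (Suc m) w)\<^sup>2 \<le> closed_walk S m w * closed_walk S (Suc (Suc m)) w"
  using walk_form_nonneg[OF assms(1), of _ "\<lambda>a. if a = w then 1 else 0"]
    walk_form_log_convex[OF assms(1), of m "\<lambda>a. if a = w then 1 else 0"]
  by (simp_all add: walk_form_unit[OF assms(2)] closed_walk_def)

lemma closed_walk_insert:
  assumes "insert w S \<subseteq> J" "w \<notin> S" "Re (K w w) \<le> R"
  shows "closed_walk S m w \<le> closed_walk (insert w S) m w"
    and "closed_walk (insert w S) m w \<le> (\<Sum>i\<le>m. real (m choose i) * R ^ i * closed_walk S (m - i) w)"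
proof -
  have sub: "S \<subseteq> J" "w \<in> J" using assms(1) by auto
  have fin: "finite S" using sub(1) finite_J by (rule finite_subset)
  let ?b = "\<lambda>m. closed_walk S m w" and ?\<beta> = "\<lambda>m. closed_walk (insert w S) m w"
  have b0: "?b 0 \<le> R" using assms(3) by (simp add: closed_walk_def)
  have renewal: "?\<beta> m = ?b m + (\<Sum>i<m. ?b i * ?\<beta> (m - 1 - i))" for m
  proof -
    have "complex_of_real (?\<beta> m) = of_real (?b m + (\<Sum>i<m. ?b i * ?\<beta> (m - 1 - i)))"
      using walk_insert[OF fin assms(2), of K m w w]
      by (simp add: walk_eq_closed_walk[OF assms(1) sub(2)] walk_eq_closed_walk[OF sub])
    then show ?thesis by (simp only: of_real_eq_iff)
  qed
  have mult_le: "?b i * ?b j \<le> R * ?b (i + j)" for i j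
  proof -
    have "?b i * ?b j \<le> ?b 0 * ?b (i + j)"
      using closed_walk_nonneg[OF sub] closed_walk_log_convex[OF sub]
      by (rule log_convex_mult_le)
    also have "\<dots> \<le> R * ?b (i + j)" by (intro mult_right_mono b0 closed_walk_nonneg[OF sub])
    finally show ?thesis .
  qed
  have R: "R \<ge> 0" using b0 closed_walk_nonneg[OF sub, of 0] by linarith
  show "?b m \<le> ?\<beta> m" "?\<beta> m \<le> (\<Sum>i\<le>m. real (m choose i) * R ^ i * ?b (m - i))"
    using renewal_bound[where b = ?b and \<beta> = ?\<beta>, OF renewal closed_walk_nonneg[OF sub] R mult_le]
    by auto
qed

text \<open>
  For \<open>m > 0\<close> this is the trace of the \<open>m\<close>-th power of the compression of \<open>K\<close> to \<open>S\<close>.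
\<close>

definition walk_trace :: "'a set \<Rightarrow> nat \<Rightarrow> real" where
  "walk_trace S m = (\<Sum>w\<in>J. closed_walk S m w)"

text \<open>
  Cyclicity of the trace together with \<open>K\<^sup>2 = K\<close>.
\<close>

lemma walk_trace_Suc:
  assumes "S \<subseteq> J"
  shows "walk_trace S (Suc m) = (\<Sum>w\<in>S. closed_walk S m w)"
proof -
  have "(\<Sum>w\<in>J. walk K S (Suc m) w w) = (\<Sum>w\<in>J. \<Sum>c\<in>S. walk K S m c w * walk K S 0 w c)"
    by (simp add: mult_ac)
  also have "\<dots> = (\<Sum>c\<in>S. \<Sum>w\<in>J. walk K S m c w * walk K S 0 w c)"
    by (rule sum.swap)
  also have "\<dots> = (\<Sum>c\<in>S. walk K S m c c)"
    using assms by (intro sum.cong refl) (subst walk_append_full, auto)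
  finally show ?thesis
    unfolding walk_trace_def closed_walk_def by (metis Re_sum)
qed

text \<open>
  The moment method without eigenvalues.  With \<open>\<parallel>x\<parallel>\<^sup>2\<close> put in front, the sequence of forms stays
  log-convex, so its first ratio to the power \<open>k\<close> is at most the \<open>k\<close>-th term divided by \<open>\<parallel>x\<parallel>\<^sup>2\<close>.
  For odd \<open>k\<close> that term is the squared norm of a matrix applied to \<open>x\<close>, which the trace bounds
  through the Frobenius norm.
\<close>

lemma form_le_of_walk_trace:
  assumes S: "S \<subseteq> J" and x: "\<And>a. a \<notin> S \<Longrightarrow> x a = 0"
    and trace: "walk_trace S (Suc (2 * j)) \<le> s ^ Suc (2 * j)" and "s \<ge> 0"
  shows "Re (walk_form S 0 x) \<le> s * (\<Sum>a\<in>S. (cmod (x a))\<^sup>2)"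
proof -
  define n where "n = (\<Sum>a\<in>S. (cmod (x a))\<^sup>2)"
  define B where "B m = Re (walk_form S m x)" for m
  \<comment> \<open>The sequence of forms preceded by the squared norm of \<open>x\<close>.\<close>
  define c where "c = case_nat n B"
  have n: "n \<ge> 0" by (simp add: n_def sum_nonneg)
  have fin: "finite S" using S finite_J by (rule finite_subset)
  have "B 0 ^ 2 \<le> n * B 1"
  proof -
    have "walk_form S 0 x = (\<Sum>a\<in>J. cnj (x a) * walk_apply S 0 x a)"
      by (simp add: walk_form_def walk_apply_def sum_distrib_left mult_ac)
    also have "\<dots> = (\<Sum>a\<in>S. cnj (x a) * walk_apply S 0 x a)"
      using S x finite_J by (intro sum.mono_neutral_right) auto
    finally have "(cmod (walk_form S 0 x))\<^sup>2 \<le> n * (\<Sum>a\<in>S. (cmod (walk_apply S 0 x a))\<^sup>2)"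
      by (simp only: n_def Cauchy_Schwarz_complex_sum)
    also have "\<dots> = n * B 1"
      using walk_form_norm(2)[OF S, of 0 x] by (simp add: B_def)
    finally show ?thesis
      unfolding B_def by (subst (asm) walk_form_nonneg(1)[OF S]) (simp add: norm_of_real)
  qed
  then have "c 1 ^ Suc (2 * j) \<le> c 0 ^ (2 * j) * c (Suc (2 * j))"
    by (intro log_convex_power_le)
       (auto simp: c_def B_def n walk_form_nonneg(2)[OF S] walk_form_log_convex[OF S]
         split: nat.splits)
  then have pow: "B 0 ^ Suc (2 * j) \<le> n ^ (2 * j) * B (2 * j)" by (simp add: c_def)
  have "B (2 * j) = (\<Sum>a\<in>J. (cmod (walk_apply S j x a))\<^sup>2)"
    using walk_form_norm(1)[OF S, of j x] by (simp add: B_def)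
  also have "\<dots> \<le> (\<Sum>a\<in>J. (\<Sum>b\<in>S. (cmod (walk K S j a b))\<^sup>2) * n)"
  proof (rule sum_mono)
    fix a
    have "walk_apply S j x a = (\<Sum>b\<in>S. cnj (walk K S j b a) * x b)"
      unfolding walk_apply_def using S x finite_J
      by (subst sum.mono_neutral_right[of J S]) (auto simp: walk_hermitian[of S j a])
    then have "(cmod (walk_apply S j x a))\<^sup>2 \<le> (\<Sum>b\<in>S. (cmod (walk K S j b a))\<^sup>2) * n"
      by (simp only: n_def Cauchy_Schwarz_complex_sum)
    then show "(cmod (walk_apply S j x a))\<^sup>2 \<le> (\<Sum>b\<in>S. (cmod (walk K S j a b))\<^sup>2) * n"
      by (subst walk_hermitian) simp
  qed
  also have "\<dots> = n * (\<Sum>b\<in>S. \<Sum>a\<in>J. (cmod (walk K S j a b))\<^sup>2)"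
    by (subst sum.swap) (simp add: sum_distrib_left mult_ac)
  also have "(\<Sum>b\<in>S. \<Sum>a\<in>J. (cmod (walk K S j a b))\<^sup>2) = (\<Sum>b\<in>S. closed_walk S (2 * j) b)"
  proof (intro sum.cong refl)
    fix b assume "b \<in> S"
    then have b: "b \<in> J" using S by auto
    have "complex_of_real (\<Sum>a\<in>J. (cmod (walk K S j a b))\<^sup>2) = (\<Sum>a\<in>J. walk K S j b a * walk K S j a b)"
      by (simp only: of_real_sum complex_norm_square walk_hermitian[of S j b] mult.commute)
    also have "\<dots> = of_real (closed_walk S (2 * j) b)"
      using walk_append_full[OF S b b, of j j] walk_eq_closed_walk[OF S b] by (simp add: mult_2)
    finally show "(\<Sum>a\<in>J. (cmod (walk K S j a b))\<^sup>2) = closed_walk S (2 * j) b"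
      by (simp only: of_real_eq_iff)
  qed
  also have "\<dots> = walk_trace S (Suc (2 * j))" by (simp add: walk_trace_Suc[OF S])
  finally have "B (2 * j) \<le> n * walk_trace S (Suc (2 * j))" .
  also have "\<dots> \<le> n * s ^ Suc (2 * j)" by (intro mult_left_mono trace n)
  finally have "n ^ (2 * j) * B (2 * j) \<le> n ^ (2 * j) * (n * s ^ Suc (2 * j))"
    using n by (intro mult_left_mono) auto
  with pow have "B 0 ^ Suc (2 * j) \<le> (s * n) ^ Suc (2 * j)"
    by (simp add: power_mult_distrib mult_ac)
  then have "B 0 \<le> s * n"
    by (rule power_le_imp_le_base) (use n \<open>s \<ge> 0\<close> in simp)
  then show ?thesis by (simp add: B_def n_def)
qed

end

section \<open>Moments over a random set of frequencies\<close>

lemma finite_set_random_set: "finite (set_pmf (random_set N p))"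
  and random_set_subset: "S \<in> set_pmf (random_set N p) \<Longrightarrow> S \<subseteq> {..<N}"
proof -
  have sub: "set_pmf (random_set N p) \<subseteq> Pow {..<N}"
    unfolding random_set_def using set_Pi_pmf_subset[of "{..<N}" False "\<lambda>_. bernoulli_pmf p"]
    by (force simp flip: not_le)
  then show "finite (set_pmf (random_set N p))" by (rule finite_subset) simp
  show "S \<in> set_pmf (random_set N p) \<Longrightarrow> S \<subseteq> {..<N}" using sub by auto
qed

lemma integrable_random_set [simp, intro]: "integrable (measure_pmf (random_set N p)) (f :: _ \<Rightarrow> real)"
  by (intro integrable_measure_pmf_finite finite_set_random_set)

text \<open>
  The event \<open>w \<in> S\<close> is independent of the rest of \<open>S\<close>, and \<open>insert w S\<close> depends on the rest only.
\<close>

lemma expectation_random_set_member: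
  fixes f :: "nat set \<Rightarrow> real"
  assumes "w < N" "0 \<le> p" "p \<le> 1"
  shows "measure_pmf.expectation (random_set N p) (\<lambda>S. if w \<in> S then f S else 0)
    = p * measure_pmf.expectation (random_set N p) (\<lambda>S. f (insert w S))"
proof -
  \<comment> \<open>The coins of all points other than \<open>w\<close>.\<close>
  define Q where "Q = Pi_pmf ({..<N} - {w}) False (\<lambda>_. bernoulli_pmf p)"
  have fin: "finite (set_pmf Q)"
    unfolding Q_def
    by (rule finite_subset[OF set_Pi_pmf_subset']) (auto intro!: finite_PiE_dflt)
  have split: "measure_pmf.expectation (random_set N p) g
      = p * measure_pmf.expectation Q (\<lambda>I. g (insert w {t. I t}))
        + (1 - p) * measure_pmf.expectation Q (\<lambda>I. g ({t. I t} - {w}))" for g :: "nat set \<Rightarrow> real"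
  proof -
    have ins: "insert w ({..<N} - {w}) = {..<N}" using assms by auto
    have "Pi_pmf {..<N} False (\<lambda>_. bernoulli_pmf p)
        = bernoulli_pmf p \<bind> (\<lambda>y. map_pmf (\<lambda>I. I(w := y)) Q)"
      using Pi_pmf_insert'[of "{..<N} - {w}" w False "\<lambda>_. bernoulli_pmf p"]
      unfolding ins Q_def map_pmf_def by simp
    then have "random_set N p = bernoulli_pmf p \<bind> (\<lambda>y. map_pmf (\<lambda>I. {t. (I(w := y)) t}) Q)"
      by (simp only: random_set_def map_bind_pmf map_pmf_comp)
    then have "measure_pmf.expectation (random_set N p) g
        = (\<Sum>y\<in>UNIV. pmf (bernoulli_pmf p) y * measure_pmf.expectation Q (\<lambda>I. g {t. (I(w := y)) t}))"
      using pmf_expectation_bind[where p = "bernoulli_pmf p" and A = UNIV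
          and f = "\<lambda>y. map_pmf (\<lambda>I. {t. (I(w := y)) t}) Q" and h = g] fin by simp
    then have "measure_pmf.expectation (random_set N p) g
        = p * measure_pmf.expectation Q (\<lambda>I. g {t. (I(w := True)) t})
          + (1 - p) * measure_pmf.expectation Q (\<lambda>I. g {t. (I(w := False)) t})"
      using assms by (simp add: UNIV_bool)
    moreover have "{t. (I(w := True)) t} = insert w {t. I t}"
      and "{t. (I(w := False)) t} = {t. I t} - {w}" for I :: "nat \<Rightarrow> bool"
      by auto
    ultimately show ?thesis by (simp only:)
  qed
  show ?thesis
    by (subst (1 2) split) (simp add: algebra_simps)
qed

lemma expected_card_eq:
  assumes "0 \<le> p" "p \<le> 1"
  shows "expected_card N p = real N * p"
proof -
  have "expected_card N p = measure_pmf.expectation (random_set N p)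
      (\<lambda>S. \<Sum>w<N. if w \<in> S then 1 else 0)"
    unfolding expected_card_def
  proof (intro integral_cong_AE AE_pmfI)
    fix S assume "S \<in> set_pmf (random_set N p)"
    then have "{..<N} \<inter> S = S" using random_set_subset by blast
    then show "real (card S) = (\<Sum>w<N. if w \<in> S then 1 else 0)"
      by (simp add: sum.If_cases)
  qed auto
  also have "\<dots> = (\<Sum>w<N. p)"
    using assms by (subst Bochner_Integration.integral_sum)
      (auto intro!: sum.cong simp: expectation_random_set_member)
  finally show ?thesis by simp
qed

lemma prob_card_random_set_ge:
  assumes "0 \<le> p" "p \<le> 1" "d \<ge> 0" "N > 0"
  shows "measure_pmf.prob (random_set N p) {S. real (card S) \<ge> real N * p + d}
    \<le> exp (- 2 * d\<^sup>2 / real N)"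
proof -
  interpret binomial_distribution N p by unfold_locales (use assms in auto)
  have "binomial_pmf N p = map_pmf (\<lambda>I. card {t\<in>{..<N}. I t}) (Pi_pmf {..<N} False (\<lambda>_. bernoulli_pmf p))"
    using assms by (intro binomial_pmf_altdef') auto
  also have "\<dots> = map_pmf card (random_set N p)"
    unfolding random_set_def map_pmf_comp
  proof (intro map_pmf_cong refl)
    fix I assume "I \<in> set_pmf (Pi_pmf {..<N} False (\<lambda>_. bernoulli_pmf p))"
    then have "{t\<in>{..<N}. I t} = {t. I t}"
      using set_Pi_pmf_subset[of "{..<N}" False "\<lambda>_. bernoulli_pmf p"] by auto
    then show "card {t\<in>{..<N}. I t} = card {t. I t}" by simp
  qed
  finally show ?thesis
    using prob_ge[of d] assms by (simp add: vimage_def)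
qed

context projection_kernel
begin

text \<open>
  For \<open>w \<in> S\<close> the renewal bound applies to \<open>S - {w}\<close>, and monotonicity returns to \<open>S\<close>.  The
  right-hand side thus refers to \<open>S\<close> in all cases, so that summing over \<open>w\<close> yields traces for \<open>S\<close>.
\<close>

lemma closed_walk_insert_le:
  assumes "S \<subseteq> J" "w \<in> J" "Re (K w w) \<le> R"
  shows "closed_walk (insert w S) m w \<le> (\<Sum>i\<le>m. real (m choose i) * R ^ i * closed_walk S (m - i) w)"
proof (cases "w \<in> S")
  case False
  then show ?thesis using assms by (intro closed_walk_insert) auto
next
  case True
  have sub: "insert w (S - {w}) \<subseteq> J" using assms by auto
  have R: "R \<ge> 0" using closed_walk_nonneg[OF assms(1,2), of 0] assms(3) by (simp add: closed_walk_def)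
  have "closed_walk S m w = closed_walk (insert w (S - {w})) m w"
    using True by (simp add: insert_absorb)
  also have "\<dots> \<le> (\<Sum>i\<le>m. real (m choose i) * R ^ i * closed_walk (S - {w}) (m - i) w)"
    using sub assms(3) by (intro closed_walk_insert) auto
  also have "\<dots> \<le> (\<Sum>i\<le>m. real (m choose i) * R ^ i * closed_walk S (m - i) w)"
    using closed_walk_insert(1)[OF sub _ assms(3)] True R
    by (intro sum_mono mult_left_mono) (auto simp: insert_absorb)
  finally show ?thesis using True by (simp add: insert_absorb)
qed

end

text \<open>
  The trace of order \<open>m + 1\<close> is a sum over the random set; independence extracts the factor \<open>p\<close>, and
  the renewal bound reduces to traces of lower order.
\<close>

lemma expected_walk_trace_Suc_le:
  assumes "projection_kernel {..<N} K" and diag: "\<And>w. w < N \<Longrightarrow> Re (K w w) \<le> R"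
    and p: "0 \<le> p" "p \<le> 1"
  defines "EM \<equiv> \<lambda>m. measure_pmf.expectation (random_set N p) (\<lambda>S. projection_kernel.walk_trace {..<N} K S m)"
  shows "EM (Suc m) \<le> p * (\<Sum>i\<le>m. real (m choose i) * R ^ i * EM (m - i))"
proof -
  interpret projection_kernel "{..<N}" K by fact
  let ?E = "measure_pmf.expectation (random_set N p)"
  have "EM (Suc m) = ?E (\<lambda>S. \<Sum>w<N. if w \<in> S then closed_walk S m w else 0)"
    unfolding EM_def
  proof (intro integral_cong_AE AE_pmfI)
    fix S assume "S \<in> set_pmf (random_set N p)"
    then have "S \<subseteq> {..<N}" by (rule random_set_subset)
    then show "walk_trace S (Suc m) = (\<Sum>w<N. if w \<in> S then closed_walk S m w else 0)"
      by (simp add: walk_trace_Suc sum.If_cases Int_absorb1)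
  qed auto
  also have "\<dots> = (\<Sum>w<N. p * ?E (\<lambda>S. closed_walk (insert w S) m w))"
    by (subst Bochner_Integration.integral_sum)
      (auto intro!: sum.cong expectation_random_set_member p)
  also have "\<dots> \<le> (\<Sum>w<N. p * ?E (\<lambda>S. \<Sum>i\<le>m. real (m choose i) * R ^ i * closed_walk S (m - i) w))"
    using p diag
    by (intro sum_mono mult_left_mono integral_mono_AE AE_pmfI closed_walk_insert_le)
      (auto dest: random_set_subset)
  also have "\<dots> = p * (\<Sum>i\<le>m. \<Sum>w<N. real (m choose i) * R ^ i * ?E (\<lambda>S. closed_walk S (m - i) w))"
    by (subst Bochner_Integration.integral_sum) (auto simp: sum_distrib_left sum.swap[of _ "{..m}"])
  also have "\<dots> = p * (\<Sum>i\<le>m. real (m choose i) * R ^ i * EM (m - i))"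
    unfolding EM_def walk_trace_def
    by (subst Bochner_Integration.integral_sum) (auto simp: sum_distrib_left)
  finally show ?thesis .
qed

text \<open>
  By the binomial theorem the recursion maps the bound \<open>q ^ i\<close>, \<open>i \<le> m\<close>, to \<open>p * (q + R) ^ m\<close>, which
  is at most \<open>q ^ (m + 1)\<close> by the choice of \<open>q\<close>.
\<close>

lemma expected_walk_trace_le:
  assumes "projection_kernel {..<N} K" and diag: "\<And>w. w < N \<Longrightarrow> Re (K w w) \<le> R"
    and p: "0 \<le> p" "p \<le> 1" and R: "R \<ge> 0" and q: "q > 0" "p * (1 + R / q) ^ k \<le> q"
  shows "j \<le> k \<Longrightarrow> measure_pmf.expectation (random_set N p)
      (\<lambda>S. projection_kernel.walk_trace {..<N} K S j) \<le> real N * R * q ^ j"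
proof (induction j rule: less_induct)
  case (less j)
  interpret projection_kernel "{..<N}" K by fact
  let ?EM = "\<lambda>m. measure_pmf.expectation (random_set N p) (\<lambda>S. walk_trace S m)"
  show ?case
  proof (cases j)
    case 0
    have "walk_trace S 0 \<le> real N * R" for S
    proof -
      have "walk_trace S 0 \<le> (\<Sum>w<N. R)"
        unfolding walk_trace_def closed_walk_def by (intro sum_mono) (simp add: diag)
      then show ?thesis by simp
    qed
    then have "?EM 0 \<le> measure_pmf.expectation (random_set N p) (\<lambda>S. real N * R)"
      by (intro integral_mono) auto
    then show ?thesis using 0 by simp
  next
    case (Suc m)
    have "?EM j \<le> p * (\<Sum>i\<le>m. real (m choose i) * R ^ i * ?EM (m - i))"
      unfolding Suc using assms by (intro expected_walk_trace_Suc_le)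
    also have "\<dots> \<le> p * (\<Sum>i\<le>m. real (m choose i) * R ^ i * (real N * R * q ^ (m - i)))"
      using less Suc R p by (intro mult_left_mono sum_mono) auto
    also have "(\<Sum>i\<le>m. real (m choose i) * R ^ i * (real N * R * q ^ (m - i)))
        = real N * R * (\<Sum>i\<le>m. real (m choose i) * R ^ i * q ^ (m - i))"
      by (simp add: sum_distrib_left mult_ac)
    also have "\<dots> = real N * R * (R + q) ^ m"
      by (subst binomial_ring) simp
    also have "(R + q) ^ m = (1 + R / q) ^ m * q ^ m"
      using q by (simp add: field_simps flip: power_mult_distrib)
    also have "p * (real N * R * ((1 + R / q) ^ m * q ^ m)) = real N * R * q ^ m * (p * (1 + R / q) ^ m)"
      by simp
    also have "\<dots> \<le> real N * R * q ^ m * q"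
    proof (intro mult_left_mono)
      have "p * (1 + R / q) ^ m \<le> p * (1 + R / q) ^ k"
        using less.prems Suc p q R by (intro mult_left_mono power_increasing) auto
      also have "\<dots> \<le> q" by (rule q)
      finally show "p * (1 + R / q) ^ m \<le> q" .
    qed (use R q in auto)
    finally show ?thesis using Suc by (simp add: mult_ac)
  qed
qed

lemma prob_form_gt_le:
  assumes "projection_kernel {..<N} K" and diag: "\<And>w. w < N \<Longrightarrow> Re (K w w) \<le> R"
    and p: "0 \<le> p" "p \<le> 1" and R: "R \<ge> 0" and q: "q > 0" "p * (1 + R / q) ^ k \<le> q"
    and "s > 0" "odd k"
  shows "measure_pmf.prob (random_set N p)
      {S. \<exists>x. (\<forall>a. a \<notin> S \<longrightarrow> x a = 0) \<and>
        Re (projection_kernel.walk_form {..<N} K S 0 x) > s * (\<Sum>a\<in>S. (cmod (x a))\<^sup>2)}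
    \<le> real N * R * (q / s) ^ k"
proof -
  interpret projection_kernel "{..<N}" K by fact
  let ?bad = "{S. \<exists>x. (\<forall>a. a \<notin> S \<longrightarrow> x a = 0) \<and> Re (walk_form S 0 x) > s * (\<Sum>a\<in>S. (cmod (x a))\<^sup>2)}"
  from \<open>odd k\<close> obtain j where k: "k = Suc (2 * j)" by (auto elim: oddE)
  have "measure_pmf.prob (random_set N p) ?bad
      \<le> measure_pmf.prob (random_set N p) {S\<in>space (random_set N p). walk_trace S k \<ge> s ^ k}"
  proof (rule measure_pmf.finite_measure_mono_AE)
    show "AE S in random_set N p. S \<in> ?bad
        \<longrightarrow> S \<in> {S\<in>space (random_set N p). walk_trace S k \<ge> s ^ k}"
    proof (intro AE_pmfI impI)
      fix S assume S: "S \<in> set_pmf (random_set N p)" and bad: "S \<in> ?bad"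
      show "S \<in> {S\<in>space (random_set N p). walk_trace S k \<ge> s ^ k}"
      proof (rule ccontr)
        assume "\<not> ?thesis"
        then have "walk_trace S (Suc (2 * j)) \<le> s ^ Suc (2 * j)" unfolding k by simp
        moreover obtain x where "\<And>a. a \<notin> S \<Longrightarrow> x a = 0"
          and "Re (walk_form S 0 x) > s * (\<Sum>a\<in>S. (cmod (x a))\<^sup>2)"
          using bad by blast
        ultimately show False
          using form_le_of_walk_trace[OF random_set_subset[OF S], of x j s] \<open>s > 0\<close> by simp
      qed
    qed
  qed auto
  also have "\<dots> \<le> measure_pmf.expectation (random_set N p) (\<lambda>S. walk_trace S k) / s ^ k"
  proof (rule integral_Markov_inequality_measure)
    show "AE S in random_set N p. walk_trace S k \<ge> 0"
      unfolding walk_trace_def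
      by (intro AE_pmfI sum_nonneg closed_walk_nonneg random_set_subset) auto
  qed (use \<open>s > 0\<close> in auto)
  also have "\<dots> \<le> real N * R * q ^ k / s ^ k"
    using \<open>s > 0\<close> by (intro divide_right_mono expected_walk_trace_le[OF assms(1) diag p R q]) auto
  finally show ?thesis by (simp add: power_divide)
qed

section \<open>Recovery from a finite family of atoms\<close>

locale atoms =
  fixes S :: "'s set" and I :: "'i set" and D :: "'s \<Rightarrow> 'i \<Rightarrow> complex"
  assumes finite_S: "finite S" and finite_I: "finite I"
begin

definition comb :: "'i set \<Rightarrow> ('i \<Rightarrow> complex) \<Rightarrow> 's \<Rightarrow> complex" where
  "comb G a s = (\<Sum>\<gamma>\<in>G. D s \<gamma> * a \<gamma>)"

text \<open>
  The smallest eigenvalue of the Gram matrix of the atoms in \<open>G\<close> is at least \<open>c\<close>.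
\<close>

definition gram_lower :: "real \<Rightarrow> 'i set \<Rightarrow> bool" where
  "gram_lower c G \<longleftrightarrow> (\<forall>z. c * (\<Sum>\<gamma>\<in>G. (cmod (z \<gamma>))\<^sup>2) \<le> (\<Sum>s\<in>S. (cmod (comb G z s))\<^sup>2))"

text \<open>
  That is, \<open>comb G a\<close> is the orthogonal projection of \<open>f\<close> onto the span of the atoms in \<open>G\<close>.
\<close>

definition normal_eq :: "'i set \<Rightarrow> ('s \<Rightarrow> complex) \<Rightarrow> ('i \<Rightarrow> complex) \<Rightarrow> bool" where
  "normal_eq G f a \<longleftrightarrow> (\<forall>\<gamma>\<in>G. (\<Sum>s\<in>S. cnj (D s \<gamma>) * (f s - comb G a s)) = 0)"

lemma orthogonal_comb:
  assumes "\<And>\<gamma>. \<gamma> \<in> G \<Longrightarrow> (\<Sum>s\<in>S. cnj (D s \<gamma>) * r s) = 0"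
  shows "(\<Sum>s\<in>S. cnj (comb G a s) * r s) = 0"
proof -
  have "(\<Sum>s\<in>S. cnj (comb G a s) * r s) = (\<Sum>\<gamma>\<in>G. cnj (a \<gamma>) * (\<Sum>s\<in>S. cnj (D s \<gamma>) * r s))"
    unfolding comb_def by (simp add: sum_distrib_left sum_distrib_right mult_ac) (rule sum.swap)
  then show ?thesis by (simp add: assms)
qed

text \<open>
  One step of Gram-Schmidt: the new atom minus its projection onto the old ones is \<open>\<psi>\<close>, and the old
  residual loses its component along \<open>\<psi>\<close>.  If \<open>\<psi> = 0\<close>, the old coefficients already work.
\<close>

lemma ex_normal_eq:
  assumes "finite G"
  shows "\<exists>a. normal_eq G f a"
  using assms
proof (induction G arbitrary: f rule: finite_induct)
  case empty
  then show ?case by (simp add: normal_eq_def)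
next
  case (insert \<gamma> G)
  obtain a where a: "normal_eq G f a" using insert.IH by blast
  obtain c where c: "normal_eq G (\<lambda>s. D s \<gamma>) c" using insert.IH by blast
  define r where "r s = f s - comb G a s" for s
  define \<psi> where "\<psi> s = D s \<gamma> - comb G c s" for s
  define n where "n = (\<Sum>s\<in>S. cnj (\<psi> s) * \<psi> s)"
  define \<mu> where "\<mu> = (if n = 0 then 0 else (\<Sum>s\<in>S. cnj (\<psi> s) * r s) / n)"
  define a' where "a' = (\<lambda>\<gamma>'. if \<gamma>' = \<gamma> then \<mu> else a \<gamma>' - \<mu> * c \<gamma>')"
  define r' where "r' s = r s - \<mu> * \<psi> s" for s
  have "comb (insert \<gamma> G) a' s = D s \<gamma> * \<mu> + (\<Sum>\<gamma>'\<in>G. D s \<gamma>' * (a \<gamma>' - \<mu> * c \<gamma>'))" for s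
  proof -
    have "(\<Sum>\<gamma>'\<in>G. D s \<gamma>' * a' \<gamma>') = (\<Sum>\<gamma>'\<in>G. D s \<gamma>' * (a \<gamma>' - \<mu> * c \<gamma>'))"
      using insert.hyps by (intro sum.cong) (auto simp: a'_def)
    then show ?thesis using insert.hyps by (simp add: comb_def a'_def)
  qed
  then have res: "f s - comb (insert \<gamma> G) a' s = r' s" for s
    by (simp add: r'_def r_def \<psi>_def comb_def algebra_simps sum_subtractf sum_distrib_left)
  have r: "(\<Sum>s\<in>S. cnj (D s \<gamma>') * r s) = 0" and \<psi>: "(\<Sum>s\<in>S. cnj (D s \<gamma>') * \<psi> s) = 0"
    if "\<gamma>' \<in> G" for \<gamma>'
    using a c that by (auto simp: normal_eq_def r_def \<psi>_def)
  have r': "(\<Sum>s\<in>S. cnj (D s \<gamma>') * r' s) = 0" if "\<gamma>' \<in> G" for \<gamma>'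
    using r[OF that] \<psi>[OF that]
    by (simp add: r'_def algebra_simps sum_subtractf flip: sum_distrib_left)
  have "(\<Sum>s\<in>S. cnj (\<psi> s) * r' s) = 0"
  proof (cases "n = 0")
    case False
    have "(\<Sum>s\<in>S. cnj (\<psi> s) * r' s) = (\<Sum>s\<in>S. cnj (\<psi> s) * r s) - \<mu> * n"
      by (simp add: r'_def n_def right_diff_distrib sum_subtractf sum_distrib_left mult_ac)
    with False show ?thesis by (simp add: \<mu>_def)
  next
    case True
    have "n = of_real (\<Sum>s\<in>S. (cmod (\<psi> s))\<^sup>2)"
      unfolding n_def by (simp only: of_real_sum complex_norm_square mult.commute)
    with True have "(\<Sum>s\<in>S. (cmod (\<psi> s))\<^sup>2) = 0" by (metis of_real_eq_0_iff)
    then have "\<And>s. s \<in> S \<Longrightarrow> \<psi> s = 0" using finite_S by (simp add: sum_nonneg_eq_0_iff)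
    then show ?thesis by simp
  qed
  moreover have "(\<Sum>s\<in>S. cnj (comb G c s) * r' s) = 0" by (rule orthogonal_comb) (rule r')
  moreover have "(\<Sum>s\<in>S. cnj (D s \<gamma>) * r' s)
      = (\<Sum>s\<in>S. cnj (\<psi> s) * r' s) + (\<Sum>s\<in>S. cnj (comb G c s) * r' s)"
    by (simp add: \<psi>_def algebra_simps flip: sum.distrib)
  ultimately have "(\<Sum>s\<in>S. cnj (D s \<gamma>) * r' s) = 0" by simp
  with r' have "normal_eq (insert \<gamma> G) f a'" by (auto simp: normal_eq_def res)
  then show ?case by blast
qed

text \<open>
  Pairing the normal equations with \<open>a\<close> itself.
\<close>

lemma normal_eq_energy:
  assumes "normal_eq G f a"
  shows "(\<Sum>s\<in>S. (cmod (comb G a s))\<^sup>2)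
    \<le> sqrt (\<Sum>\<gamma>\<in>G. (cmod (a \<gamma>))\<^sup>2) * sqrt (\<Sum>\<gamma>\<in>G. (cmod (\<Sum>s\<in>S. cnj (D s \<gamma>) * f s))\<^sup>2)"
proof -
  let ?b = "\<lambda>\<gamma>. \<Sum>s\<in>S. cnj (D s \<gamma>) * f s"
  have "(\<Sum>s\<in>S. cnj (comb G a s) * (f s - comb G a s)) = 0"
    using assms by (intro orthogonal_comb) (auto simp: normal_eq_def)
  then have "(\<Sum>s\<in>S. cnj (comb G a s) * comb G a s) = (\<Sum>s\<in>S. cnj (comb G a s) * f s)"
    by (simp add: algebra_simps sum_subtractf)
  also have "\<dots> = (\<Sum>\<gamma>\<in>G. cnj (a \<gamma>) * ?b \<gamma>)"
    unfolding comb_def by (simp add: sum_distrib_left sum_distrib_right mult_ac) (rule sum.swap)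
  finally have eq: "of_real (\<Sum>s\<in>S. (cmod (comb G a s))\<^sup>2) = (\<Sum>\<gamma>\<in>G. cnj (a \<gamma>) * ?b \<gamma>)"
    by (simp only: of_real_sum complex_norm_square mult.commute[of _ "cnj _"])
  have "(\<Sum>s\<in>S. (cmod (comb G a s))\<^sup>2) = cmod (of_real (\<Sum>s\<in>S. (cmod (comb G a s))\<^sup>2))"
    by (simp only: norm_of_real) (simp add: sum_nonneg)
  also have "\<dots> = cmod (\<Sum>\<gamma>\<in>G. cnj (a \<gamma>) * ?b \<gamma>)" by (simp only: eq)
  also have "\<dots> \<le> sqrt ((\<Sum>\<gamma>\<in>G. (cmod (a \<gamma>))\<^sup>2) * (\<Sum>\<gamma>\<in>G. (cmod (?b \<gamma>))\<^sup>2))"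
    by (rule real_le_rsqrt) (rule Cauchy_Schwarz_complex_sum)
  finally show ?thesis by (simp add: real_sqrt_mult)
qed

lemma normal_eq_coeff_bound:
  assumes "normal_eq G f a" "gram_lower c G" "c \<ge> 0"
  shows "c\<^sup>2 * (\<Sum>\<gamma>\<in>G. (cmod (a \<gamma>))\<^sup>2) \<le> (\<Sum>\<gamma>\<in>G. (cmod (\<Sum>s\<in>S. cnj (D s \<gamma>) * f s))\<^sup>2)"
proof -
  define A where "A = (\<Sum>\<gamma>\<in>G. (cmod (a \<gamma>))\<^sup>2)"
  define B where "B = (\<Sum>\<gamma>\<in>G. (cmod (\<Sum>s\<in>S. cnj (D s \<gamma>) * f s))\<^sup>2)"
  have nonneg: "A \<ge> 0" "B \<ge> 0" by (simp_all add: A_def B_def sum_nonneg)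
  have "c * A \<le> (\<Sum>s\<in>S. (cmod (comb G a s))\<^sup>2)" using assms(2) by (simp add: gram_lower_def A_def)
  also have "\<dots> \<le> sqrt A * sqrt B" using normal_eq_energy[OF assms(1)] by (simp add: A_def B_def)
  finally have "sqrt A * (c * sqrt A) \<le> sqrt A * sqrt B" using nonneg by (simp add: algebra_simps)
  then have "c * sqrt A \<le> sqrt B" using nonneg by (cases "A = 0") auto
  then have "(c * sqrt A)\<^sup>2 \<le> (sqrt B)\<^sup>2" using nonneg assms(3) by (intro power_mono) auto
  then show ?thesis using nonneg by (simp add: power_mult_distrib A_def B_def)
qed

lemma not_comb_of_small_correlation:
  assumes "gram_lower c G" "c > 0"
    and unit: "(\<Sum>s\<in>S. (cmod (f s))\<^sup>2) = 1"
    and small: "(\<Sum>\<gamma>\<in>G. (cmod (\<Sum>s\<in>S. cnj (D s \<gamma>) * f s))\<^sup>2) < c"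
  shows "\<exists>s\<in>S. f s \<noteq> comb G z s"
proof (rule ccontr)
  assume "\<not> ?thesis"
  then have eq: "\<And>s. s \<in> S \<Longrightarrow> f s = comb G z s" by blast
  define A where "A = (\<Sum>\<gamma>\<in>G. (cmod (z \<gamma>))\<^sup>2)"
  define B where "B = (\<Sum>\<gamma>\<in>G. (cmod (\<Sum>s\<in>S. cnj (D s \<gamma>) * f s))\<^sup>2)"
  have nonneg: "A \<ge> 0" "B \<ge> 0" by (simp_all add: A_def B_def sum_nonneg)
  have one: "(\<Sum>s\<in>S. (cmod (comb G z s))\<^sup>2) = 1"
    using unit by (simp add: eq)
  have normal: "normal_eq G f z" by (simp add: normal_eq_def eq)
  have "c * A \<le> 1" using assms(1) one by (metis A_def gram_lower_def)
  have "1 \<le> sqrt A * sqrt B" using normal_eq_energy[OF normal] by (simp add: A_def B_def one)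
  then have "1 \<le> A * B" by (simp flip: real_sqrt_mult)
  moreover have "A * B \<le> A * c" using small nonneg by (intro mult_left_mono) (auto simp: B_def)
  moreover have "A \<noteq> 0" using \<open>1 \<le> A * B\<close> by auto
  then have "A * B < A * c" using small nonneg by (simp add: B_def)
  ultimately show False using \<open>c * A \<le> 1\<close> by (simp add: mult.commute)
qed

text \<open>
  Subgradient inequality for the modulus; at \<open>u = 0\<close> the subgradient \<open>sgn u\<close> is \<open>0\<close>.
\<close>

lemma cmod_add_ge: "cmod (u + h) \<ge> cmod u + Re (cnj (sgn u) * h)"
proof -
  have "cmod u + Re (cnj (sgn u) * h) = Re (cnj (sgn u) * (u + h))"
  proof (cases "u = 0")
    case False
    have "cnj (sgn u) * u = of_real (cmod u)"
      using False
      by (simp add: sgn_div_norm scaleR_conv_of_real mult.assoc complex_norm_square[symmetric]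
          mult.commute[of "cnj u"] power2_eq_square field_simps)
    then show ?thesis by (simp add: algebra_simps)
  qed simp
  also have "\<dots> \<le> cmod (cnj (sgn u) * (u + h))" by (rule complex_Re_le_cmod)
  also have "\<dots> \<le> cmod (u + h)" by (simp add: norm_mult norm_sgn)
  finally show ?thesis .
qed

text \<open>
  Fuchs' condition.  The combination \<open>z\<close> of \<open>h\<close> with the projection coefficients has an image that
  is both in the span of the atoms in \<open>G\<close> and orthogonal to it, so \<open>h\<close> on \<open>G\<close> is determined by \<open>h\<close>
  off \<open>G\<close>.  The gain off \<open>G\<close> then strictly exceeds the largest possible loss on \<open>G\<close>.
\<close>

lemma l1_unique:
  assumes G: "G \<subseteq> I" and gram: "gram_lower c G" "c > 0"
    and \<alpha>: "\<And>\<gamma>. \<gamma> \<in> I - G \<Longrightarrow> \<alpha> \<gamma> = 0"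
    and a: "\<And>\<gamma>. \<gamma> \<in> I - G \<Longrightarrow> normal_eq G (\<lambda>s. D s \<gamma>) (a \<gamma>)"
    and dual: "\<And>\<gamma>. \<gamma> \<in> I - G \<Longrightarrow> cmod (\<Sum>\<gamma>'\<in>G. cnj (sgn (\<alpha> \<gamma>')) * a \<gamma> \<gamma>') < 1"
    and h: "\<And>s. s \<in> S \<Longrightarrow> comb I h s = 0" and nz: "\<exists>\<gamma>\<in>I. h \<gamma> \<noteq> 0"
  shows "(\<Sum>\<gamma>\<in>I. cmod (\<alpha> \<gamma>)) < (\<Sum>\<gamma>\<in>I. cmod (\<alpha> \<gamma> + h \<gamma>))"
proof -
  have fin: "finite G" "finite (I - G)" using G finite_I by (auto intro: finite_subset)
  define z where "z \<gamma>' = h \<gamma>' + (\<Sum>\<gamma>\<in>I - G. a \<gamma> \<gamma>' * h \<gamma>)" for \<gamma>'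
  have combz: "comb G z s = (\<Sum>\<gamma>\<in>I - G. - h \<gamma> * (D s \<gamma> - comb G (a \<gamma>) s))" if "s \<in> S" for s
  proof -
    have "comb G h s + (\<Sum>\<gamma>\<in>I - G. D s \<gamma> * h \<gamma>) = 0"
      using h[OF that] G finite_I unfolding comb_def by (simp add: sum.subset_diff[of G I] add.commute)
    moreover have "(\<Sum>\<gamma>'\<in>G. \<Sum>\<gamma>\<in>I - G. D s \<gamma>' * (a \<gamma> \<gamma>' * h \<gamma>)) = (\<Sum>\<gamma>\<in>I - G. h \<gamma> * comb G (a \<gamma>) s)"
      unfolding comb_def by (subst sum.swap) (simp add: sum_distrib_left mult_ac)
    ultimately show ?thesis
      unfolding comb_def z_def
      by (simp add: distrib_left sum.distrib sum_distrib_left right_diff_distrib sum_subtractf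
          sum_negf mult.commute[of "h _" "D s _"] eq_neg_iff_add_eq_0)
  qed
  have orth: "(\<Sum>s\<in>S. cnj (D s \<gamma>') * comb G z s) = 0" if "\<gamma>' \<in> G" for \<gamma>'
  proof -
    have "(\<Sum>s\<in>S. cnj (D s \<gamma>') * comb G z s)
        = (\<Sum>s\<in>S. \<Sum>\<gamma>\<in>I - G. - h \<gamma> * (cnj (D s \<gamma>') * (D s \<gamma> - comb G (a \<gamma>) s)))"
      by (intro sum.cong refl) (simp only: combz sum_distrib_left mult_ac)
    also have "\<dots> = (\<Sum>\<gamma>\<in>I - G. - h \<gamma> * (\<Sum>s\<in>S. cnj (D s \<gamma>') * (D s \<gamma> - comb G (a \<gamma>) s)))"
      by (subst sum.swap) (simp only: sum_distrib_left)
    also have "\<dots> = 0"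
      using a that by (intro sum.neutral) (auto simp: normal_eq_def)
    finally show ?thesis .
  qed
  have "(\<Sum>s\<in>S. cnj (comb G z s) * comb G z s) = 0" by (rule orthogonal_comb) (rule orth)
  then have "of_real (\<Sum>s\<in>S. (cmod (comb G z s))\<^sup>2) = (0 :: complex)"
    by (simp only: of_real_sum complex_norm_square mult.commute[of _ "cnj _"])
  then have "(\<Sum>s\<in>S. (cmod (comb G z s))\<^sup>2) = 0" by (simp only: of_real_eq_0_iff)
  then have "c * (\<Sum>\<gamma>\<in>G. (cmod (z \<gamma>))\<^sup>2) \<le> 0" using gram(1) unfolding gram_lower_def by metis
  then have "(\<Sum>\<gamma>\<in>G. (cmod (z \<gamma>))\<^sup>2) \<le> 0" using \<open>c > 0\<close> by (simp add: mult_le_0_iff)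
  then have "(\<Sum>\<gamma>\<in>G. (cmod (z \<gamma>))\<^sup>2) = 0" by (simp add: sum_nonneg antisym)
  then have z0: "z \<gamma>' = 0" if "\<gamma>' \<in> G" for \<gamma>' using that fin by (simp add: sum_nonneg_eq_0_iff)
  have hG: "h \<gamma>' = - (\<Sum>\<gamma>\<in>I - G. a \<gamma> \<gamma>' * h \<gamma>)" if "\<gamma>' \<in> G" for \<gamma>'
    using z0[OF that] by (simp add: z_def eq_neg_iff_add_eq_0)
  define P where "P \<gamma> = (\<Sum>\<gamma>'\<in>G. cnj (sgn (\<alpha> \<gamma>')) * a \<gamma> \<gamma>')" for \<gamma>
  have "\<exists>\<gamma>\<in>I - G. h \<gamma> \<noteq> 0"
  proof (rule ccontr)
    assume "\<not> ?thesis"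
    then have "\<And>\<gamma>. \<gamma> \<in> I - G \<Longrightarrow> h \<gamma> = 0" by blast
    moreover from this have "\<And>\<gamma>. \<gamma> \<in> G \<Longrightarrow> h \<gamma> = 0" by (simp add: hG)
    ultimately show False using nz by blast
  qed
  then obtain \<gamma>0 where \<gamma>0: "\<gamma>0 \<in> I - G" "h \<gamma>0 \<noteq> 0" by blast
  have "(\<Sum>\<gamma>'\<in>G. cnj (sgn (\<alpha> \<gamma>')) * h \<gamma>')
      = (\<Sum>\<gamma>'\<in>G. \<Sum>\<gamma>\<in>I - G. - (h \<gamma> * (cnj (sgn (\<alpha> \<gamma>')) * a \<gamma> \<gamma>')))"
    by (intro sum.cong refl) (simp add: hG sum_distrib_left sum_negf mult_ac)
  also have "\<dots> = - (\<Sum>\<gamma>\<in>I - G. h \<gamma> * P \<gamma>)"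
    by (subst sum.swap) (simp add: P_def sum_distrib_left sum_negf)
  finally have cross: "(\<Sum>\<gamma>'\<in>G. cnj (sgn (\<alpha> \<gamma>')) * h \<gamma>') = - (\<Sum>\<gamma>\<in>I - G. h \<gamma> * P \<gamma>)" .
  have "Re (\<Sum>\<gamma>\<in>I - G. h \<gamma> * P \<gamma>) \<le> (\<Sum>\<gamma>\<in>I - G. cmod (h \<gamma>) * cmod (P \<gamma>))"
    by (rule order_trans[OF complex_Re_le_cmod], rule order_trans[OF norm_sum]) (simp add: norm_mult)
  also have "\<dots> < (\<Sum>\<gamma>\<in>I - G. cmod (h \<gamma>))"
  proof (rule sum_strict_mono_ex1[OF fin(2)])
    show "\<forall>\<gamma>\<in>I - G. cmod (h \<gamma>) * cmod (P \<gamma>) \<le> cmod (h \<gamma>)"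
      using dual by (intro ballI mult_left_le) (auto simp: P_def less_imp_le)
    show "\<exists>\<gamma>\<in>I - G. cmod (h \<gamma>) * cmod (P \<gamma>) < cmod (h \<gamma>)"
      using \<gamma>0 dual[OF \<gamma>0(1)] by (intro bexI[of _ \<gamma>0]) (auto simp: P_def)
  qed
  finally have strict: "- (\<Sum>\<gamma>\<in>I - G. cmod (h \<gamma>)) < Re (\<Sum>\<gamma>'\<in>G. cnj (sgn (\<alpha> \<gamma>')) * h \<gamma>')"
    unfolding cross by simp
  have "(\<Sum>\<gamma>\<in>I. cmod (\<alpha> \<gamma>)) = (\<Sum>\<gamma>\<in>G. cmod (\<alpha> \<gamma>))"
    using G finite_I \<alpha> by (intro sum.mono_neutral_right) auto
  also have "\<dots> < (\<Sum>\<gamma>\<in>G. cmod (\<alpha> \<gamma>) + Re (cnj (sgn (\<alpha> \<gamma>)) * h \<gamma>)) + (\<Sum>\<gamma>\<in>I - G. cmod (h \<gamma>))"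
    using strict by (simp add: sum.distrib)
  also have "\<dots> \<le> (\<Sum>\<gamma>\<in>G. cmod (\<alpha> \<gamma> + h \<gamma>)) + (\<Sum>\<gamma>\<in>I - G. cmod (\<alpha> \<gamma> + h \<gamma>))"
    using \<alpha> by (intro add_mono sum_mono cmod_add_ge) auto
  also have "\<dots> = (\<Sum>\<gamma>\<in>I. cmod (\<alpha> \<gamma> + h \<gamma>))"
    using G finite_I by (simp add: sum.subset_diff[of G I] add.commute)
  finally show ?thesis .
qed

text \<open>
  With an atom of \<open>G'\<close> outside \<open>G\<close> the atoms in \<open>G\<close> are still independent, and they are too many to
  lie in the span of \<open>G'\<close>.  The functional is the residual of an atom of \<open>G\<close> after projection onto
  the span of \<open>G'\<close>.
\<close>

lemma separating_functional:
  assumes G: "G \<subseteq> I" "G' \<subseteq> I" and gram: "gram_lower c G" "c > 0"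
    and indep: "\<And>\<gamma> z. \<gamma> \<in> I - G \<Longrightarrow> \<exists>s\<in>S. D s \<gamma> \<noteq> comb G z s"
    and card: "card G' \<le> card G" and new: "\<not> G' \<subseteq> G"
  shows "\<exists>\<psi>. (\<forall>\<gamma>\<in>G'. (\<Sum>s\<in>S. cnj (\<psi> s) * D s \<gamma>) = 0) \<and> (\<exists>\<gamma>\<in>G. (\<Sum>s\<in>S. cnj (\<psi> s) * D s \<gamma>) \<noteq> 0)"
proof -
  have fin: "finite G" "finite G'" using G finite_I by (auto intro: finite_subset)
  define \<phi> where "\<phi> \<gamma> = (\<lambda>s. if s \<in> S then D s \<gamma> else 0)" for \<gamma>
  \<comment> \<open>Functions that vanish off \<open>S\<close> stand for vectors; the library's dimension theory applies to them.\<close>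
  interpret vector_space "\<lambda>(k :: complex) (f :: 's \<Rightarrow> complex). (\<lambda>s. k * f s)"
    by unfold_locales (simp_all add: fun_eq_iff distrib_left distrib_right mult.assoc)
  have comb_\<phi>: "(\<Sum>\<gamma>\<in>F. (\<lambda>s. k \<gamma> * \<phi> \<gamma> s)) = (\<lambda>s. if s \<in> S then comb F k s else 0)" if "finite F" for F k
    using that by (induction F rule: finite_induct) (auto simp: comb_def \<phi>_def fun_eq_iff)
  obtain \<gamma>1 where \<gamma>1: "\<gamma>1 \<in> G'" "\<gamma>1 \<notin> G" using new by blast
  have gram0: "k \<gamma> = 0" if "\<And>s. s \<in> S \<Longrightarrow> comb G k s = 0" "\<gamma> \<in> G" for k \<gamma>
  proof -
    have "c * (\<Sum>\<gamma>\<in>G. (cmod (k \<gamma>))\<^sup>2) \<le> 0"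
      using gram(1)[unfolded gram_lower_def, rule_format, of k] that(1) by simp
    then have "(\<Sum>\<gamma>\<in>G. (cmod (k \<gamma>))\<^sup>2) \<le> 0" using \<open>c > 0\<close> by (simp add: mult_le_0_iff)
    then have "(\<Sum>\<gamma>\<in>G. (cmod (k \<gamma>))\<^sup>2) = 0" by (simp add: sum_nonneg antisym)
    then show ?thesis using that(2) fin by (simp add: sum_nonneg_eq_0_iff)
  qed
  have rel: "k \<gamma> = 0"
    if k: "\<And>s. s \<in> S \<Longrightarrow> comb (insert \<gamma>1 G) k s = 0" and \<gamma>: "\<gamma> \<in> insert \<gamma>1 G" for k \<gamma>
  proof -
    have split: "k \<gamma>1 * D s \<gamma>1 + comb G k s = 0" if "s \<in> S" for s
      using k[OF that] \<gamma>1 fin by (simp add: comb_def mult.commute)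
    have "k \<gamma>1 = 0"
    proof (rule ccontr)
      assume nz: "k \<gamma>1 \<noteq> 0"
      have "D s \<gamma>1 = comb G (\<lambda>\<gamma>. - k \<gamma> / k \<gamma>1) s" if "s \<in> S" for s
      proof -
        have "comb G (\<lambda>\<gamma>. - k \<gamma> / k \<gamma>1) s = - comb G k s / k \<gamma>1"
          by (simp add: comb_def sum_divide_distrib sum_negf)
        also have "\<dots> = D s \<gamma>1"
        proof -
          have "D s \<gamma>1 * k \<gamma>1 = - comb G k s"
            using split[OF that] by (simp add: eq_neg_iff_add_eq_0 mult.commute)
          with nz show ?thesis by (metis nonzero_eq_divide_eq)
        qed
        finally show ?thesis by simp
      qed
      with indep[of \<gamma>1] \<gamma>1 G show False by blast
    qed
    with split gram0[of k] \<gamma> show ?thesis by auto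
  qed
  have inj: "inj_on \<phi> (insert \<gamma>1 G)"
  proof (rule inj_onI, rule ccontr)
    fix x y assume xy: "x \<in> insert \<gamma>1 G" "y \<in> insert \<gamma>1 G" "\<phi> x = \<phi> y" "x \<noteq> y"
    define k where "k \<gamma> = (if \<gamma> = x then 1 else if \<gamma> = y then -1 else 0 :: complex)" for \<gamma>
    have "comb (insert \<gamma>1 G) k s = 0" if "s \<in> S" for s
    proof -
      have "comb (insert \<gamma>1 G) k s = comb {x, y} k s"
        unfolding comb_def using xy fin by (intro sum.mono_neutral_right) (auto simp: k_def)
      also have "\<dots> = D s x - D s y" using xy by (simp add: comb_def k_def)
      also have "\<dots> = 0" using fun_cong[OF xy(3), of s] that by (simp add: \<phi>_def)
      finally show ?thesis .
    qed
    from rel[OF this, of x] xy show False by (simp add: k_def)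
  qed
  have indep': "independent (\<phi> ` insert \<gamma>1 G)"
  proof (rule independent_if_scalars_zero)
    fix f x assume f: "(\<Sum>x\<in>\<phi> ` insert \<gamma>1 G. (\<lambda>s. f x * x s)) = 0" and x: "x \<in> \<phi> ` insert \<gamma>1 G"
    have "(\<Sum>\<gamma>\<in>insert \<gamma>1 G. (\<lambda>s. f (\<phi> \<gamma>) * \<phi> \<gamma> s)) = 0"
      using f by (subst (asm) sum.reindex[OF inj]) (simp add: o_def)
    then have "(\<lambda>s. if s \<in> S then comb (insert \<gamma>1 G) (\<lambda>\<gamma>. f (\<phi> \<gamma>)) s else 0) = 0"
      using fin by (subst (asm) comb_\<phi>) auto
    then have "comb (insert \<gamma>1 G) (\<lambda>\<gamma>. f (\<phi> \<gamma>)) s = 0" if "s \<in> S" for s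
      using that by (auto dest: fun_cong[where x = s])
    from rel[OF this] x show "f x = 0" by auto
  qed (use fin in auto)
  have "\<exists>\<gamma>\<in>insert \<gamma>1 G. \<phi> \<gamma> \<notin> span (\<phi> ` G')"
  proof (rule ccontr)
    assume "\<not> ?thesis"
    then have "\<phi> ` insert \<gamma>1 G \<subseteq> span (\<phi> ` G')" by blast
    with indep' fin have "card (\<phi> ` insert \<gamma>1 G) \<le> card (\<phi> ` G')"
      using independent_span_bound by blast
    also have "\<dots> \<le> card G'" using fin by (intro card_image_le)
    finally show False using card inj \<gamma>1 fin by (simp add: card_image)
  qed
  then obtain \<gamma> where "\<gamma> \<in> insert \<gamma>1 G" and span: "\<phi> \<gamma> \<notin> span (\<phi> ` G')" by blast
  moreover have "\<phi> \<gamma>1 \<in> span (\<phi> ` G')" using \<gamma>1 by (intro span_base) auto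
  ultimately have \<gamma>: "\<gamma> \<in> G" by auto
  obtain b where b: "normal_eq G' (\<lambda>s. D s \<gamma>) b" using ex_normal_eq fin by blast
  define \<psi> where "\<psi> s = D s \<gamma> - comb G' b s" for s
  have orth: "(\<Sum>s\<in>S. cnj (D s \<gamma>') * \<psi> s) = 0" if "\<gamma>' \<in> G'" for \<gamma>'
    using b that by (simp add: normal_eq_def \<psi>_def)
  have swap: "(\<Sum>s\<in>S. cnj (\<psi> s) * g s) = 0" if "(\<Sum>s\<in>S. cnj (g s) * \<psi> s) = 0" for g
  proof -
    have "(\<Sum>s\<in>S. cnj (\<psi> s) * g s) = cnj (\<Sum>s\<in>S. cnj (g s) * \<psi> s)"
      by (simp only: cnj_sum complex_cnj_mult complex_cnj_cnj mult.commute)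
    with that show ?thesis by simp
  qed
  have zero: "(\<Sum>s\<in>S. cnj (\<psi> s) * D s \<gamma>') = 0" if "\<gamma>' \<in> G'" for \<gamma>'
    by (rule swap) (rule orth[OF that])
  have "(\<Sum>s\<in>S. cnj (\<psi> s) * D s \<gamma>) \<noteq> 0"
  proof
    assume 0: "(\<Sum>s\<in>S. cnj (\<psi> s) * D s \<gamma>) = 0"
    have "(\<Sum>s\<in>S. cnj (\<psi> s) * comb G' b s) = 0"
      by (rule swap, rule orthogonal_comb, rule orth)
    with 0 have "(\<Sum>s\<in>S. cnj (\<psi> s) * \<psi> s) = 0"
      by (simp add: \<psi>_def right_diff_distrib sum_subtractf)
    then have "of_real (\<Sum>s\<in>S. (cmod (\<psi> s))\<^sup>2) = (0 :: complex)"
      by (simp only: of_real_sum complex_norm_square mult.commute[of _ "cnj _"])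
    then have "(\<Sum>s\<in>S. (cmod (\<psi> s))\<^sup>2) = 0" by (simp only: of_real_eq_0_iff)
    then have "\<psi> s = 0" if "s \<in> S" for s using that finite_S by (simp add: sum_nonneg_eq_0_iff)
    then have "\<phi> \<gamma> = (\<lambda>s. if s \<in> S then comb G' b s else 0)"
      by (auto simp: \<phi>_def \<psi>_def fun_eq_iff)
    also have "\<dots> = (\<Sum>\<gamma>'\<in>G'. (\<lambda>s. b \<gamma>' * \<phi> \<gamma>' s))" using fin by (simp add: comb_\<phi>)
    also have "\<dots> \<in> span (\<phi> ` G')"
      by (intro span_sum span_scale span_base) auto
    finally show False using span by simp
  qed
  with zero \<gamma> show ?thesis by blast
qed

end

section \<open>The Fourier matrix and the time-frequency dictionary\<close>

lemma dft_eq_cis: "dft N \<omega> t = cis (- (2 * pi * real \<omega> * real t / real N)) / of_real (sqrt (real N))"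
  by (simp add: dft_def cis_conv_exp)

lemma dft_commute: "dft N \<omega> t = dft N t \<omega>"
  by (simp add: dft_eq_cis mult_ac)

lemma cmod_dft: "(cmod (dft N \<omega> t))\<^sup>2 = 1 / real N"
  by (simp add: dft_eq_cis norm_divide power_divide)

lemma dft_orthonormal:
  assumes "a < N" "b < N"
  shows "(\<Sum>c<N. cnj (dft N c a) * dft N c b) = (if a = b then 1 else 0)"
proof -
  have N: "N > 0" using assms by simp
  define \<theta> where "\<theta> = 2 * pi * (real a - real b) / real N"
  define z where "z = cis \<theta>"
  have term_eq: "cnj (dft N c a) * dft N c b = z ^ c / of_nat N" for c
  proof -
    have "cnj (dft N c a) * dft N c b
        = cis (2 * pi * real c * real a / real N) * cis (- (2 * pi * real c * real b / real N))
          / (of_real (sqrt (real N)) * of_real (sqrt (real N)))"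
      by (simp add: dft_eq_cis cis_cnj)
    also have "cis (2 * pi * real c * real a / real N) * cis (- (2 * pi * real c * real b / real N))
        = cis (real c * \<theta>)"
      unfolding cis_mult by (rule arg_cong[where f = cis]) (use N in \<open>simp add: \<theta>_def field_simps\<close>)
    also have "of_real (sqrt (real N)) * of_real (sqrt (real N)) = (of_nat N :: complex)"
      by (simp flip: of_real_mult)
    finally show ?thesis by (simp add: z_def Complex.DeMoivre)
  qed
  show ?thesis
  proof (cases "a = b")
    case True
    then show ?thesis unfolding term_eq using N by (simp add: z_def \<theta>_def)
  next
    case False
    have "z ^ N = 1"
    proof -
      have "z ^ N = cis (real N * \<theta>)" by (simp add: z_def Complex.DeMoivre)
      also have "real N * \<theta> = 2 * pi * of_int (int a - int b)" using N by (simp add: \<theta>_def)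
      finally show ?thesis by (simp only: cis_multiple_2pi Ints_of_int)
    qed
    moreover have "z \<noteq> 1"
    proof
      assume "z = 1"
      then have "cos \<theta> = 1" by (simp add: z_def complex_eq_iff)
      then obtain n :: int where n: "\<theta> = of_int n * (2 * pi)" by (auto simp: cos_one_2pi_int)
      then have "2 * pi * (real a - real b) = 2 * pi * (real N * of_int n)"
        using N by (simp add: \<theta>_def field_simps)
      then have "real a - real b = real N * of_int n" by (subst (asm) mult_left_cancel) auto
      then have "int a - int b = int N * n" by (metis of_int_diff of_int_eq_iff of_int_mult of_int_of_nat_eq)
      then have dvd: "int N dvd int a - int b" by simp
      have "int a - int b \<noteq> 0" using False by simp
      from dvd_imp_le_int[OF this dvd] show False using assms by auto
    qed
    ultimately have "(\<Sum>c<N. z ^ c) = 0" using geometric_sum[of z N] by simp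
    then show ?thesis using False by (simp add: term_eq flip: sum_divide_distrib)
  qed
qed

lemma dft_orthonormal_time:
  assumes "a < N" "b < N"
  shows "(\<Sum>t<N. cnj (dft N a t) * dft N b t) = (if a = b then 1 else 0)"
  using dft_orthonormal[OF assms] by (simp only: dft_commute[of N a] dft_commute[of N b])

definition inverse_dft :: "nat \<Rightarrow> (nat \<Rightarrow> complex) \<Rightarrow> nat \<Rightarrow> complex" where
  "inverse_dft N x t = (\<Sum>\<omega><N. cnj (dft N \<omega> t) * x \<omega>)"

lemma inverse_dft_parseval: "(\<Sum>t<N. (cmod (inverse_dft N x t))\<^sup>2) = (\<Sum>\<omega><N. (cmod (x \<omega>))\<^sup>2)"
proof -
  have "complex_of_real (\<Sum>t<N. (cmod (inverse_dft N x t))\<^sup>2)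
      = (\<Sum>t<N. \<Sum>a<N. \<Sum>b<N. (cnj (dft N a t) * dft N b t) * (x a * cnj (x b)))"
    by (simp only: of_real_sum complex_norm_square inverse_dft_def cnj_sum sum_product
        complex_cnj_mult complex_cnj_cnj dft_commute[of N t] mult_ac)
  also have "\<dots> = (\<Sum>a<N. \<Sum>b<N. (\<Sum>t<N. cnj (dft N a t) * dft N b t) * (x a * cnj (x b)))"
    by (simp only: sum_distrib_right) (subst sum.swap, intro sum.cong refl sum.swap)
  also have "\<dots> = (\<Sum>a<N. \<Sum>b<N. (if a = b then 1 else 0) * (x a * cnj (x b)))"
    by (intro sum.cong refl) (simp add: dft_orthonormal_time)
  also have "\<dots> = (\<Sum>a<N. x a * cnj (x a))"
    by (intro sum.cong refl) (simp add: if_distribR if_distrib[of "\<lambda>z. z * _"] cong: if_cong)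
  also have "\<dots> = complex_of_real (\<Sum>\<omega><N. (cmod (x \<omega>))\<^sup>2)"
    by (simp only: of_real_sum complex_norm_square)
  finally show ?thesis by (simp only: of_real_eq_iff)
qed

text \<open>
  The squared operator norm of the Fourier matrix restricted to times in \<open>T\<close> and frequencies in
  \<open>\<Omega>\<close> is at most \<open>s\<close>.
\<close>

definition partial_dft_bound :: "nat \<Rightarrow> real \<Rightarrow> nat set \<Rightarrow> nat set \<Rightarrow> bool" where
  "partial_dft_bound N s T \<Omega> \<longleftrightarrow> (\<forall>x. (\<forall>\<omega>. \<omega> \<notin> \<Omega> \<longrightarrow> x \<omega> = 0) \<longrightarrow>
    (\<Sum>t\<in>T. (cmod (inverse_dft N x t))\<^sup>2) \<le> s * (\<Sum>\<omega>\<in>\<Omega>. (cmod (x \<omega>))\<^sup>2))"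

text \<open>
  The frequency-side matrix of the projection onto signals supported in \<open>T\<close>.
\<close>

definition band_kernel :: "nat \<Rightarrow> nat set \<Rightarrow> nat \<Rightarrow> nat \<Rightarrow> complex" where
  "band_kernel N T a b = (\<Sum>t\<in>T. dft N a t * cnj (dft N b t))"

lemma projection_kernel_band:
  assumes "T \<subseteq> {..<N}"
  shows "projection_kernel {..<N} (band_kernel N T)"
proof
  show "band_kernel N T a b = cnj (band_kernel N T b a)" for a b
    by (simp add: band_kernel_def mult.commute)
next
  fix a b assume "a \<in> {..<N}" "b \<in> {..<N}"
  have "(\<Sum>c<N. band_kernel N T a c * band_kernel N T c b)
      = (\<Sum>c<N. \<Sum>t\<in>T. \<Sum>u\<in>T. dft N a t * (cnj (dft N c t) * dft N c u) * cnj (dft N b u))"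
    unfolding band_kernel_def sum_product by (intro sum.cong refl) (simp add: mult_ac)
  also have "\<dots> = (\<Sum>t\<in>T. \<Sum>u\<in>T. dft N a t * (\<Sum>c<N. cnj (dft N c t) * dft N c u) * cnj (dft N b u))"
    by (simp only: sum_distrib_left sum_distrib_right) (subst sum.swap, intro sum.cong refl sum.swap)
  also have "\<dots> = (\<Sum>t\<in>T. \<Sum>u\<in>T. dft N a t * (if t = u then 1 else 0) * cnj (dft N b u))"
  proof (intro sum.cong refl)
    fix t u assume "t \<in> T" "u \<in> T"
    then have "(\<Sum>c<N. cnj (dft N c t) * dft N c u) = (if t = u then 1 else 0)"
      using assms by (intro dft_orthonormal) auto
    then show "dft N a t * (\<Sum>c<N. cnj (dft N c t) * dft N c u) * cnj (dft N b u)
        = dft N a t * (if t = u then 1 else 0) * cnj (dft N b u)" by (simp only:)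
  qed
  also have "\<dots> = (\<Sum>t\<in>T. \<Sum>u\<in>T. if t = u then dft N a t * cnj (dft N b u) else 0)"
    by (intro sum.cong refl) auto
  also have "\<dots> = band_kernel N T a b"
    using finite_subset[OF assms] by (simp add: band_kernel_def)
  finally show "(\<Sum>c<N. band_kernel N T a c * band_kernel N T c b) = band_kernel N T a b" .
qed simp

lemma band_kernel_diag: "Re (band_kernel N T w w) = real (card T) / real N"
proof -
  have "band_kernel N T w w = of_real (\<Sum>t\<in>T. (cmod (dft N w t))\<^sup>2)"
    unfolding band_kernel_def by (simp only: of_real_sum complex_norm_square)
  then show ?thesis by (simp add: cmod_dft)
qed

lemma band_kernel_form:
  assumes "T \<subseteq> {..<N}"
  shows "Re (projection_kernel.walk_form {..<N} (band_kernel N T) S 0 x)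
    = (\<Sum>t\<in>T. (cmod (inverse_dft N x t))\<^sup>2)"
proof -
  interpret projection_kernel "{..<N}" "band_kernel N T" by (rule projection_kernel_band[OF assms])
  have "walk_form S 0 x = (\<Sum>a<N. \<Sum>b<N. \<Sum>t\<in>T. (cnj (dft N b t) * x b) * cnj (cnj (dft N a t) * x a))"
    by (simp add: walk_form_def band_kernel_def sum_distrib_left sum_distrib_right mult_ac)
  also have "\<dots> = (\<Sum>a<N. \<Sum>t\<in>T. \<Sum>b<N. (cnj (dft N b t) * x b) * cnj (cnj (dft N a t) * x a))"
    by (intro sum.cong refl sum.swap)
  also have "\<dots> = (\<Sum>t\<in>T. \<Sum>a<N. \<Sum>b<N. (cnj (dft N b t) * x b) * cnj (cnj (dft N a t) * x a))"
    by (rule sum.swap)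
  also have "\<dots> = (\<Sum>t\<in>T. inverse_dft N x t * cnj (inverse_dft N x t))"
    unfolding inverse_dft_def cnj_sum sum_product
    by (rule sum.cong[OF refl], rule sum.swap)
  also have "\<dots> = of_real (\<Sum>t\<in>T. (cmod (inverse_dft N x t))\<^sup>2)"
    by (simp only: of_real_sum complex_norm_square)
  finally show ?thesis by simp
qed

text \<open>
  In the frequency domain the restriction to \<open>T\<close> is the projection \<open>band_kernel N T\<close>, and the partial
  Fourier matrix is this projection restricted to vectors supported in \<open>\<Omega>\<close>.
\<close>

lemma prob_partial_dft_bound_fails:
  assumes T: "T \<subseteq> {..<N}" "real (card T) \<le> R * real N" and "N > 0"
    and p: "0 \<le> p" "p \<le> 1" and q: "q > 0" "p * (1 + R / q) ^ k \<le> q"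
    and "s > 0" "odd k"
  shows "measure_pmf.prob (random_set N p) {\<Omega>. \<not> partial_dft_bound N s T \<Omega>} \<le> real N * R * (q / s) ^ k"
proof -
  have R: "real (card T) / real N \<le> R" using T \<open>N > 0\<close> by (simp add: divide_simps)
  then have "0 \<le> R" by (rule order_trans[rotated]) simp
  with R have "measure_pmf.prob (random_set N p)
      {S. \<exists>x. (\<forall>a. a \<notin> S \<longrightarrow> x a = 0) \<and>
        Re (projection_kernel.walk_form {..<N} (band_kernel N T) S 0 x) > s * (\<Sum>a\<in>S. (cmod (x a))\<^sup>2)}
    \<le> real N * R * (q / s) ^ k"
    using assms by (intro prob_form_gt_le projection_kernel_band) (auto simp: band_kernel_diag)
  then show ?thesis
    by (simp add: band_kernel_form[OF T(1)] partial_dft_bound_def not_le)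
qed

interpretation dictionary: atoms "{..<N}" "indices N" "dictionary N" for N
  by unfold_locales (simp_all add: indices_def)

lemma dictionary_unit:
  assumes "\<gamma> \<in> indices N"
  shows "(\<Sum>s<N. (cmod (dictionary N s \<gamma>))\<^sup>2) = 1"
proof (cases \<gamma>)
  case (Inl t)
  then have "(\<Sum>s<N. (cmod (dictionary N s \<gamma>))\<^sup>2) = (\<Sum>s<N. if s = t then 1 else 0)"
    by (intro sum.cong) (auto simp: dictionary_def)
  then show ?thesis using assms Inl by (auto simp: indices_def)
next
  case (Inr \<omega>)
  then show ?thesis using assms by (auto simp: dictionary_def cmod_dft indices_def)
qed

text \<open>
  Both bases are orthonormal, so only the cross term between spikes and sinusoids can lower the
  energy, and it is a bilinear form in the partial Fourier matrix.
\<close>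

lemma dictionary_gram_lower:
  assumes sub: "T \<subseteq> {..<N}" "\<Omega> \<subseteq> {..<N}" and bound: "partial_dft_bound N (\<sigma>\<^sup>2) T \<Omega>" and "\<sigma> \<ge> 0"
  shows "dictionary.gram_lower N (1 - \<sigma>) (T <+> \<Omega>)"
  unfolding dictionary.gram_lower_def
proof
  fix z :: "nat + nat \<Rightarrow> complex"
  have fin: "finite T" "finite \<Omega>" using sub finite_subset by auto
  define u where "u s = (if s \<in> T then z (Inl s) else 0)" for s
  define x where "x \<omega> = (if \<omega> \<in> \<Omega> then z (Inr \<omega>) else 0)" for \<omega>
  define a where "a = (\<Sum>t\<in>T. (cmod (z (Inl t)))\<^sup>2)"
  define b where "b = (\<Sum>\<omega>\<in>\<Omega>. (cmod (z (Inr \<omega>)))\<^sup>2)"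
  let ?v = "inverse_dft N x"
  have nonneg: "a \<ge> 0" "b \<ge> 0" by (simp_all add: a_def b_def sum_nonneg)
  have comb: "dictionary.comb N (T <+> \<Omega>) z s = u s + ?v s" for s
  proof -
    have "(\<Sum>t\<in>T. (if s = t then 1 else 0) * z (Inl t)) = (\<Sum>t\<in>T. if s = t then z (Inl t) else 0)"
      by (intro sum.cong) auto
    also have "\<dots> = u s" using fin by (simp add: u_def)
    finally have "(\<Sum>t\<in>T. (if s = t then 1 else 0) * z (Inl t)) = u s" .
    moreover have "(\<Sum>\<omega>\<in>\<Omega>. cnj (dft N \<omega> s) * z (Inr \<omega>)) = ?v s"
      unfolding inverse_dft_def using sub
      by (intro sum.mono_neutral_cong_left) (auto simp: x_def)
    ultimately show ?thesis
      using fin by (simp add: dictionary.comb_def sum.Plus dictionary_def)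
  qed
  have uu: "(\<Sum>s<N. (cmod (u s))\<^sup>2) = a"
    unfolding a_def using sub by (intro sum.mono_neutral_cong_right) (auto simp: u_def)
  have xx: "(\<Sum>\<omega><N. (cmod (x \<omega>))\<^sup>2) = b"
    unfolding b_def using sub by (intro sum.mono_neutral_cong_right) (auto simp: x_def)
  have x\<Omega>: "(\<Sum>\<omega>\<in>\<Omega>. (cmod (x \<omega>))\<^sup>2) = b"
    unfolding b_def by (intro sum.cong) (auto simp: x_def)
  have uT: "(\<Sum>t\<in>T. (cmod (u t))\<^sup>2) = a"
    unfolding a_def by (intro sum.cong) (auto simp: u_def)
  have "(\<Sum>t\<in>T. (cmod (?v t))\<^sup>2) \<le> \<sigma>\<^sup>2 * b"
    using bound[unfolded partial_dft_bound_def, rule_format, of x] x\<Omega> by (simp add: x_def)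
  then have "(cmod (\<Sum>t\<in>T. cnj (u t) * ?v t))\<^sup>2 \<le> a * (\<sigma>\<^sup>2 * b)"
    using nonneg
    by (intro order_trans[OF Cauchy_Schwarz_complex_sum]) (auto simp: uT intro!: mult_left_mono)
  then have "cmod (\<Sum>t\<in>T. cnj (u t) * ?v t) \<le> sqrt (a * (\<sigma>\<^sup>2 * b))"
    by (rule real_le_rsqrt)
  also have "\<dots> = \<sigma> * sqrt (a * b)" using \<open>\<sigma> \<ge> 0\<close> by (simp add: real_sqrt_mult)
  also have "\<dots> \<le> \<sigma> * ((a + b) / 2)"
    using \<open>\<sigma> \<ge> 0\<close> nonneg by (intro mult_left_mono arith_geo_mean_sqrt) auto
  finally have cross: "cmod (\<Sum>t\<in>T. cnj (u t) * ?v t) \<le> \<sigma> * ((a + b) / 2)" .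
  have "(\<Sum>s<N. cnj (u s) * ?v s) = (\<Sum>t\<in>T. cnj (u t) * ?v t)"
    using sub by (intro sum.mono_neutral_right) (auto simp: u_def)
  then have "(\<Sum>s<N. Re (cnj (u s) * ?v s)) = Re (\<Sum>t\<in>T. cnj (u t) * ?v t)"
    by (simp only: Re_sum[symmetric])
  then have cross': "- (\<sigma> * ((a + b) / 2)) \<le> (\<Sum>s<N. Re (cnj (u s) * ?v s))"
    using cross abs_Re_le_cmod[of "\<Sum>t\<in>T. cnj (u t) * ?v t"] by linarith
  have "(cmod (u s + ?v s))\<^sup>2 = (cmod (u s))\<^sup>2 + (cmod (?v s))\<^sup>2 + 2 * Re (cnj (u s) * ?v s)" for s
    unfolding cmod_power2 by (simp add: power2_eq_square algebra_simps)
  then have "(\<Sum>s<N. (cmod (u s + ?v s))\<^sup>2) = a + b + 2 * (\<Sum>s<N. Re (cnj (u s) * ?v s))"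
    by (simp only: sum.distrib uu inverse_dft_parseval xx sum_distrib_left)
  also have "\<dots> \<ge> (1 - \<sigma>) * (a + b)" using cross' by (simp add: field_simps)
  finally show "(1 - \<sigma>) * (\<Sum>\<gamma>\<in>T <+> \<Omega>. (cmod (z \<gamma>))\<^sup>2)
      \<le> (\<Sum>s<N. (cmod (dictionary.comb N (T <+> \<Omega>) z s))\<^sup>2)"
    using fin by (simp add: comb sum.Plus a_def b_def)
qed

text \<open>
  An atom is orthogonal to the other atoms of its own basis and has correlation \<open>1 / sqrt N\<close> with
  every atom of the other one.
\<close>

lemma dictionary_correlation:
  assumes sub: "T \<subseteq> {..<N}" "\<Omega> \<subseteq> {..<N}" and card: "real (card T) \<le> R * real N" "real (card \<Omega>) \<le> R * real N"
    and \<gamma>: "\<gamma> \<in> indices N - (T <+> \<Omega>)"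
  shows "(\<Sum>\<gamma>'\<in>T <+> \<Omega>. (cmod (\<Sum>s<N. cnj (dictionary N s \<gamma>') * dictionary N s \<gamma>))\<^sup>2) \<le> R"
proof -
  have fin: "finite T" "finite \<Omega>" using sub finite_subset by auto
  have N: "N > 0" using \<gamma> by (auto simp: indices_def)
  have R: "real (card T) / real N \<le> R" "real (card \<Omega>) / real N \<le> R"
    using card N by (simp_all add: divide_simps)
  have delta: "(\<Sum>s<N. f s * (if s = t then 1 else 0)) = f t"
    "(\<Sum>s<N. (if s = t then 1 else 0) * f s) = f t" if "t < N" for t and f :: "nat \<Rightarrow> complex"
    using that by (simp_all add: if_distrib[of "\<lambda>c. _ * c"] if_distrib[of "\<lambda>c. c * _"] cong: if_cong)
  show ?thesis
  proof (cases \<gamma>)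
    case (Inl t)
    then have t: "t < N" "t \<notin> T" using \<gamma> by (auto simp: indices_def)
    have "(\<Sum>\<gamma>'\<in>T <+> \<Omega>. (cmod (\<Sum>s<N. cnj (dictionary N s \<gamma>') * dictionary N s \<gamma>))\<^sup>2)
        = (\<Sum>t'\<in>T. (cmod (if t = t' then 1 else 0))\<^sup>2) + (\<Sum>\<omega>\<in>\<Omega>. (cmod (dft N \<omega> t))\<^sup>2)"
      using fin t by (simp add: sum.Plus dictionary_def Inl delta if_distrib[of cnj] cong: if_cong)
    also have "(\<Sum>t'\<in>T. (cmod (if t = t' then 1 else 0))\<^sup>2) = (\<Sum>t'\<in>T. 0)"
      using t by (intro sum.cong) auto
    finally show ?thesis using R by (simp add: cmod_dft)
  next
    case (Inr \<omega>)
    then have w: "\<omega> < N" "\<omega> \<notin> \<Omega>" using \<gamma> by (auto simp: indices_def)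
    have orth: "(\<Sum>s<N. dft N \<omega>' s * cnj (dft N \<omega> s)) = 0" if "\<omega>' \<in> \<Omega>" for \<omega>'
    proof -
      have "(\<Sum>s<N. cnj (dft N \<omega> s) * dft N \<omega>' s) = 0"
        using that w sub by (subst dft_orthonormal_time) auto
      then show ?thesis by (simp add: mult.commute)
    qed
    have "(\<Sum>\<gamma>'\<in>T <+> \<Omega>. (cmod (\<Sum>s<N. cnj (dictionary N s \<gamma>') * dictionary N s \<gamma>))\<^sup>2)
        = (\<Sum>t\<in>T. (cmod (\<Sum>s<N. (if s = t then 1 else 0) * cnj (dft N \<omega> s)))\<^sup>2)
          + (\<Sum>\<omega>'\<in>\<Omega>. (cmod (\<Sum>s<N. dft N \<omega>' s * cnj (dft N \<omega> s)))\<^sup>2)"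
      using fin by (simp add: sum.Plus dictionary_def Inr if_distrib[of cnj] cong: if_cong)
    also have "\<dots> = (\<Sum>t\<in>T. (cmod (dft N \<omega> t))\<^sup>2)"
    proof -
      have "(\<Sum>t\<in>T. (cmod (\<Sum>s<N. (if s = t then 1 else 0) * cnj (dft N \<omega> s)))\<^sup>2)
          = (\<Sum>t\<in>T. (cmod (dft N \<omega> t))\<^sup>2)"
        using sub by (intro sum.cong refl) (subst delta, auto)
      then show ?thesis by (simp add: orth)
    qed
    finally show ?thesis using R by (simp add: cmod_dft)
  qed
qed

section \<open>Measurability of the recovery event\<close>

text \<open>
  A minimum over a compact set is attained, and by continuity it is the infimum over a countable
  subset that meets every open set which meets \<open>K\<close>.
\<close>

lemma sets_ex_compact_le:
  fixes g :: "'m \<Rightarrow> 'h :: second_countable_topology \<Rightarrow> real"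
  assumes "compact K"
    and cont: "\<And>x. x \<in> space M \<Longrightarrow> continuous_on UNIV (g x)"
    and meas: "\<And>h. (\<lambda>x. g x h) \<in> borel_measurable M"
  shows "{x \<in> space M. \<exists>h\<in>K. g x h \<le> 0} \<in> sets M"
proof -
  obtain B :: "'h set set" where B: "countable B" "topological_basis B"
    using ex_countable_basis by blast
  \<comment> \<open>One point of \<open>K\<close> in each basic open set that meets \<open>K\<close>.\<close>
  define pt where "pt b = (SOME h. h \<in> b \<inter> K)" for b
  define D where "D = pt ` {b \<in> B. b \<inter> K \<noteq> {}}"
  have D: "countable D" using B by (auto simp: D_def)
  have pt: "pt b \<in> b \<inter> K" if "b \<inter> K \<noteq> {}" for b
    using that unfolding pt_def by (metis ex_in_conv someI_ex)
  have "(\<exists>h\<in>K. g x h \<le> 0) \<longleftrightarrow> (\<forall>m. \<exists>d\<in>D. g x d < 1 / real (Suc m))" if x: "x \<in> space M" for x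
  proof
    assume "\<exists>h\<in>K. g x h \<le> 0"
    then obtain h where h: "h \<in> K" "g x h \<le> 0" by blast
    show "\<forall>m. \<exists>d\<in>D. g x d < 1 / real (Suc m)"
    proof
      fix m
      let ?U = "{h. g x h < 1 / real (Suc m)}"
      have "open ?U" using cont[OF x] by (intro open_Collect_less continuous_on_const)
      moreover have "h \<in> ?U" using h by (auto intro: le_less_trans)
      ultimately obtain b where b: "b \<in> B" "h \<in> b" "b \<subseteq> ?U"
        using B(2) topological_basisE by blast
      with h have "b \<inter> K \<noteq> {}" by blast
      with b pt[OF this] show "\<exists>d\<in>D. g x d < 1 / real (Suc m)"
        by (intro bexI[of _ "pt b"]) (auto simp: D_def)
    qed
  next
    assume D_small: "\<forall>m. \<exists>d\<in>D. g x d < 1 / real (Suc m)"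
    have "D \<subseteq> K" using pt by (auto simp: D_def)
    with D_small have "K \<noteq> {}" by blast
    then obtain h where h: "h \<in> K" "\<And>k. k \<in> K \<Longrightarrow> g x h \<le> g x k"
      using continuous_attains_inf[OF \<open>compact K\<close>, of "g x"] cont[OF x] continuous_on_subset by blast
    have "g x h < 1 / real (Suc m)" for m
      using D_small h(2) \<open>D \<subseteq> K\<close> by (meson le_less_trans subsetD)
    then have "g x h \<le> 0"
      by (metis inverse_eq_divide not_le order.asym reals_Archimedean)
    with h show "\<exists>h\<in>K. g x h \<le> 0" by blast
  qed
  then have "{x \<in> space M. \<exists>h\<in>K. g x h \<le> 0}
      = (\<Inter>m. \<Union>d\<in>D. {x \<in> space M. g x d < 1 / real (Suc m)}) \<inter> space M"
    by (auto simp del: of_nat_Suc)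
  also have "\<dots> \<in> sets M"
    using D meas by (intro sets.Int sets.countable_INT sets.countable_UN' sets.top) auto
  finally show ?thesis .
qed

lemma compact_cball_function: "compact {h :: 'i \<Rightarrow> complex. \<forall>i. cmod (h i) \<le> r}"
proof -
  have "compactin (product_topology (\<lambda>i :: 'i. euclidean) UNIV) (PiE UNIV (\<lambda>_. cball (0 :: complex) r))"
    by (simp add: compactin_PiE)
  then have "compact (PiE UNIV (\<lambda>_ :: 'i. cball (0 :: complex) r))"
    by (simp only: euclidean_product_topology compactin_euclidean_iff)
  also have "PiE UNIV (\<lambda>_ :: 'i. cball (0 :: complex) r) = {h. \<forall>i. cmod (h i) \<le> r}"
    by (auto simp: PiE_iff)
  finally show ?thesis .
qed

text \<open>
  The vectors that do not vanish on \<open>I\<close> are exhausted by the compact annuli \<open>K n\<close>.  Values off \<open>I\<close>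
  do not affect \<open>g\<close>, by locality, and are set to zero to keep the annuli compact.
\<close>

lemma sets_ex_nonzero_le:
  fixes g :: "'m \<Rightarrow> ('i :: countable \<Rightarrow> complex) \<Rightarrow> real"
  assumes "finite I"
    and cont: "\<And>x. x \<in> space M \<Longrightarrow> continuous_on UNIV (g x)"
    and meas: "\<And>h. (\<lambda>x. g x h) \<in> borel_measurable M"
    and local: "\<And>x h h'. (\<And>i. i \<in> I \<Longrightarrow> h i = h' i) \<Longrightarrow> g x h = g x h'"
  shows "{x \<in> space M. \<exists>h. (\<exists>i\<in>I. h i \<noteq> 0) \<and> g x h \<le> 0} \<in> sets M"
proof -
  define K where "K n = {h :: 'i \<Rightarrow> complex. \<forall>i. cmod (h i) \<le> real n}
    \<inter> {h. 1 / real n \<le> (\<Sum>i\<in>I. cmod (h i))}" for n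
  have "compact (K n)" for n
    unfolding K_def
    by (intro compact_Int_closed compact_cball_function closed_Collect_le continuous_intros
        continuous_on_product_coordinates)
  then have "{x \<in> space M. \<exists>h\<in>K n. g x h \<le> 0} \<in> sets M" for n
    using cont meas by (intro sets_ex_compact_le)
  then have "(\<Union>n\<in>{1..}. {x \<in> space M. \<exists>h\<in>K n. g x h \<le> 0}) \<in> sets M" by (intro sets.countable_UN') auto
  also have "(\<Union>n\<in>{1..}. {x \<in> space M. \<exists>h\<in>K n. g x h \<le> 0})
      = {x \<in> space M. \<exists>h. (\<exists>i\<in>I. h i \<noteq> 0) \<and> g x h \<le> 0}" (is "?L = ?R")
  proof (intro equalityI subsetI)
    fix x assume "x \<in> ?L"
    then obtain n h where n: "n \<ge> 1" and x: "x \<in> space M" and h: "h \<in> K n" "g x h \<le> 0" by auto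
    have "\<exists>i\<in>I. h i \<noteq> 0"
    proof (rule ccontr)
      assume "\<not> ?thesis"
      then have "(\<Sum>i\<in>I. cmod (h i)) = 0" by simp
      with h n show False by (simp add: K_def)
    qed
    with x h show "x \<in> ?R" by blast
  next
    fix x assume "x \<in> ?R"
    then obtain h i where x: "x \<in> space M" and h: "g x h \<le> 0" and i: "i \<in> I" "h i \<noteq> 0" by blast
    define h' where "h' = (\<lambda>i. if i \<in> I then h i else 0)"
    define s where "s = (\<Sum>i\<in>I. cmod (h' i))"
    have le: "cmod (h' j) \<le> s" for j
      unfolding s_def using \<open>finite I\<close>
      by (cases "j \<in> I") (auto intro!: member_le_sum sum_nonneg simp: h'_def)
    have "0 < cmod (h' i)" using i by (simp add: h'_def)
    also have "\<dots> \<le> s" by (rule le)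
    finally have "s > 0" .
    obtain n where n: "max s (1 / s) < real n" using reals_Archimedean2 by blast
    then have "n \<ge> 1" using \<open>s > 0\<close> by (cases n) auto
    have "h' \<in> K n"
    proof -
      have "cmod (h' j) \<le> real n" for j using le[of j] n by simp
      moreover have "1 / real n \<le> s" using n \<open>s > 0\<close> \<open>n \<ge> 1\<close> by (simp add: field_simps)
      ultimately show ?thesis by (simp add: K_def s_def)
    qed
    moreover have "g x h' \<le> 0" using h local[of h h' x] by (simp add: h'_def)
    ultimately show "x \<in> ?L" using x \<open>n \<ge> 1\<close> by blast
  qed
  finally show ?thesis .
qed

lemma is_arg_min_singleton_iff:
  fixes f :: "'a \<Rightarrow> 'b :: linorder"
  assumes "P \<alpha>"
  shows "{x. is_arg_min f P x} = {\<alpha>} \<longleftrightarrow> (\<forall>y. P y \<longrightarrow> y \<noteq> \<alpha> \<longrightarrow> f \<alpha> < f y)"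
proof
  assume L: "{x. is_arg_min f P x} = {\<alpha>}"
  then have \<alpha>: "is_arg_min f P \<alpha>" by blast
  show "\<forall>y. P y \<longrightarrow> y \<noteq> \<alpha> \<longrightarrow> f \<alpha> < f y"
  proof (intro allI impI, rule ccontr)
    fix y assume y: "P y" "y \<noteq> \<alpha>" "\<not> f \<alpha> < f y"
    then have "is_arg_min f P y" using \<alpha> by (auto simp: is_arg_min_def)
    with L y show False by blast
  qed
next
  assume "\<forall>y. P y \<longrightarrow> y \<noteq> \<alpha> \<longrightarrow> f \<alpha> < f y"
  with assms show "{x. is_arg_min f P x} = {\<alpha>}"
    by (fastforce simp: is_arg_min_def)
qed

definition kernel_vector :: "nat \<Rightarrow> (nat + nat \<Rightarrow> complex) \<Rightarrow> bool" where
  "kernel_vector N h \<longleftrightarrow> (\<exists>\<gamma>\<in>indices N. h \<gamma> \<noteq> 0) \<and> (\<forall>s<N. dictionary.comb N (indices N) h s = 0)"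

lemma finite_indices [simp]: "finite (indices N)"
  by (simp add: indices_def)

text \<open>
  Feasible points differ from \<open>\<alpha>\<close> by vectors of the kernel of \<open>\<Phi>\<close>.  The locality of \<open>F\<close> is needed as
  \<open>\<alpha> + h\<close> need not be extensional.
\<close>

lemma unique_minimizer_iff:
  fixes F :: "(nat + nat \<Rightarrow> complex) \<Rightarrow> 'b :: linorder"
  assumes \<alpha>: "\<alpha> \<in> coeff_space N"
    and local: "\<And>x y. (\<And>\<gamma>. \<gamma> \<in> indices N \<Longrightarrow> x \<gamma> = y \<gamma>) \<Longrightarrow> F x = F y"
  shows "{x. is_arg_min F (\<lambda>\<alpha>'. \<alpha>' \<in> coeff_space N \<and> synthesis N \<alpha>' = synthesis N \<alpha>) x} = {\<alpha>}
    \<longleftrightarrow> (\<forall>h. kernel_vector N h \<longrightarrow> F \<alpha> < F (\<lambda>\<gamma>. \<alpha> \<gamma> + h \<gamma>))"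
proof -
  have syn: "synthesis N x = synthesis N y
      \<longleftrightarrow> (\<forall>s<N. dictionary.comb N (indices N) (\<lambda>\<gamma>. x \<gamma> - y \<gamma>) s = 0)" for x y
    by (auto simp: synthesis_def dictionary.comb_def right_diff_distrib sum_subtractf
        restrict_def fun_eq_iff)
  show ?thesis
    unfolding is_arg_min_singleton_iff[of "\<lambda>\<alpha>'. \<alpha>' \<in> coeff_space N \<and> synthesis N \<alpha>' = synthesis N \<alpha>", OF conjI[OF \<alpha> refl]]
  proof (intro iffI allI impI)
    fix h assume L: "\<forall>y. y \<in> coeff_space N \<and> synthesis N y = synthesis N \<alpha> \<longrightarrow> y \<noteq> \<alpha> \<longrightarrow> F \<alpha> < F y"
      and h: "kernel_vector N h"
    define y where "y = (\<lambda>\<gamma>\<in>indices N. \<alpha> \<gamma> + h \<gamma>)"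
    have "y \<in> coeff_space N" by (simp add: y_def coeff_space_def)
    moreover have "synthesis N y = synthesis N \<alpha>"
    proof -
      have "dictionary.comb N (indices N) (\<lambda>\<gamma>. y \<gamma> - \<alpha> \<gamma>) s = dictionary.comb N (indices N) h s" for s
        unfolding dictionary.comb_def by (intro sum.cong) (auto simp: y_def)
      then show ?thesis using h by (simp add: syn kernel_vector_def)
    qed
    moreover have "y \<noteq> \<alpha>" using h by (auto simp: y_def kernel_vector_def fun_eq_iff restrict_def)
    ultimately have "F \<alpha> < F y" using L by blast
    also have "F y = F (\<lambda>\<gamma>. \<alpha> \<gamma> + h \<gamma>)" by (rule local) (simp add: y_def)
    finally show "F \<alpha> < F (\<lambda>\<gamma>. \<alpha> \<gamma> + h \<gamma>)" .
  next
    fix y assume R: "\<forall>h. kernel_vector N h \<longrightarrow> F \<alpha> < F (\<lambda>\<gamma>. \<alpha> \<gamma> + h \<gamma>)"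
      and y: "y \<in> coeff_space N \<and> synthesis N y = synthesis N \<alpha>" "y \<noteq> \<alpha>"
    have "\<exists>\<gamma>\<in>indices N. y \<gamma> \<noteq> \<alpha> \<gamma>"
    proof (rule ccontr)
      assume "\<not> ?thesis"
      then have "y = \<alpha>" using y(1) \<alpha> unfolding coeff_space_def by (intro PiE_ext) auto
      with y show False by blast
    qed
    then have "kernel_vector N (\<lambda>\<gamma>. y \<gamma> - \<alpha> \<gamma>)" using y by (auto simp: kernel_vector_def syn)
    with R have "F \<alpha> < F (\<lambda>\<gamma>. \<alpha> \<gamma> + (y \<gamma> - \<alpha> \<gamma>))" by blast
    then show "F \<alpha> < F y" by simp
  qed
qed

lemma P1_unique_iff:
  assumes "\<alpha> \<in> coeff_space N"
  shows "P1_solutions N (synthesis N \<alpha>) = {\<alpha>}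
    \<longleftrightarrow> (\<forall>h. kernel_vector N h \<longrightarrow> l1_norm N \<alpha> < l1_norm N (\<lambda>\<gamma>. \<alpha> \<gamma> + h \<gamma>))"
  unfolding P1_solutions_def by (rule unique_minimizer_iff[OF assms]) (simp add: l1_norm_def)

lemma P0_unique_iff:
  assumes "\<alpha> \<in> coeff_space N"
  shows "P0_solutions N (synthesis N \<alpha>) = {\<alpha>}
    \<longleftrightarrow> (\<forall>h. kernel_vector N h \<longrightarrow> l0_norm N \<alpha> < l0_norm N (\<lambda>\<gamma>. \<alpha> \<gamma> + h \<gamma>))"
  unfolding P0_solutions_def
  by (rule unique_minimizer_iff[OF assms]) (auto simp: l0_norm_def intro!: arg_cong[where f = card])

lemma continuous_on_comb: "continuous_on UNIV (\<lambda>h. dictionary.comb N (indices N) h s)"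
  unfolding dictionary.comb_def by (intro continuous_intros continuous_on_product_coordinates)

text \<open>
  Failure of either uniqueness is the existence of a nonzero kernel vector with a property that is
  closed in the vector and measurable in \<open>\<alpha>\<close>.  For \<open>(P\<^sub>0)\<close> the counting norm is not continuous,
  so the possible supports of the competitor are enumerated.  Measurability is essential for a lower
  bound on the probability, as sets outside the sigma-algebra have measure \<open>0\<close>.
\<close>

lemma sets_unique_solutions:
  assumes sets: "sets M = sets (\<Pi>\<^sub>M \<gamma>\<in>indices N. borel)"
  shows "{\<alpha> \<in> space M. P1_solutions N (synthesis N \<alpha>) = {\<alpha>} \<and> P0_solutions N (synthesis N \<alpha>) = {\<alpha>}} \<in> sets M"
proof -
  have space: "space M = coeff_space N"
    using sets_eq_imp_space_eq[OF sets] by (simp add: space_PiM coeff_space_def)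
  have [measurable]: "(\<lambda>\<alpha>. \<alpha> \<gamma>) \<in> borel_measurable M" if "\<gamma> \<in> indices N" for \<gamma>
    using measurable_component_singleton[OF that, of "\<lambda>_. borel :: complex measure"]
      measurable_cong_sets[OF sets refl] by blast
  \<comment> \<open>Membership in the kernel enters through this penalty, which is zero exactly on the kernel.\<close>
  define defect where "defect h = (\<Sum>s<N. cmod (dictionary.comb N (indices N) h s))" for h
  have defect_nonneg: "defect h \<ge> 0" for h by (simp add: defect_def sum_nonneg)
  have defect_0: "defect h = 0 \<longleftrightarrow> (\<forall>s<N. dictionary.comb N (indices N) h s = 0)" for h
    by (auto simp: defect_def sum_nonneg_eq_0_iff)
  have defect_local: "defect h = defect h'" if "\<And>\<gamma>. \<gamma> \<in> indices N \<Longrightarrow> h \<gamma> = h' \<gamma>" for h h'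
    unfolding defect_def dictionary.comb_def using that by simp
  have defect_cont: "continuous_on UNIV defect"
    unfolding defect_def by (intro continuous_intros continuous_on_comb)
  define g1 where "g1 \<alpha> h = defect h + max 0 (l1_norm N (\<lambda>\<gamma>. \<alpha> \<gamma> + h \<gamma>) - l1_norm N \<alpha>)" for \<alpha> h
  define g0 where "g0 G \<alpha> h = defect h + (\<Sum>\<gamma>\<in>indices N - G. cmod (\<alpha> \<gamma> + h \<gamma>))" for G \<alpha> h
  define B1 where "B1 = {\<alpha> \<in> space M. \<exists>h. (\<exists>\<gamma>\<in>indices N. h \<gamma> \<noteq> 0) \<and> g1 \<alpha> h \<le> 0}"
  define B0 where "B0 G = {\<alpha> \<in> space M. real (card G) \<le> (\<Sum>\<gamma>\<in>indices N. if \<alpha> \<gamma> = 0 then 0 else 1)}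
    \<inter> {\<alpha> \<in> space M. \<exists>h. (\<exists>\<gamma>\<in>indices N. h \<gamma> \<noteq> 0) \<and> g0 G \<alpha> h \<le> 0}" for G
  have "B1 \<in> sets M"
    unfolding B1_def
  proof (rule sets_ex_nonzero_le)
    show "continuous_on UNIV (g1 \<alpha>)" for \<alpha>
      unfolding g1_def l1_norm_def by (intro continuous_intros continuous_on_product_coordinates defect_cont)
    show "(\<lambda>\<alpha>. g1 \<alpha> h) \<in> borel_measurable M" for h
      unfolding g1_def l1_norm_def by measurable
    show "g1 \<alpha> h = g1 \<alpha> h'" if "\<And>\<gamma>. \<gamma> \<in> indices N \<Longrightarrow> h \<gamma> = h' \<gamma>" for \<alpha> h h'
      using defect_local[of h h'] that by (simp add: g1_def l1_norm_def)
  qed simp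
  moreover have "B0 G \<in> sets M" if "G \<subseteq> indices N" for G
    unfolding B0_def
  proof (rule sets.Int)
    show "{\<alpha> \<in> space M. \<exists>h. (\<exists>\<gamma>\<in>indices N. h \<gamma> \<noteq> 0) \<and> g0 G \<alpha> h \<le> 0} \<in> sets M"
    proof (rule sets_ex_nonzero_le)
      show "continuous_on UNIV (g0 G \<alpha>)" for \<alpha>
        unfolding g0_def by (intro continuous_intros continuous_on_product_coordinates defect_cont)
      show "(\<lambda>\<alpha>. g0 G \<alpha> h) \<in> borel_measurable M" for h
        unfolding g0_def by measurable
      show "g0 G \<alpha> h = g0 G \<alpha> h'" if "\<And>\<gamma>. \<gamma> \<in> indices N \<Longrightarrow> h \<gamma> = h' \<gamma>" for \<alpha> h h'
        using defect_local[of h h'] that by (simp add: g0_def)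
    qed simp
  qed measurable
  ultimately have "space M - (B1 \<union> (\<Union>G\<in>Pow (indices N). B0 G)) \<in> sets M"
    by (intro sets.Diff sets.Un sets.finite_UN sets.top) auto
  also have "space M - (B1 \<union> (\<Union>G\<in>Pow (indices N). B0 G))
    = {\<alpha> \<in> space M. P1_solutions N (synthesis N \<alpha>) = {\<alpha>} \<and> P0_solutions N (synthesis N \<alpha>) = {\<alpha>}}"
  proof -
    have "\<alpha> \<in> B1 \<longleftrightarrow> P1_solutions N (synthesis N \<alpha>) \<noteq> {\<alpha>}" if \<alpha>: "\<alpha> \<in> space M" for \<alpha>
    proof -
      have "g1 \<alpha> h \<le> 0 \<longleftrightarrow> defect h = 0 \<and> l1_norm N (\<lambda>\<gamma>. \<alpha> \<gamma> + h \<gamma>) \<le> l1_norm N \<alpha>" for h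
        unfolding g1_def using defect_nonneg[of h] by (auto simp: max_def)
      then show ?thesis
        using \<alpha> unfolding B1_def P1_unique_iff[OF \<alpha>[unfolded space]] kernel_vector_def defect_0[symmetric]
        by (auto simp: not_less)
    qed
    moreover have "(\<exists>G\<in>Pow (indices N). \<alpha> \<in> B0 G) \<longleftrightarrow> P0_solutions N (synthesis N \<alpha>) \<noteq> {\<alpha>}"
      if \<alpha>: "\<alpha> \<in> space M" for \<alpha>
    proof -
      have l0: "(\<Sum>\<gamma>\<in>indices N. if \<alpha> \<gamma> = 0 then 0 else 1) = real (l0_norm N \<alpha>)"
      proof -
        have "(\<Sum>\<gamma>\<in>indices N. if \<alpha> \<gamma> = 0 then 0 else 1) = (\<Sum>\<gamma>\<in>{\<gamma>\<in>indices N. \<alpha> \<gamma> \<noteq> 0}. 1 :: real)"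
          by (intro sum.mono_neutral_cong_right) auto
        then show ?thesis by (simp add: l0_norm_def)
      qed
      have g0: "g0 G \<alpha> h \<le> 0 \<longleftrightarrow> defect h = 0 \<and> (\<forall>\<gamma>\<in>indices N - G. \<alpha> \<gamma> + h \<gamma> = 0)" for G h
      proof -
        have "0 \<le> (\<Sum>\<gamma>\<in>indices N - G. cmod (\<alpha> \<gamma> + h \<gamma>))" by (simp add: sum_nonneg)
        then have "g0 G \<alpha> h \<le> 0 \<longleftrightarrow> defect h = 0 \<and> (\<Sum>\<gamma>\<in>indices N - G. cmod (\<alpha> \<gamma> + h \<gamma>)) = 0"
          unfolding g0_def using defect_nonneg[of h] by linarith
        then show ?thesis by (simp add: sum_nonneg_eq_0_iff)
      qed
      have mem: "\<alpha> \<in> B0 G \<longleftrightarrow> card G \<le> l0_norm N \<alpha> \<and> (\<exists>h. kernel_vector N h \<and>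
          (\<forall>\<gamma>\<in>indices N - G. \<alpha> \<gamma> + h \<gamma> = 0))" for G
        using \<alpha> by (auto simp add: B0_def l0 g0 defect_0 kernel_vector_def)
      show ?thesis
        unfolding mem P0_unique_iff[OF \<alpha>[unfolded space]] not_all not_imp not_less
      proof (intro iffI; elim exE conjE bexE)
        fix G h assume G: "G \<in> Pow (indices N)" "card G \<le> l0_norm N \<alpha>" and h: "kernel_vector N h"
          and off: "\<forall>\<gamma>\<in>indices N - G. \<alpha> \<gamma> + h \<gamma> = 0"
        have "l0_norm N (\<lambda>\<gamma>. \<alpha> \<gamma> + h \<gamma>) \<le> card G"
          unfolding l0_norm_def using G off finite_subset[OF _ finite_indices, of G N]
          by (intro card_mono) auto
        with G h show "\<exists>h. kernel_vector N h \<and> l0_norm N (\<lambda>\<gamma>. \<alpha> \<gamma> + h \<gamma>) \<le> l0_norm N \<alpha>"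
          using order_trans by blast
      next
        fix h assume "kernel_vector N h" "l0_norm N (\<lambda>\<gamma>. \<alpha> \<gamma> + h \<gamma>) \<le> l0_norm N \<alpha>"
        then show "\<exists>G\<in>Pow (indices N). card G \<le> l0_norm N \<alpha> \<and> (\<exists>h. kernel_vector N h \<and>
            (\<forall>\<gamma>\<in>indices N - G. \<alpha> \<gamma> + h \<gamma> = 0))"
          by (intro bexI[of _ "{\<gamma>\<in>indices N. \<alpha> \<gamma> + h \<gamma> \<noteq> 0}"]) (auto simp: l0_norm_def)
      qed
    qed
    ultimately show ?thesis by blast
  qed
  finally show ?thesis .
qed

section \<open>Coefficients with independent uniform phases\<close>

lemma borel_measurable_Arg2pi [measurable]: "Arg2pi \<in> borel_measurable borel"
  by (rule borel_measurableI_le) (simp add: closed_Arg2pi2pi_le)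

lemma borel_measurable_cis [measurable]: "cis \<in> borel_measurable borel"
  unfolding cis_conv_exp[abs_def] by measurable

lemma sgn_eq_cis_Arg2pi:
  assumes "z \<noteq> 0"
  shows "sgn z = cis (Arg2pi z)"
proof -
  have "z = of_real (cmod z) * cis (Arg2pi z)"
    using Arg2pi[of z] by (simp only: is_Arg_def cis_conv_exp)
  then show ?thesis
    using assms by (metis nonzero_mult_div_cancel_left norm_eq_zero of_real_eq_0_iff sgn_eq)
qed

lemma borel_measurable_sgn_complex [measurable]: "(sgn :: complex \<Rightarrow> complex) \<in> borel_measurable borel"
proof -
  have "(\<lambda>z :: complex. z / of_real (cmod z)) \<in> borel_measurable borel" by measurable
  then show ?thesis by (simp add: sgn_eq[abs_def])
qed

text \<open>
  The integrand is a trigonometric polynomial without constant term, integrated over a full period.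
  The endpoint \<open>2 * pi\<close> missing from the interval is a null set.
\<close>

lemma uniform_phase_integral:
  "(\<integral>\<theta>. Re (u * cis \<theta>) \<partial>uniform_measure lborel {0..<2 * pi}) = 0"
proof -
  let ?F = "\<lambda>\<theta>. Re u * sin \<theta> + Im u * cos \<theta>"
  have "(\<integral>\<theta>. indicator {0..2 * pi} \<theta> *\<^sub>R Re (u * cis \<theta>) \<partial>lborel) = ?F (2 * pi) - ?F 0"
    by (rule integral_FTC_Icc)
      (auto intro!: derivative_eq_intros continuous_intros simp: has_real_derivative_iff_has_vector_derivative[symmetric])
  also have "\<dots> = 0" by simp
  also have "(\<integral>\<theta>. indicator {0..2 * pi} \<theta> *\<^sub>R Re (u * cis \<theta>) \<partial>lborel)
      = (\<integral>\<theta>. indicator {0..<2 * pi} \<theta> *\<^sub>R Re (u * cis \<theta>) \<partial>lborel)"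
  proof (rule integral_cong_AE)
    show "AE \<theta> in lborel. indicator {0..2 * pi} \<theta> *\<^sub>R Re (u * cis \<theta>) = indicator {0..<2 * pi} \<theta> *\<^sub>R Re (u * cis \<theta>)"
      using AE_lborel_singleton[of "2 * pi"] by eventually_elim (auto simp: indicator_def)
  qed measurable
  finally have zero: "(\<integral>\<theta>. indicator {0..<2 * pi} \<theta> *\<^sub>R Re (u * cis \<theta>) \<partial>lborel) = 0" .
  have "uniform_measure lborel {0..<2 * pi} = density lborel (\<lambda>\<theta>. ennreal (indicator {0..<2 * pi} \<theta> / (2 * pi)))"
    unfolding uniform_measure_def
    by (intro density_cong) (auto simp: indicator_def divide_ennreal[symmetric] ennreal_mult)
  then have "(\<integral>\<theta>. Re (u * cis \<theta>) \<partial>uniform_measure lborel {0..<2 * pi})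
      = (\<integral>\<theta>. (indicator {0..<2 * pi} \<theta> / (2 * pi)) *\<^sub>R Re (u * cis \<theta>) \<partial>lborel)"
    by (simp only:) (subst integral_density, auto)
  also have "\<dots> = (\<integral>\<theta>. (indicator {0..<2 * pi} \<theta> *\<^sub>R Re (u * cis \<theta>)) / (2 * pi) \<partial>lborel)"
    by (intro Bochner_Integration.integral_cong) auto
  also have "\<dots> = 0" by (subst integral_divide_zero) (simp only: zero div_0)
  finally show ?thesis .
qed

locale circular_law =
  fixes \<nu> :: "complex measure"
  assumes circular: "continuous_circular \<nu>"
begin

sublocale prob_space \<nu>
  using circular by (simp add: continuous_circular_def)

lemma sets_law [simp, measurable_cong]: "sets \<nu> = sets borel"
  using circular by (auto simp: continuous_circular_def)

lemma space_law [simp]: "space \<nu> = UNIV"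
  using sets_eq_imp_space_eq[OF sets_law] by simp

lemma AE_law_neq: "AE z in \<nu>. z \<noteq> c"
proof -
  obtain g where g: "g \<in> borel_measurable lborel" "\<nu> = density lborel g"
    using circular by (auto simp: continuous_circular_def)
  have "AE z in density lborel g. z \<noteq> c"
    unfolding AE_density[OF g(1)] using AE_lborel_singleton[of c] by eventually_elim simp
  then show ?thesis by (simp only: g(2))
qed

lemma integral_phase: "(\<integral>z. Re (u * sgn z) \<partial>\<nu>) = 0"
proof -
  have "(\<integral>z. Re (u * sgn z) \<partial>\<nu>) = (\<integral>z. Re (u * cis (Arg2pi z)) \<partial>\<nu>)"
  proof (rule integral_cong_AE)
    show "AE z in \<nu>. Re (u * sgn z) = Re (u * cis (Arg2pi z))"
      using AE_law_neq[of 0] by eventually_elim (simp add: sgn_eq_cis_Arg2pi)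
  qed (measurable)
  also have "\<dots> = (\<integral>\<theta>. Re (u * cis \<theta>) \<partial>distr \<nu> borel Arg2pi)"
    by (subst integral_distr) auto
  also have "\<dots> = (\<integral>\<theta>. Re (u * cis \<theta>) \<partial>uniform_measure lborel {0..<2 * pi})"
    using circular by (simp add: continuous_circular_def)
  finally show ?thesis by (simp only: uniform_phase_integral)
qed

end

text \<open>
  The conditional law of the coefficients given the support \<open>G\<close>: independent, with law \<open>\<nu>\<close> on \<open>G\<close> and
  concentrated at zero elsewhere.
\<close>

locale random_coefficients = circular_law \<nu> for \<nu> +
  fixes I G :: "'i set"
  assumes finite_I: "finite I" and G: "G \<subseteq> I"
begin

definition marginal :: "'i \<Rightarrow> complex measure" where
  "marginal \<gamma> = (if \<gamma> \<in> G then \<nu> else return borel 0)"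

lemma prob_space_marginal: "prob_space (marginal \<gamma>)"
  using prob_space_axioms by (auto simp: marginal_def intro!: prob_space_return)

lemma sets_marginal [simp, measurable_cong]: "sets (marginal \<gamma>) = sets borel"
  by (simp add: marginal_def)

lemma space_marginal [simp]: "space (marginal \<gamma>) = UNIV"
  by (simp add: marginal_def)

sublocale joint: product_prob_space marginal I
  by (intro product_prob_spaceI prob_space_marginal)

abbreviation "joint_law \<equiv> \<Pi>\<^sub>M \<gamma>\<in>I. marginal \<gamma>"

lemma AE_support: "AE \<alpha> in joint_law. \<forall>\<gamma>\<in>I. \<alpha> \<gamma> = 0 \<longleftrightarrow> \<gamma> \<notin> G"
proof -
  have "AE \<alpha> in joint_law. \<alpha> \<gamma> = 0 \<longleftrightarrow> \<gamma> \<notin> G" if "\<gamma> \<in> I" for \<gamma>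
  proof (rule AE_PiM_component[OF prob_space_marginal that])
    show "AE z in marginal \<gamma>. z = 0 \<longleftrightarrow> \<gamma> \<notin> G"
      using AE_law_neq[of 0] unfolding marginal_def by (cases "\<gamma> \<in> G") (simp_all add: AE_return)
  qed
  then show ?thesis using finite_I by (simp add: AE_finite_all)
qed

text \<open>
  For fixed values of the other coordinates the functional vanishes for a single value of the
  coordinate \<open>\<gamma>0\<close>, which has probability zero.
\<close>

lemma AE_linear_functional_nonzero:
  assumes "\<gamma>0 \<in> G" "c \<gamma>0 \<noteq> 0"
  shows "AE \<alpha> in joint_law. (\<Sum>\<gamma>\<in>I. c \<gamma> * \<alpha> \<gamma>) \<noteq> 0"
proof -
  define I' where "I' = I - {\<gamma>0}"
  have I: "I = insert \<gamma>0 I'" "finite I'" "\<gamma>0 \<notin> I'" using assms G finite_I by (auto simp: I'_def)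
  let ?Z = "{\<alpha> \<in> space joint_law. (\<Sum>\<gamma>\<in>I. c \<gamma> * \<alpha> \<gamma>) = 0}"
  have Z: "?Z \<in> sets joint_law" by measurable
  have "emeasure joint_law ?Z = (\<integral>\<^sup>+\<alpha>. indicator ?Z \<alpha> \<partial>joint_law)" using Z by simp
  also have "\<dots> = (\<integral>\<^sup>+x. (\<integral>\<^sup>+y. indicator ?Z (x(\<gamma>0 := y)) \<partial>marginal \<gamma>0) \<partial>Pi\<^sub>M I' marginal)"
    using I(2,3) Z unfolding I(1) by (intro joint.product_nn_integral_insert) auto
  also have "\<dots> = (\<integral>\<^sup>+x. 0 \<partial>Pi\<^sub>M I' marginal)"
  proof (rule nn_integral_cong)
    fix x
    define r where "r = (\<Sum>\<gamma>\<in>I'. c \<gamma> * x \<gamma>)"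
    have sum_eq: "(\<Sum>\<gamma>\<in>I. c \<gamma> * (x(\<gamma>0 := y)) \<gamma>) = c \<gamma>0 * y + r" for y
    proof -
      have "(\<Sum>\<gamma>\<in>I'. c \<gamma> * (x(\<gamma>0 := y)) \<gamma>) = r"
        unfolding r_def using I(3) by (intro sum.cong) auto
      then show ?thesis unfolding I(1) using I(2,3) by simp
    qed
    have "AE y in \<nu>. indicator ?Z (x(\<gamma>0 := y)) = (0 :: ennreal)"
      using AE_law_neq[of "- r / c \<gamma>0"]
    proof eventually_elim
      case (elim y)
      then have "c \<gamma>0 * y + r \<noteq> 0"
        using assms(2) by (metis add_eq_0_iff2 mult.commute nonzero_eq_divide_eq)
      then show ?case by (simp only: sum_eq mem_Collect_eq indicator_def) simp
    qed
    then show "(\<integral>\<^sup>+y. indicator ?Z (x(\<gamma>0 := y)) \<partial>marginal \<gamma>0) = 0"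
      using assms(1) by (simp add: marginal_def nn_integral_0_iff_AE nn_integral_cong_AE)
  qed
  finally have "emeasure joint_law ?Z = 0" by simp
  with Z show ?thesis by (subst AE_iff_null) (auto simp: null_sets_def)
qed

lemma indep_coordinates:
  assumes [measurable]: "\<And>\<gamma>. f \<gamma> \<in> borel_measurable borel" and "I \<noteq> {}"
  shows "joint.P.indep_vars (\<lambda>_. borel) (\<lambda>\<gamma> \<alpha>. f \<gamma> (\<alpha> \<gamma>)) I"
proof -
  have "joint.P.indep_vars marginal (\<lambda>\<gamma> \<alpha>. \<alpha> \<gamma>) I"
  proof (subst joint.P.indep_vars_iff_distr_eq_PiM'[OF assms(2)])
    have "distr joint_law joint_law (\<lambda>\<alpha>. \<lambda>\<gamma>\<in>I. \<alpha> \<gamma>) = distr joint_law joint_law (\<lambda>\<alpha>. \<alpha>)"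
      by (intro distr_cong refl) (auto simp: space_PiM PiE_restrict)
    also have "\<dots> = (\<Pi>\<^sub>M \<gamma>\<in>I. distr joint_law (marginal \<gamma>) (\<lambda>\<alpha>. \<alpha> \<gamma>))"
      by (simp add: distr_id2, intro PiM_cong refl)
         (rule distr_PiM_component[OF prob_space_marginal, symmetric])
    finally show "distr joint_law joint_law (\<lambda>\<alpha>. \<lambda>\<gamma>\<in>I. \<alpha> \<gamma>)
        = (\<Pi>\<^sub>M \<gamma>\<in>I. distr joint_law (marginal \<gamma>) (\<lambda>\<alpha>. \<alpha> \<gamma>))" .
  qed measurable
  then show ?thesis
    by (rule joint.P.indep_vars_compose2[where M' = marginal]) measurable
qed

text \<open>
  Hoeffding's inequality for terms with mean zero in \<open>[- |c \<gamma>|, |c \<gamma>|]\<close>.  Off \<open>G\<close> the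
  coefficient is zero.
\<close>

lemma prob_phase_sum_ge:
  assumes c: "\<And>\<gamma>. \<gamma> \<in> I - G \<Longrightarrow> c \<gamma> = 0" and pos: "(\<Sum>\<gamma>\<in>I. (cmod (c \<gamma>))\<^sup>2) > 0" and "d \<ge> 0"
  shows "measure joint_law {\<alpha> \<in> space joint_law. Re (\<Sum>\<gamma>\<in>I. c \<gamma> * sgn (\<alpha> \<gamma>)) \<ge> d}
    \<le> exp (- d\<^sup>2 / (2 * (\<Sum>\<gamma>\<in>I. (cmod (c \<gamma>))\<^sup>2)))"
proof -
  interpret Hoeffding_ineq joint_law I "\<lambda>\<gamma> \<alpha>. Re (c \<gamma> * sgn (\<alpha> \<gamma>))"
    "\<lambda>\<gamma>. - cmod (c \<gamma>)" "\<lambda>\<gamma>. cmod (c \<gamma>)" "\<Sum>\<gamma>\<in>I. joint.P.expectation (\<lambda>\<alpha>. Re (c \<gamma> * sgn (\<alpha> \<gamma>)))"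
  proof unfold_locales
    show "finite I" by (rule finite_I)
    show "joint.P.indep_vars (\<lambda>_. borel) (\<lambda>\<gamma> \<alpha>. Re (c \<gamma> * sgn (\<alpha> \<gamma>))) I"
      using pos by (intro indep_coordinates) (measurable, auto)
    show "AE \<alpha> in joint_law. Re (c \<gamma> * sgn (\<alpha> \<gamma>)) \<in> {- cmod (c \<gamma>)..cmod (c \<gamma>)}" for \<gamma>
    proof (rule AE_I2)
      fix \<alpha> :: "'i \<Rightarrow> complex"
      have "\<bar>Re (c \<gamma> * sgn (\<alpha> \<gamma>))\<bar> \<le> cmod (c \<gamma> * sgn (\<alpha> \<gamma>))" by (rule abs_Re_le_cmod)
      also have "\<dots> \<le> cmod (c \<gamma>)" by (simp add: norm_mult norm_sgn)
      finally show "Re (c \<gamma> * sgn (\<alpha> \<gamma>)) \<in> {- cmod (c \<gamma>)..cmod (c \<gamma>)}" by auto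
    qed
  qed simp
  have mean: "joint.P.expectation (\<lambda>\<alpha>. Re (c \<gamma> * sgn (\<alpha> \<gamma>))) = 0" if "\<gamma> \<in> I" for \<gamma>
  proof (cases "\<gamma> \<in> G")
    case False
    then show ?thesis using c that by simp
  next
    case True
    have "joint.P.expectation (\<lambda>\<alpha>. Re (c \<gamma> * sgn (\<alpha> \<gamma>)))
        = (\<integral>z. Re (c \<gamma> * sgn z) \<partial>distr joint_law (marginal \<gamma>) (\<lambda>\<alpha>. \<alpha> \<gamma>))"
      using that by (subst integral_distr) auto
    also have "distr joint_law (marginal \<gamma>) (\<lambda>\<alpha>. \<alpha> \<gamma>) = \<nu>"
      using True by (subst distr_PiM_component[OF prob_space_marginal that]) (simp add: marginal_def)
    finally show ?thesis by (simp only: integral_phase)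
  qed
  have width: "(\<Sum>\<gamma>\<in>I. (cmod (c \<gamma>) - - cmod (c \<gamma>))\<^sup>2) = 4 * (\<Sum>\<gamma>\<in>I. (cmod (c \<gamma>))\<^sup>2)"
    by (simp add: power2_eq_square sum_distrib_left)
  have "measure joint_law {\<alpha> \<in> space joint_law.
      (\<Sum>\<gamma>\<in>I. joint.P.expectation (\<lambda>\<alpha>. Re (c \<gamma> * sgn (\<alpha> \<gamma>)))) + d \<le> (\<Sum>\<gamma>\<in>I. Re (c \<gamma> * sgn (\<alpha> \<gamma>)))}
    \<le> exp (- 2 * d\<^sup>2 / (4 * (\<Sum>\<gamma>\<in>I. (cmod (c \<gamma>))\<^sup>2)))"
    using Hoeffding_ineq_ge[OF \<open>d \<ge> 0\<close>] pos unfolding width by simp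
  also have "(\<Sum>\<gamma>\<in>I. joint.P.expectation (\<lambda>\<alpha>. Re (c \<gamma> * sgn (\<alpha> \<gamma>)))) = 0"
    by (intro sum.neutral ballI mean)
  finally show ?thesis by (simp only: Re_sum add_0_left) simp
qed

text \<open>
  A complex number of modulus at least one has real part at least \<open>1 / sqrt 2\<close> after multiplication
  by some fourth root of unity.
\<close>

lemma prob_phase_sum_norm_ge:
  assumes c: "\<And>\<gamma>. \<gamma> \<in> I - G \<Longrightarrow> c \<gamma> = 0" and v: "(\<Sum>\<gamma>\<in>I. (cmod (c \<gamma>))\<^sup>2) \<le> v" "v > 0"
  shows "measure joint_law {\<alpha> \<in> space joint_law. cmod (\<Sum>\<gamma>\<in>I. c \<gamma> * sgn (\<alpha> \<gamma>)) \<ge> 1}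
    \<le> 4 * exp (- 1 / (4 * v))"
proof (cases "(\<Sum>\<gamma>\<in>I. (cmod (c \<gamma>))\<^sup>2) = 0")
  case True
  then have "\<And>\<gamma>. \<gamma> \<in> I \<Longrightarrow> c \<gamma> = 0" using finite_I by (simp add: sum_nonneg_eq_0_iff)
  then show ?thesis by simp
next
  case False
  define V where "V = (\<Sum>\<gamma>\<in>I. (cmod (c \<gamma>))\<^sup>2)"
  have "V > 0" using False by (simp add: V_def sum_nonneg order_less_le)
  define A where "A u = {\<alpha> \<in> space joint_law. Re (\<Sum>\<gamma>\<in>I. (u * c \<gamma>) * sgn (\<alpha> \<gamma>)) \<ge> 1 / sqrt 2}" for u
  have A: "A u \<in> sets joint_law" for u unfolding A_def by measurable
  have prob_A: "measure joint_law (A u) \<le> exp (- 1 / (4 * v))" if "cmod u = 1" for u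
  proof -
    have V: "(\<Sum>\<gamma>\<in>I. (cmod (u * c \<gamma>))\<^sup>2) = V" using that by (simp add: V_def norm_mult)
    have "measure joint_law (A u) \<le> exp (- (1 / sqrt 2)\<^sup>2 / (2 * V))"
      unfolding A_def using prob_phase_sum_ge[of "\<lambda>\<gamma>. u * c \<gamma>" "1 / sqrt 2"] c \<open>V > 0\<close> V by simp
    also have "\<dots> \<le> exp (- 1 / (4 * v))"
      using \<open>V > 0\<close> v by (simp add: power_divide V_def[symmetric] frac_le)
    finally show ?thesis .
  qed
  let ?U = "{1, - 1, - \<i>, \<i>}"
  have "{\<alpha> \<in> space joint_law. cmod (\<Sum>\<gamma>\<in>I. c \<gamma> * sgn (\<alpha> \<gamma>)) \<ge> 1} \<subseteq> (\<Union>u\<in>?U. A u)"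
  proof
    fix \<alpha> assume \<alpha>: "\<alpha> \<in> {\<alpha> \<in> space joint_law. cmod (\<Sum>\<gamma>\<in>I. c \<gamma> * sgn (\<alpha> \<gamma>)) \<ge> 1}"
    define w where "w = (\<Sum>\<gamma>\<in>I. c \<gamma> * sgn (\<alpha> \<gamma>))"
    have uw: "(\<Sum>\<gamma>\<in>I. (u * c \<gamma>) * sgn (\<alpha> \<gamma>)) = u * w" for u
      by (simp add: w_def sum_distrib_left mult.assoc)
    have "\<bar>Re w\<bar> \<ge> 1 / sqrt 2 \<or> \<bar>Im w\<bar> \<ge> 1 / sqrt 2"
    proof (rule ccontr)
      assume "\<not> ?thesis"
      then have "\<bar>Re w\<bar>\<^sup>2 < (1 / sqrt 2)\<^sup>2" "\<bar>Im w\<bar>\<^sup>2 < (1 / sqrt 2)\<^sup>2"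
        by (intro power_strict_mono; simp)+
      then have "(Re w)\<^sup>2 + (Im w)\<^sup>2 < 1" by (simp add: power_divide)
      moreover have "1 \<le> (cmod w)\<^sup>2" using \<alpha> by (simp add: w_def)
      ultimately show False by (simp add: cmod_power2)
    qed
    then have "\<exists>u\<in>?U. Re (u * w) \<ge> 1 / sqrt 2" by (auto simp: abs_real_def split: if_splits)
    then obtain u where u: "u \<in> ?U" "Re (u * w) \<ge> 1 / sqrt 2" by blast
    have "\<alpha> \<in> A u" using \<alpha> u(2) by (simp add: A_def uw del: Re_sum)
    with u(1) show "\<alpha> \<in> (\<Union>u\<in>?U. A u)" by blast
  qed
  then have "measure joint_law {\<alpha> \<in> space joint_law. cmod (\<Sum>\<gamma>\<in>I. c \<gamma> * sgn (\<alpha> \<gamma>)) \<ge> 1}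
      \<le> measure joint_law (\<Union>u\<in>?U. A u)"
    using A by (intro joint.P.finite_measure_mono) auto
  also have "\<dots> \<le> (\<Sum>u\<in>?U. measure joint_law (A u))"
    using A by (intro joint.P.finite_measure_subadditive_finite) auto
  also have "\<dots> \<le> (\<Sum>u\<in>?U. exp (- 1 / (4 * v)))"
    by (intro sum_mono prob_A) auto
  also have "\<dots> = real (card ?U) * exp (- 1 / (4 * v))" by simp
  also have "\<dots> \<le> 4 * exp (- 1 / (4 * v))"
    by (intro mult_right_mono) (auto simp: card_insert_if)
  finally show ?thesis .
qed

end

section \<open>Recovery with high probability\<close>

text \<open>
  The deterministic part.  If a competitor \<open>\<alpha> + h\<close> for \<open>(P\<^sub>0)\<close> has its support \<open>G'\<close> inside \<open>G\<close>, then \<open>h\<close>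
  is a kernel vector supported in \<open>G\<close> and vanishes.  Otherwise the functional \<open>\<psi> G'\<close> annihilates
  \<open>\<Phi> (\<alpha> + h) = \<Phi> \<alpha>\<close>, which genericity excludes.
\<close>

lemma unique_solutions_if_certified:
  fixes N :: nat and T \<Omega> :: "nat set" and a :: "nat + nat \<Rightarrow> nat + nat \<Rightarrow> complex"
  defines "G \<equiv> T <+> \<Omega>"
  assumes sub: "T \<subseteq> {..<N}" "\<Omega> \<subseteq> {..<N}"
    and gram: "dictionary.gram_lower N c G" "c > 0"
    and a: "\<And>\<gamma>. \<gamma> \<in> indices N - G \<Longrightarrow> dictionary.normal_eq N G (\<lambda>s. dictionary N s \<gamma>) (a \<gamma>)"
    and \<psi>: "\<And>G' \<gamma>. G' \<in> \<G> \<Longrightarrow> \<gamma> \<in> G' \<Longrightarrow> (\<Sum>s<N. cnj (\<psi> G' s) * dictionary N s \<gamma>) = 0"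
    and \<G>: "\<G> = {G'. G' \<subseteq> indices N \<and> card G' \<le> card G \<and> \<not> G' \<subseteq> G}"
    and \<alpha>: "\<alpha> \<in> coeff_space N" "\<forall>\<gamma>\<in>indices N. \<alpha> \<gamma> = 0 \<longleftrightarrow> \<gamma> \<notin> G"
    and dual: "\<And>\<gamma>. \<gamma> \<in> indices N - G \<Longrightarrow> cmod (\<Sum>\<gamma>'\<in>G. cnj (sgn (\<alpha> \<gamma>')) * a \<gamma> \<gamma>') < 1"
    and generic: "\<And>G'. G' \<in> \<G> \<Longrightarrow>
      (\<Sum>\<gamma>\<in>indices N. (\<Sum>s<N. cnj (\<psi> G' s) * dictionary N s \<gamma>) * \<alpha> \<gamma>) \<noteq> 0"
  shows "P1_solutions N (synthesis N \<alpha>) = {\<alpha>} \<and> P0_solutions N (synthesis N \<alpha>) = {\<alpha>}"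
proof
  have G: "G \<subseteq> indices N" using sub by (auto simp: G_def indices_def)
  show "P1_solutions N (synthesis N \<alpha>) = {\<alpha>}"
    unfolding P1_unique_iff[OF \<alpha>(1)] l1_norm_def
  proof (intro allI impI)
    fix h assume "kernel_vector N h"
    then show "(\<Sum>\<gamma>\<in>indices N. cmod (\<alpha> \<gamma>)) < (\<Sum>\<gamma>\<in>indices N. cmod (\<alpha> \<gamma> + h \<gamma>))"
      using \<alpha>(2) a dual by (intro dictionary.l1_unique[OF G gram]) (auto simp: kernel_vector_def)
  qed
  show "P0_solutions N (synthesis N \<alpha>) = {\<alpha>}"
    unfolding P0_unique_iff[OF \<alpha>(1)]
  proof (intro allI impI, rule ccontr)
    fix h assume h: "kernel_vector N h" and "\<not> l0_norm N \<alpha> < l0_norm N (\<lambda>\<gamma>. \<alpha> \<gamma> + h \<gamma>)"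
    define G' where "G' = {\<gamma>\<in>indices N. \<alpha> \<gamma> + h \<gamma> \<noteq> 0}"
    have "{\<gamma>\<in>indices N. \<alpha> \<gamma> \<noteq> 0} = G" using G \<alpha>(2) by auto
    then have card: "card G' \<le> card G"
      using \<open>\<not> _\<close> by (simp add: l0_norm_def G'_def)
    have comb_h: "dictionary.comb N (indices N) h s = 0" if "s < N" for s
      using h that by (simp add: kernel_vector_def)
    show False
    proof (cases "G' \<subseteq> G")
      case True
      have h0: "h \<gamma> = 0" if "\<gamma> \<in> indices N - G" for \<gamma>
      proof -
        have "\<gamma> \<notin> G'" using True that by blast
        then have "\<alpha> \<gamma> + h \<gamma> = 0" using that by (simp add: G'_def)
        then show ?thesis using \<alpha>(2) that by auto
      qed
      have "dictionary.comb N G h s = dictionary.comb N (indices N) h s" for s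
        unfolding dictionary.comb_def using G h0 by (intro sum.mono_neutral_left) auto
      then have "(\<Sum>s<N. (cmod (dictionary.comb N G h s))\<^sup>2) = 0" using comb_h by simp
      then have "c * (\<Sum>\<gamma>\<in>G. (cmod (h \<gamma>))\<^sup>2) \<le> 0"
        using gram(1) unfolding dictionary.gram_lower_def by metis
      then have "(\<Sum>\<gamma>\<in>G. (cmod (h \<gamma>))\<^sup>2) \<le> 0" using gram(2) by (simp add: mult_le_0_iff)
      then have "(\<Sum>\<gamma>\<in>G. (cmod (h \<gamma>))\<^sup>2) = 0" by (simp add: sum_nonneg antisym)
      then have "\<And>\<gamma>. \<gamma> \<in> G \<Longrightarrow> h \<gamma> = 0"
        using finite_subset[OF G] by (simp add: sum_nonneg_eq_0_iff)
      with h0 h show False by (auto simp: kernel_vector_def)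
    next
      case False
      then have G': "G' \<in> \<G>" using card by (auto simp: \<G> G'_def)
      let ?L = "\<lambda>\<gamma>. \<Sum>s<N. cnj (\<psi> G' s) * dictionary N s \<gamma>"
      have L: "(\<Sum>\<gamma>\<in>indices N. ?L \<gamma> * x \<gamma>) = (\<Sum>s<N. cnj (\<psi> G' s) * dictionary.comb N (indices N) x s)" for x
        unfolding dictionary.comb_def
        by (simp add: sum_distrib_left sum_distrib_right mult.assoc) (rule sum.swap)
      have "(\<Sum>\<gamma>\<in>indices N. ?L \<gamma> * \<alpha> \<gamma>) = (\<Sum>\<gamma>\<in>indices N. ?L \<gamma> * (\<alpha> \<gamma> + h \<gamma>)) - (\<Sum>\<gamma>\<in>indices N. ?L \<gamma> * h \<gamma>)"
        by (simp add: distrib_left sum.distrib)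
      also have "(\<Sum>\<gamma>\<in>indices N. ?L \<gamma> * h \<gamma>) = 0" unfolding L by (simp add: comb_h)
      also have "(\<Sum>\<gamma>\<in>indices N. ?L \<gamma> * (\<alpha> \<gamma> + h \<gamma>)) = 0"
        using \<psi>[OF G'] by (intro sum.neutral) (auto simp: G'_def)
      finally show False using generic[OF G'] by simp
    qed
  qed
qed

text \<open>
  Here the norm of the partial Fourier matrix is at most \<open>1 / 8\<close>, so the Gram matrix is at least
  \<open>7 / 8\<close> and the projection coefficients have square sum at most \<open>R / (7 / 8)\<^sup>2\<close>.
\<close>

lemma prob_unique_given_support:
  assumes circ: "continuous_circular \<nu>"
    and sub: "T \<subseteq> {..<N}" "\<Omega> \<subseteq> {..<N}"
    and card: "real (card T) \<le> R * real N" "real (card \<Omega>) \<le> R * real N"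
    and R: "0 < R" "R < 7 / 8" and bound: "partial_dft_bound N (1 / 64) T \<Omega>"
  shows "measure (coeff_given_support N \<nu> (T, \<Omega>))
      {\<alpha> \<in> space (coeff_given_support N \<nu> (T, \<Omega>)).
        P1_solutions N (synthesis N \<alpha>) = {\<alpha>} \<and> P0_solutions N (synthesis N \<alpha>) = {\<alpha>}}
    \<ge> 1 - 8 * real N * exp (- 49 / (256 * R))"
proof -
  define G where "G = T <+> \<Omega>"
  have G: "G \<subseteq> indices N" using sub by (auto simp: G_def indices_def)
  interpret random_coefficients \<nu> "indices N" G
    using circ G by unfold_locales simp_all
  have law: "coeff_given_support N \<nu> (T, \<Omega>) = joint_law"
    by (simp add: coeff_given_support_def marginal_def[abs_def] G_def[symmetric])
  have gram: "dictionary.gram_lower N (7 / 8) G"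
    using dictionary_gram_lower[OF sub, of "1 / 8"] bound by (simp add: G_def power2_eq_square)
  have corr: "(\<Sum>\<gamma>'\<in>G. (cmod (\<Sum>s<N. cnj (dictionary N s \<gamma>') * dictionary N s \<gamma>))\<^sup>2) \<le> R"
    if "\<gamma> \<in> indices N - G" for \<gamma>
    using dictionary_correlation[OF sub card] that by (simp add: G_def)
  have indep: "\<exists>s\<in>{..<N}. dictionary N s \<gamma> \<noteq> dictionary.comb N G z s" if "\<gamma> \<in> indices N - G" for \<gamma> z
    using corr[OF that] R that
    by (intro dictionary.not_comb_of_small_correlation[OF gram]) (auto simp: dictionary_unit)
  obtain a where a: "\<And>\<gamma>. dictionary.normal_eq N G (\<lambda>s. dictionary N s \<gamma>) (a \<gamma>)"
    using choice[of "\<lambda>\<gamma>. dictionary.normal_eq N G (\<lambda>s. dictionary N s \<gamma>)"]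
      dictionary.ex_normal_eq[OF finite_subset[OF G finite_indices]] by blast
  define \<G> where "\<G> = {G'. G' \<subseteq> indices N \<and> card G' \<le> card G \<and> \<not> G' \<subseteq> G}"
  have "\<forall>G'\<in>\<G>. \<exists>\<psi>. (\<forall>\<gamma>\<in>G'. (\<Sum>s<N. cnj (\<psi> s) * dictionary N s \<gamma>) = 0)
      \<and> (\<exists>\<gamma>\<in>G. (\<Sum>s<N. cnj (\<psi> s) * dictionary N s \<gamma>) \<noteq> 0)"
  proof
    fix G' assume "G' \<in> \<G>"
    then show "\<exists>\<psi>. (\<forall>\<gamma>\<in>G'. (\<Sum>s<N. cnj (\<psi> s) * dictionary N s \<gamma>) = 0)
        \<and> (\<exists>\<gamma>\<in>G. (\<Sum>s<N. cnj (\<psi> s) * dictionary N s \<gamma>) \<noteq> 0)"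
      by (intro dictionary.separating_functional[OF G _ gram _ indep]) (simp_all add: \<G>_def)
  qed
  from bchoice[OF this] obtain \<psi> where \<psi>: "\<And>G' \<gamma>. G' \<in> \<G> \<Longrightarrow> \<gamma> \<in> G' \<Longrightarrow> (\<Sum>s<N. cnj (\<psi> G' s) * dictionary N s \<gamma>) = 0"
      "\<And>G'. G' \<in> \<G> \<Longrightarrow> \<exists>\<gamma>\<in>G. (\<Sum>s<N. cnj (\<psi> G' s) * dictionary N s \<gamma>) \<noteq> 0"
    by blast
  have "finite \<G>" by (rule finite_subset[of _ "Pow (indices N)"]) (auto simp: \<G>_def)
  have generic: "AE \<alpha> in joint_law. \<forall>G'\<in>\<G>.
      (\<Sum>\<gamma>\<in>indices N. (\<Sum>s<N. cnj (\<psi> G' s) * dictionary N s \<gamma>) * \<alpha> \<gamma>) \<noteq> 0"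
  proof (rule AE_finite_allI[OF \<open>finite \<G>\<close>])
    fix G' assume "G' \<in> \<G>"
    then obtain \<gamma> where "\<gamma> \<in> G" "(\<Sum>s<N. cnj (\<psi> G' s) * dictionary N s \<gamma>) \<noteq> 0" using \<psi>(2) by blast
    then show "AE \<alpha> in joint_law.
        (\<Sum>\<gamma>\<in>indices N. (\<Sum>s<N. cnj (\<psi> G' s) * dictionary N s \<gamma>) * \<alpha> \<gamma>) \<noteq> 0"
      by (rule AE_linear_functional_nonzero)
  qed
  define c where "c \<gamma> \<gamma>' = (if \<gamma>' \<in> G then cnj (a \<gamma> \<gamma>') else 0)" for \<gamma> \<gamma>'
  define bad where "bad \<gamma> = {\<alpha> \<in> space joint_law. cmod (\<Sum>\<gamma>'\<in>indices N. c \<gamma> \<gamma>' * sgn (\<alpha> \<gamma>')) \<ge> 1}" for \<gamma>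
  have bad_sets: "bad \<gamma> \<in> sets joint_law" for \<gamma> unfolding bad_def by measurable
  have prob_bad: "measure joint_law (bad \<gamma>) \<le> 4 * exp (- 49 / (256 * R))" if \<gamma>: "\<gamma> \<in> indices N - G" for \<gamma>
  proof -
    have "(\<Sum>\<gamma>'\<in>indices N. (cmod (c \<gamma> \<gamma>'))\<^sup>2) = (\<Sum>\<gamma>'\<in>G. (cmod (a \<gamma> \<gamma>'))\<^sup>2)"
      using G by (intro sum.mono_neutral_cong_right) (auto simp: c_def)
    also have "\<dots> \<le> 64 / 49 * R"
      using dictionary.normal_eq_coeff_bound[OF a gram, of \<gamma>] corr[OF \<gamma>]
      by (simp add: power2_eq_square)
    finally have "measure joint_law (bad \<gamma>) \<le> 4 * exp (- 1 / (4 * (64 / 49 * R)))"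
      unfolding bad_def using R by (intro prob_phase_sum_norm_ge) (auto simp: c_def)
    then show ?thesis by simp
  qed
  let ?good = "{\<alpha> \<in> space joint_law.
    P1_solutions N (synthesis N \<alpha>) = {\<alpha>} \<and> P0_solutions N (synthesis N \<alpha>) = {\<alpha>}}"
  have good_sets: "?good \<in> sets joint_law"
    by (rule sets_unique_solutions) (intro sets_PiM_cong refl sets_marginal)
  have "measure joint_law (space joint_law - ?good) \<le> measure joint_law (\<Union>\<gamma>\<in>indices N - G. bad \<gamma>)"
  proof (rule joint.P.finite_measure_mono_AE)
    show "AE \<alpha> in joint_law. \<alpha> \<in> space joint_law - ?good \<longrightarrow> \<alpha> \<in> (\<Union>\<gamma>\<in>indices N - G. bad \<gamma>)"
      using AE_support generic AE_space
    proof eventually_elim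
      case (elim \<alpha>)
      show ?case
      proof (rule impI, rule ccontr)
        assume \<alpha>: "\<alpha> \<in> space joint_law - ?good" and not_bad: "\<alpha> \<notin> (\<Union>\<gamma>\<in>indices N - G. bad \<gamma>)"
        have dual: "cmod (\<Sum>\<gamma>'\<in>G. cnj (sgn (\<alpha> \<gamma>')) * a \<gamma> \<gamma>') < 1" if "\<gamma> \<in> indices N - G" for \<gamma>
        proof -
          have "(\<Sum>\<gamma>'\<in>indices N. c \<gamma> \<gamma>' * sgn (\<alpha> \<gamma>')) = (\<Sum>\<gamma>'\<in>G. cnj (a \<gamma> \<gamma>') * sgn (\<alpha> \<gamma>'))"
            using G by (intro sum.mono_neutral_cong_right) (auto simp: c_def)
          also have "\<dots> = cnj (\<Sum>\<gamma>'\<in>G. cnj (sgn (\<alpha> \<gamma>')) * a \<gamma> \<gamma>')"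
            by (simp add: mult.commute)
          finally have "cmod (\<Sum>\<gamma>'\<in>indices N. c \<gamma> \<gamma>' * sgn (\<alpha> \<gamma>'))
              = cmod (\<Sum>\<gamma>'\<in>G. cnj (sgn (\<alpha> \<gamma>')) * a \<gamma> \<gamma>')" by (simp only: complex_mod_cnj)
          moreover have "\<alpha> \<notin> bad \<gamma>" using not_bad that by blast
          ultimately show ?thesis using \<alpha> by (simp add: bad_def not_le)
        qed
        have "\<alpha> \<in> coeff_space N" using \<alpha> by (auto simp: space_PiM coeff_space_def)
        then have "\<alpha> \<in> ?good"
          using \<alpha> elim a \<psi>(1) dual unique_solutions_if_certified[OF sub, of "7 / 8" a \<G> \<psi> \<alpha>] gram
          unfolding G_def[symmetric] \<G>_def[symmetric] by auto
        with \<alpha> show False by blast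
      qed
    qed
  qed (use bad_sets in auto)
  also have "\<dots> \<le> (\<Sum>\<gamma>\<in>indices N - G. measure joint_law (bad \<gamma>))"
    using bad_sets by (intro joint.P.finite_measure_subadditive_finite) auto
  also have "\<dots> \<le> (\<Sum>\<gamma>\<in>indices N - G. 4 * exp (- 49 / (256 * R)))"
    by (intro sum_mono prob_bad)
  also have "\<dots> \<le> (\<Sum>\<gamma>\<in>indices N. 4 * exp (- 49 / (256 * R)))"
    by (intro sum_mono2) auto
  also have "\<dots> = 8 * real N * exp (- 49 / (256 * R))"
    by (simp add: indices_def card_Plus)
  finally show ?thesis
    unfolding law using joint.P.prob_compl[OF good_sets] by simp
qed

definition good_support :: "nat \<Rightarrow> real \<Rightarrow> nat set \<times> nat set \<Rightarrow> bool" where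
  "good_support N R = (\<lambda>(T, \<Omega>). real (card T) \<le> R * real N \<and> real (card \<Omega>) \<le> R * real N
    \<and> partial_dft_bound N (1 / 64) T \<Omega>)"

text \<open>
  Both inclusion probabilities are at most \<open>2 / 3 * R\<close>, which leaves a deviation of \<open>R / 3 * N\<close> in Hoeffding's
  inequality for the sizes.  The moment bound is used with \<open>q = 1 / (64 * e)\<close>, that is \<open>1 / e\<close> times
  the target \<open>s = 1 / 64\<close> for the squared norm.
\<close>

lemma prob_good_support_fails:
  assumes "N > 0" and pT: "0 \<le> pT" "pT \<le> 1" and pW: "0 \<le> pW" "pW \<le> 1"
    and p_le: "pT \<le> 2 / 3 * R" "pW \<le> 2 / 3 * R" and R: "0 < R" "R \<le> 1"
    and "odd k" and q: "pW * (1 + 64 * exp 1 * R) ^ k \<le> exp (- 1) / 64"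
  shows "measure_pmf.prob (pair_pmf (random_set N pT) (random_set N pW)) {x. \<not> good_support N R x}
    \<le> 2 * exp (- (2 / 9 * R\<^sup>2 * real N)) + real N * exp (- real k)"
proof -
  let ?P = "pair_pmf (random_set N pT) (random_set N pW)"
  have large: "measure_pmf.prob (random_set N p) {S. \<not> real (card S) \<le> R * real N} \<le> exp (- (2 / 9 * R\<^sup>2 * real N))"
    if "0 \<le> p" "p \<le> 1" "p \<le> 2 / 3 * R" for p
  proof -
    have "measure_pmf.prob (random_set N p) {S. \<not> real (card S) \<le> R * real N}
        \<le> measure_pmf.prob (random_set N p) {S. real (card S) \<ge> real N * p + R / 3 * real N}"
    proof (intro measure_pmf.finite_measure_mono subsetI)
      fix S assume "S \<in> {S. \<not> real (card S) \<le> R * real N}"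
      moreover have "real N * p \<le> 2 / 3 * R * real N"
        using that \<open>N > 0\<close> by (simp add: mult.commute)
      ultimately show "S \<in> {S. real (card S) \<ge> real N * p + R / 3 * real N}" by simp
    qed simp
    also have "\<dots> \<le> exp (- 2 * (R / 3 * real N)\<^sup>2 / real N)"
      using that R \<open>N > 0\<close> by (intro prob_card_random_set_ge) auto
    also have "- 2 * (R / 3 * real N)\<^sup>2 / real N = - (2 / 9 * R\<^sup>2 * real N)"
      using \<open>N > 0\<close> by (simp add: power2_eq_square field_simps)
    finally show ?thesis .
  qed
  define BT where "BT = {x :: nat set \<times> nat set. \<not> real (card (fst x)) \<le> R * real N}"
  define BW where "BW = {x :: nat set \<times> nat set. \<not> real (card (snd x)) \<le> R * real N}"
  define BF where "BF = {x. real (card (fst x)) \<le> R * real N \<and> \<not> partial_dft_bound N (1 / 64) (fst x) (snd x)}"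
  have "measure_pmf.prob ?P BT = measure_pmf.prob (map_pmf fst ?P) {S. \<not> real (card S) \<le> R * real N}"
    by (simp add: BT_def vimage_def)
  then have T: "measure_pmf.prob ?P BT \<le> exp (- (2 / 9 * R\<^sup>2 * real N))"
    using large pT p_le by (simp add: map_fst_pair_pmf)
  have "measure_pmf.prob ?P BW = measure_pmf.prob (map_pmf snd ?P) {S. \<not> real (card S) \<le> R * real N}"
    by (simp add: BW_def vimage_def)
  then have W: "measure_pmf.prob ?P BW \<le> exp (- (2 / 9 * R\<^sup>2 * real N))"
    using large pW p_le by (simp add: map_snd_pair_pmf)
  have F: "measure_pmf.prob ?P BF \<le> real N * exp (- real k)"
  proof -
    have "ennreal (measure_pmf.prob ?P BF) = emeasure ?P BF"
      by (simp add: measure_pmf.emeasure_eq_measure)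
    also have "\<dots> = (\<integral>\<^sup>+x. indicator BF x \<partial>?P)" by simp
    also have "\<dots> = (\<integral>\<^sup>+T. \<integral>\<^sup>+\<Omega>. indicator BF (T, \<Omega>) \<partial>random_set N pW \<partial>random_set N pT)"
      by (rule nn_integral_pair_pmf')
    also have "\<dots> \<le> (\<integral>\<^sup>+T. ennreal (real N * exp (- real k)) \<partial>random_set N pT)"
    proof (intro nn_integral_mono_AE AE_pmfI)
      fix T assume "T \<in> set_pmf (random_set N pT)"
      then have T: "T \<subseteq> {..<N}" by (rule random_set_subset)
      show "(\<integral>\<^sup>+\<Omega>. indicator BF (T, \<Omega>) \<partial>random_set N pW) \<le> ennreal (real N * exp (- real k))"
      proof (cases "real (card T) \<le> R * real N")
        case False
        then show ?thesis by (simp add: BF_def)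
      next
        case True
        have "(\<integral>\<^sup>+\<Omega>. indicator BF (T, \<Omega>) \<partial>random_set N pW)
            = (\<integral>\<^sup>+\<Omega>. indicator {\<Omega>. \<not> partial_dft_bound N (1 / 64) T \<Omega>} \<Omega> \<partial>random_set N pW)"
          using True by (intro nn_integral_cong) (simp add: BF_def indicator_def)
        also have "\<dots> = ennreal (measure_pmf.prob (random_set N pW) {\<Omega>. \<not> partial_dft_bound N (1 / 64) T \<Omega>})"
          by (simp add: measure_pmf.emeasure_eq_measure)
        also have "\<dots> \<le> ennreal (real N * R * ((exp (- 1) / 64) / (1 / 64)) ^ k)"
        proof (intro ennreal_leI prob_partial_dft_bound_fails[OF T True \<open>N > 0\<close> pW])
          show "pW * (1 + R / (exp (- 1) / 64)) ^ k \<le> exp (- 1) / 64"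
            using q by (simp add: exp_minus field_simps)
        qed (use \<open>odd k\<close> in auto)
        also have "((exp (- 1) / 64) / (1 / 64)) ^ k = exp (- real k)"
          by (simp flip: exp_of_nat_mult)
        also have "ennreal (real N * R * exp (- real k)) \<le> ennreal (real N * exp (- real k))"
          using R by (intro ennreal_leI mult_right_mono) (auto intro: mult_left_le)
        finally show ?thesis .
      qed
    qed
    also have "\<dots> = ennreal (real N * exp (- real k))" by simp
    finally show ?thesis by (subst (asm) ennreal_le_iff) auto
  qed
  have "{x. \<not> good_support N R x} \<subseteq> BT \<union> BW \<union> BF"
    by (auto simp: good_support_def BT_def BW_def BF_def)
  then have "measure_pmf.prob ?P {x. \<not> good_support N R x} \<le> measure_pmf.prob ?P (BT \<union> BW \<union> BF)"
    by (intro measure_pmf.finite_measure_mono) auto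
  also have "\<dots> \<le> measure_pmf.prob ?P (BT \<union> BW) + measure_pmf.prob ?P BF"
    by (rule measure_Un_le) auto
  also have "\<dots> \<le> (measure_pmf.prob ?P BT + measure_pmf.prob ?P BW) + measure_pmf.prob ?P BF"
    by (intro add_right_mono measure_Un_le) auto
  finally show ?thesis using T W F by linarith
qed

lemma prob_unique_ge:
  assumes circ: "continuous_circular \<nu>" and R: "0 < R" "R < 7 / 8"
  shows "measure (coeff_law N pT pW \<nu>)
      {\<alpha> \<in> space (coeff_law N pT pW \<nu>).
        P1_solutions N (synthesis N \<alpha>) = {\<alpha>} \<and> P0_solutions N (synthesis N \<alpha>) = {\<alpha>}}
    \<ge> 1 - 8 * real N * exp (- 49 / (256 * R))
      - measure_pmf.prob (pair_pmf (random_set N pT) (random_set N pW)) {x. \<not> good_support N R x}"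
proof -
  let ?P = "pair_pmf (random_set N pT) (random_set N pW)" and ?\<kappa> = "coeff_given_support N \<nu>"
  let ?B = "\<Pi>\<^sub>M \<gamma>\<in>indices N. (borel :: complex measure)"
  define E where "E = {\<alpha> \<in> space ?B.
    P1_solutions N (synthesis N \<alpha>) = {\<alpha>} \<and> P0_solutions N (synthesis N \<alpha>) = {\<alpha>}}"
  let ?\<delta> = "8 * real N * exp (- 49 / (256 * R))"
  interpret circular_law \<nu> using circ by unfold_locales
  have sets_\<kappa>: "sets (?\<kappa> x) = sets ?B" for x
    by (cases x) (auto simp: coeff_given_support_def intro!: sets_PiM_cong split: if_splits)
  have prob_\<kappa>: "prob_space (?\<kappa> x)" for x
    using prob_space_axioms
    by (cases x) (auto simp: coeff_given_support_def intro!: prob_space_PiM prob_space_return)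
  have meas: "?\<kappa> \<in> measurable (measure_pmf ?P) (subprob_algebra ?B)"
    by (auto simp: space_subprob_algebra sets_\<kappa> prob_space_imp_subprob_space[OF prob_\<kappa>])
  have E: "E \<in> sets ?B" unfolding E_def by (rule sets_unique_solutions) simp
  have fin: "finite (set_pmf ?P)" by (simp add: finite_set_random_set)
  have "space (coeff_law N pT pW \<nu>) = space ?B"
    unfolding coeff_law_def by (rule space_bind) (simp_all add: sets_\<kappa>)
  then have "measure (coeff_law N pT pW \<nu>) {\<alpha> \<in> space (coeff_law N pT pW \<nu>).
        P1_solutions N (synthesis N \<alpha>) = {\<alpha>} \<and> P0_solutions N (synthesis N \<alpha>) = {\<alpha>}}
      = measure (coeff_law N pT pW \<nu>) E" by (simp add: E_def)
  also have "\<dots> = (\<integral>x. measure (?\<kappa> x) E \<partial>?P)"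
    unfolding coeff_law_def by (rule measure_pmf.measure_bind[OF meas E])
  also have "\<dots> \<ge> (\<integral>x. (1 - ?\<delta>) - indicator {x. \<not> good_support N R x} x \<partial>?P)"
  proof (intro integral_mono_AE AE_pmfI integrable_measure_pmf_finite[OF fin])
    fix x assume x: "x \<in> set_pmf ?P"
    obtain T \<Omega> where [simp]: "x = (T, \<Omega>)" by (cases x)
    have sub: "T \<subseteq> {..<N}" "\<Omega> \<subseteq> {..<N}" using x random_set_subset by auto
    show "(1 - ?\<delta>) - indicator {x. \<not> good_support N R x} x \<le> measure (?\<kappa> x) E"
    proof (cases "good_support N R x")
      case True
      have "space (?\<kappa> x) = space ?B" by (rule sets_eq_imp_space_eq[OF sets_\<kappa>])
      then show ?thesis
        using prob_unique_given_support[OF circ sub _ _ R] True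
        by (simp add: good_support_def E_def)
    next
      case False
      then show ?thesis using measure_nonneg[of "?\<kappa> x" E] by (simp add: order_trans[of _ 0])
    qed
  qed
  also have "(\<integral>x. (1 - ?\<delta>) - indicator {x. \<not> good_support N R x} x \<partial>?P)
      = (1 - ?\<delta>) - measure_pmf.prob ?P {x. \<not> good_support N R x}"
    by (subst Bochner_Integration.integral_diff)
      (simp_all add: measure_pmf.prob_space integrable_measure_pmf_finite[OF fin])
  finally show ?thesis .
qed

text \<open>
  The two conditions on large \<open>N\<close> make the deviation of the set sizes cost at most \<open>N powr - \<beta>\<close>, and
  make \<open>p\<close> small enough for the moment bound at the odd order \<open>k\<close> between \<open>L\<close> and \<open>2 * L\<close>.
\<close>

lemma prob_coeff_law_ge_large_N:
  fixes \<beta> :: real and N :: nat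
  defines "L \<equiv> (\<beta> + 1) * ln (real N)"
  assumes "\<beta> \<ge> 1" "N \<ge> 512" and circ: "continuous_circular \<nu>"
    and large: "real N / 128 / L\<^sup>2 \<ge> \<beta> * ln (real N)" "L \<ge> 8 * exp (24 * exp 1 + 1)"
    and p: "pT \<in> {0..1}" "pW \<in> {0..1}" "pT \<le> 1 / (8 * L)" "pW \<le> 1 / (8 * L)"
  shows "measure (coeff_law N pT pW \<nu>)
      {\<alpha> \<in> space (coeff_law N pT pW \<nu>).
        P1_solutions N (synthesis N \<alpha>) = {\<alpha>} \<and> P0_solutions N (synthesis N \<alpha>) = {\<alpha>}}
    \<ge> 1 - 11 * real N powr (- \<beta>)"
proof -
  have "1 \<le> exp (24 * exp 1 + 1 :: real)" by (subst one_le_exp_iff) (simp add: add_nonneg_nonneg)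
  then have L: "L \<ge> 8" using large(2) by linarith
  \<comment> \<open>For this value the exponent \<open>49 / (256 * R) = 49 / 48 * L\<close> of the phase bound exceeds \<open>L\<close>.\<close>
  define R where "R = 3 / (16 * L)"
  have R: "0 < R" "R < 7 / 8" using L by (simp_all add: R_def field_simps)
  define k where "k = 2 * nat \<lceil>L / 2\<rceil> + 1"
  have "real (nat \<lceil>L / 2\<rceil>) = of_int \<lceil>L / 2\<rceil>" using L by simp
  then have "L / 2 \<le> real (nat \<lceil>L / 2\<rceil>)" "real (nat \<lceil>L / 2\<rceil>) < L / 2 + 1"
    using ceiling_correct[of "L / 2"] by simp_all
  moreover have "real k = 2 * real (nat \<lceil>L / 2\<rceil>) + 1" by (simp add: k_def)
  ultimately have k: "L \<le> real k" "real k \<le> 2 * L" using L by linarith+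
  have "(1 + 64 * exp 1 * R) ^ k \<le> exp (64 * exp 1 * R) ^ k"
    using R by (intro power_mono exp_ge_add_one_self) (auto intro: add_nonneg_nonneg)
  also have "\<dots> = exp (12 * exp 1 * (real k / L))"
    using L by (simp add: R_def flip: exp_of_nat_mult)
  also have "\<dots> \<le> exp (12 * exp 1 * 2)"
    using k L by (subst exp_le_cancel_iff, intro mult_left_mono) (auto simp: field_simps)
  finally have growth: "(1 + 64 * exp 1 * R) ^ k \<le> exp (24 * exp 1)" by simp
  have "pW * (1 + 64 * exp 1 * R) ^ k \<le> 1 / (8 * L) * exp (24 * exp 1)"
    using p L growth R by (intro mult_mono) (auto intro!: zero_le_power add_nonneg_nonneg)
  also have "\<dots> \<le> exp (- 1) / 64"
    using large(2) L by (simp add: exp_add exp_minus field_simps)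
  finally have q: "pW * (1 + 64 * exp 1 * R) ^ k \<le> exp (- 1) / 64" .
  have exp_L: "real N * exp (- L) = real N powr (- \<beta>)"
  proof -
    have "real N * exp (- L) = exp (ln (real N)) * exp (- L)" using \<open>N \<ge> 512\<close> by simp
    also have "\<dots> = exp (ln (real N) - L)" by (simp only: exp_add[symmetric]) simp
    also have "ln (real N) - L = - \<beta> * ln (real N)" by (simp add: L_def algebra_simps)
    finally show ?thesis using \<open>N \<ge> 512\<close> by (simp add: powr_def)
  qed
  have "measure_pmf.prob (pair_pmf (random_set N pT) (random_set N pW)) {x. \<not> good_support N R x}
      \<le> 2 * exp (- (2 / 9 * R\<^sup>2 * real N)) + real N * exp (- real k)"
    using p L R q \<open>N \<ge> 512\<close> by (intro prob_good_support_fails) (auto simp: R_def k_def)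
  moreover have "exp (- (2 / 9 * R\<^sup>2 * real N)) \<le> real N powr (- \<beta>)"
  proof -
    have "2 / 9 * R\<^sup>2 * real N = real N / 128 / L\<^sup>2" by (simp add: R_def power2_eq_square)
    then show ?thesis using large(1) \<open>N \<ge> 512\<close> by (simp add: powr_def)
  qed
  moreover have "real N * exp (- real k) \<le> real N * exp (- L)"
    using k by (intro mult_left_mono) auto
  moreover have "8 * real N * exp (- 49 / (256 * R)) \<le> 8 * real N * exp (- L)"
    using L by (intro mult_left_mono) (auto simp: R_def field_simps)
  moreover note prob_unique_ge[OF circ R, of N pT pW]
  ultimately show ?thesis using exp_L by linarith
qed

theorem theorem4p2:
  fixes \<beta> :: real
  assumes "\<beta> \<ge> 1"
  shows "\<exists>(\<epsilon> :: nat \<Rightarrow> real) (C :: real). \<epsilon> \<longlonglongrightarrow> 0 \<and> C > 0 \<and>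
    (\<forall>N \<ge> 512. \<forall>p\<^sub>T \<in> {0..1}. \<forall>p\<^sub>\<Omega> \<in> {0..1}. \<forall>\<nu>.
      continuous_circular \<nu> \<longrightarrow>
      min (expected_card N p\<^sub>T) (expected_card N p\<^sub>\<Omega>) \<ge> 4 * (\<beta> + 1) * ln (real N) \<longrightarrow>
      expected_card N p\<^sub>T + expected_card N p\<^sub>\<Omega>
        \<le> real N / ((\<beta> + 1) * ln (real N)) * (1 / 8 + \<epsilon> N) \<longrightarrow>
      measure (coeff_law N p\<^sub>T p\<^sub>\<Omega> \<nu>)
        {\<alpha> \<in> space (coeff_law N p\<^sub>T p\<^sub>\<Omega> \<nu>).
          P1_solutions N (synthesis N \<alpha>) = {\<alpha>} \<and> P0_solutions N (synthesis N \<alpha>) = {\<alpha>}}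
        \<ge> 1 - C * ln (real N) * real N powr (- \<beta>))"
proof -
  have "\<forall>\<^sub>F N in sequentially. \<beta> * ln (real N) \<le> real N / 128 / ((\<beta> + 1) * ln (real N))\<^sup>2"
    using assms by real_asymp
  moreover have "\<forall>\<^sub>F N in sequentially. 8 * exp (24 * exp 1 + 1) \<le> (\<beta> + 1) * ln (real N)"
    using assms by real_asymp
  ultimately have "\<forall>\<^sub>F N in sequentially. \<beta> * ln (real N) \<le> real N / 128 / ((\<beta> + 1) * ln (real N))\<^sup>2
      \<and> 8 * exp (24 * exp 1 + 1) \<le> (\<beta> + 1) * ln (real N)"
    by (rule eventually_conj)
  then obtain N0 where N0: "\<And>N. N \<ge> N0 \<Longrightarrow> \<beta> * ln (real N) \<le> real N / 128 / ((\<beta> + 1) * ln (real N))\<^sup>2"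
      "\<And>N. N \<ge> N0 \<Longrightarrow> 8 * exp (24 * exp 1 + 1) \<le> (\<beta> + 1) * ln (real N)"
    unfolding eventually_sequentially by blast
  \<comment> \<open>The second term makes the lower bound nonpositive for \<open>N < N0\<close>.\<close>
  define C where "C = max 11 (real N0 powr \<beta>)"
  show ?thesis
  proof (rule exI[of _ "\<lambda>_. 0"], rule exI[of _ C], intro conjI allI ballI impI)
    show "C > 0" by (simp add: C_def)
  next
    fix N :: nat and pT pW :: real and \<nu>
    assume "N \<ge> 512" and p: "pT \<in> {0..1}" "pW \<in> {0..1}" and circ: "continuous_circular \<nu>"
      and sum_le: "expected_card N pT + expected_card N pW \<le> real N / ((\<beta> + 1) * ln (real N)) * (1 / 8 + 0)"
    let ?good = "{\<alpha> \<in> space (coeff_law N pT pW \<nu>).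
      P1_solutions N (synthesis N \<alpha>) = {\<alpha>} \<and> P0_solutions N (synthesis N \<alpha>) = {\<alpha>}}"
    have "exp 1 \<le> real N" using exp_le \<open>N \<ge> 512\<close> by simp
    then have ln_ge: "ln (real N) \<ge> 1" using \<open>N \<ge> 512\<close> by (subst ln_ge_iff) auto
    show "measure (coeff_law N pT pW \<nu>) ?good \<ge> 1 - C * ln (real N) * real N powr (- \<beta>)"
    proof (cases "N \<ge> N0")
      case True
      define L where "L = (\<beta> + 1) * ln (real N)"
      have "L > 0" using ln_ge assms by (simp add: L_def)
      have "real N * (pT + pW) \<le> real N * (1 / (8 * L))"
        using sum_le p by (simp add: expected_card_eq L_def algebra_simps)
      then have "pT + pW \<le> 1 / (8 * L)" using \<open>N \<ge> 512\<close> by (subst (asm) mult_le_cancel_left_pos) auto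
      then have "measure (coeff_law N pT pW \<nu>) ?good \<ge> 1 - 11 * real N powr (- \<beta>)"
        using prob_coeff_law_ge_large_N[OF assms \<open>N \<ge> 512\<close> circ N0[OF True] p] p unfolding L_def by auto
      moreover have "11 * real N powr (- \<beta>) \<le> C * ln (real N) * real N powr (- \<beta>)"
        using mult_mono[of 11 C 1 "ln (real N)"] ln_ge by (intro mult_right_mono) (auto simp: C_def)
      ultimately show ?thesis by linarith
    next
      case False
      have "1 = real N powr \<beta> * real N powr (- \<beta>)" using \<open>N \<ge> 512\<close> by (simp flip: powr_add)
      also have "\<dots> \<le> (C * ln (real N)) * real N powr (- \<beta>)"
      proof (rule mult_right_mono)
        have "real N powr \<beta> \<le> real N0 powr \<beta>" using False assms by (intro powr_mono2) auto
        also have "\<dots> \<le> C" by (simp add: C_def)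
        also have "\<dots> \<le> C * ln (real N)" using mult_left_mono[OF ln_ge, of C] by (simp add: C_def)
        finally show "real N powr \<beta> \<le> C * ln (real N)" .
      qed simp
      finally show ?thesis using measure_nonneg[of "coeff_law N pT pW \<nu>" ?good] by linarith
    qed
  qed simp
qed


end
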